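(* Let $N\ge1$ be an integer, $\alpha>0$, and let $H$ be the self-adjoint operator $-\frac{d^2}{dx^2}$ on the infinite star graph with the Exner--Šeba vertex condition, as defined in the context. For $\lambda>0$, let $P(\lambda)$ be the orthogonal spectral projection of $H$ onto the interval $[0,\lambda]$. Then $P(\lambda)$ has the integral kernel $$P(\lambda,x,y)=\int_0^{\sqrt\lambda}\sigma_S(\omega,x,y)\,d\omega ,\qquad x,y>0,$$ where the matrix-valued function $\sigma_S=(\sigma_{Sj}{}^{l})_{j,l=1}^N$ is $$\sigma_{Sj}{}^{l}(\omega,x,y)=\frac2\pi\,\delta_j{}^{l}\sin(\omega x)\sin(\omega y)+\frac{2/\pi}{\alpha^2+N^2\omega^2}\Big\{N\omega^2\cos[\omega(x+y)]+\alpha\omega\sin[\omega(x+y)]\Big\}.$$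
   Context: Operator $H$: on $L^2(0,\infty)^N$, $(Hu)_j=-u_j''$ with domain consisting of all $u=(u_1,\dots,u_N)$ with $u_j\in H^2(0,\infty)$ (Sobolev space) satisfying $u_1(0)=\dots=u_N(0)=:u(0)$ and $\sum_{j=1}^N u_j'(0)=\alpha u(0)$. For $\alpha>0$, $H$ is self-adjoint and nonnegative. $P(\lambda)=\mathbf 1_{[0,\lambda]}(H)$ in the sense of functional calculus. A matrix kernel $K_j{}^{l}(x,y)$ acts on $f\in C_c^\infty((0,\infty))^N$ by $(Kf)_j(x)=\sum_{l=1}^N\int_0^\infty K_j{}^{l}(x,y)f_l(y)\,dy$. $\delta_j{}^{l}$ is the Kronecker delta. *)

theory Defs
  imports "HOL-Analysis.Analysis"
begin

section \<open>Square-integrable functions on the half-line\<close>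

text \<open>
  Elements of \<open>L\<^sup>2(0,\<infinity>)\<close> are handled through representatives \<open>real \<Rightarrow> 'a\<close>: equality in
  \<open>L\<^sup>2\<close> is almost-everywhere equality, and the values at arguments \<open>x \<le> 0\<close> are irrelevant.
  A vector of \<open>N\<close> functions is one function with values in \<open>complex ^ 'n\<close>, where \<open>N = CARD('n)\<close>.
\<close>

abbreviation half_line :: "real measure" where
  "half_line \<equiv> restrict_space lborel {0<..}"

definition L2 :: "(real \<Rightarrow> 'a::real_normed_vector) set" where
  "L2 = {u. u \<in> borel_measurable half_line \<and> integrable half_line (\<lambda>x. (norm (u x))\<^sup>2)}"

definition l2_eq :: "(real \<Rightarrow> 'a) \<Rightarrow> (real \<Rightarrow> 'a) \<Rightarrow> bool" where
  "l2_eq u v \<longleftrightarrow> (AE x in half_line. u x = v x)"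

definition l2_inner :: "(real \<Rightarrow> complex ^ 'n::finite) \<Rightarrow> (real \<Rightarrow> complex ^ 'n) \<Rightarrow> complex" where
  "l2_inner u v = (\<integral>x. (\<Sum>j\<in>UNIV. u x $ j * cnj (v x $ j)) \<partial>half_line)"

definition l2_norm :: "(real \<Rightarrow> 'a::real_normed_vector) \<Rightarrow> real" where
  "l2_norm u = sqrt (\<integral>x. (norm (u x))\<^sup>2 \<partial>half_line)"


section \<open>Test functions, weak derivatives, boundary values\<close>

text \<open>\<open>C\<^sub>c\<^sup>\<infinity>((0,\<infinity>))\<close>, its members being extended by zero to the whole line.\<close>

definition test_function :: "(real \<Rightarrow> 'a::real_normed_vector) \<Rightarrow> bool" where
  "test_function \<phi> \<longleftrightarrow>
     (\<exists>D. D 0 = \<phi> \<and> (\<forall>k x. (D k has_vector_derivative D (Suc k) x) (at x))) \<and>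
     (\<exists>K. compact K \<and> K \<subseteq> {0<..} \<and> (\<forall>x. x \<notin> K \<longrightarrow> \<phi> x = 0))"

definition locally_integrable :: "(real \<Rightarrow> complex) \<Rightarrow> bool" where
  "locally_integrable u \<longleftrightarrow>
     (\<forall>K. compact K \<and> K \<subseteq> {0<..} \<longrightarrow> set_integrable lborel K u)"

definition weak_deriv :: "(real \<Rightarrow> complex) \<Rightarrow> (real \<Rightarrow> complex) \<Rightarrow> bool" where
  "weak_deriv u v \<longleftrightarrow> locally_integrable u \<and> locally_integrable v \<and>
     (\<forall>\<phi>. test_function \<phi> \<longrightarrow>
        (\<integral>x. u x * vector_derivative \<phi> (at x) \<partial>half_line) = - (\<integral>x. v x * \<phi> x \<partial>half_line))"

definition sobolev_H2 :: "(real \<Rightarrow> complex) set" where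
  "sobolev_H2 = {u \<in> L2. \<exists>v\<in>L2. \<exists>w\<in>L2. weak_deriv u v \<and> weak_deriv v w}"

text \<open>\<open>c\<close> is the value at \<open>0\<close> of the representative of \<open>u\<close> that is continuous on \<open>[0,\<infinity>)\<close>.\<close>

definition boundary_value :: "(real \<Rightarrow> complex) \<Rightarrow> complex \<Rightarrow> bool" where
  "boundary_value u c \<longleftrightarrow> (\<exists>g. continuous_on {0..} g \<and> l2_eq u g \<and> g 0 = c)"


section \<open>The operator on the star graph\<close>

text \<open>
  In the domain, \<open>c\<close> is the common vertex value \<open>u(0)\<close> and \<open>d $ j\<close> is \<open>u\<^sub>j'(0)\<close>.
\<close>

definition star_domain :: "real \<Rightarrow> (real \<Rightarrow> complex ^ 'n::finite) set" where
  "star_domain \<alpha> = {u. (\<forall>j. (\<lambda>x. u x $ j) \<in> sobolev_H2) \<and>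
     (\<exists>c. \<exists>d :: complex ^ 'n.
        (\<forall>j. boundary_value (\<lambda>x. u x $ j) c) \<and>
        (\<forall>j. \<exists>v. weak_deriv (\<lambda>x. u x $ j) v \<and> boundary_value v (d $ j)) \<and>
        (\<Sum>j\<in>UNIV. d $ j) = of_real \<alpha> * c)}"

text \<open>Operators are given by their graphs: \<open>star_H \<alpha> u f\<close> says that \<open>u\<close> is in the domain and
  \<open>H u = f\<close>, i.e. \<open>f\<^sub>j = - u\<^sub>j''\<close>.\<close>

definition star_H ::
  "real \<Rightarrow> (real \<Rightarrow> complex ^ 'n::finite) \<Rightarrow> (real \<Rightarrow> complex ^ 'n) \<Rightarrow> bool" where
  "star_H \<alpha> u f \<longleftrightarrow> u \<in> star_domain \<alpha> \<and> f \<in> L2 \<and>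
     (\<forall>j. \<exists>v. weak_deriv (\<lambda>x. u x $ j) v \<and> weak_deriv v (\<lambda>x. - (f x $ j)))"


section \<open>Spectral measures\<close>

definition orthogonal_projection ::
  "((real \<Rightarrow> complex ^ 'n::finite) \<Rightarrow> (real \<Rightarrow> complex ^ 'n)) \<Rightarrow> bool" where
  "orthogonal_projection P \<longleftrightarrow>
     (\<forall>u\<in>L2. P u \<in> L2) \<and>
     (\<forall>u\<in>L2. \<forall>v\<in>L2. l2_eq u v \<longrightarrow> l2_eq (P u) (P v)) \<and>
     (\<forall>u\<in>L2. \<forall>v\<in>L2. \<forall>a b. l2_eq (P (\<lambda>x. a *s u x + b *s v x)) (\<lambda>x. a *s P u x + b *s P v x)) \<and>
     (\<forall>u\<in>L2. l2_eq (P (P u)) (P u)) \<and>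
     (\<forall>u\<in>L2. \<forall>v\<in>L2. l2_inner (P u) v = l2_inner u (P v))"

definition projection_valued_measure ::
  "(real set \<Rightarrow> (real \<Rightarrow> complex ^ 'n::finite) \<Rightarrow> (real \<Rightarrow> complex ^ 'n)) \<Rightarrow> bool" where
  "projection_valued_measure E \<longleftrightarrow>
     (\<forall>S\<in>sets borel. orthogonal_projection (E S)) \<and>
     (\<forall>u\<in>L2. l2_eq (E {} u) (\<lambda>x. 0)) \<and>
     (\<forall>u\<in>L2. l2_eq (E UNIV u) u) \<and>
     (\<forall>S\<in>sets borel. \<forall>T\<in>sets borel. \<forall>u\<in>L2. l2_eq (E (S \<inter> T) u) (E S (E T u))) \<and>
     (\<forall>A :: nat \<Rightarrow> real set. range A \<subseteq> sets borel \<longrightarrow> disjoint_family A \<longrightarrow>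
        (\<forall>u\<in>L2. (\<lambda>n. l2_norm (\<lambda>x. E (\<Union>i. A i) u x - (\<Sum>i<n. E (A i) u x))) \<longlonglongrightarrow> 0))"

text \<open>The measure \<open>S \<mapsto> \<langle>E(S)u, u\<rangle> = \<parallel>E(S)u\<parallel>\<^sup>2\<close>.\<close>

definition scalar_spectral_measure ::
  "(real set \<Rightarrow> (real \<Rightarrow> complex ^ 'n::finite) \<Rightarrow> (real \<Rightarrow> complex ^ 'n)) \<Rightarrow>
   (real \<Rightarrow> complex ^ 'n) \<Rightarrow> real measure" where
  "scalar_spectral_measure E u =
     measure_of UNIV (sets borel) (\<lambda>S. ennreal ((l2_norm (E S u))\<^sup>2))"

text \<open>
  \<open>A = \<integral> t dE(t)\<close>: the domain of \<open>A\<close> consists of the \<open>u\<close> with \<open>\<integral> t\<^sup>2 d\<langle>E(t)u, u\<rangle> < \<infinity>\<close>,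
  and \<open>\<langle>A u, u\<rangle> = \<integral> t d\<langle>E(t)u, u\<rangle>\<close> there (which determines \<open>A\<close> by polarization). For such
  \<open>A\<close> and \<open>E\<close>, the functional calculus gives \<open>\<one>\<^sub>S(A) = E S\<close>.
\<close>

definition spectral_measure_of ::
  "((real \<Rightarrow> complex ^ 'n::finite) \<Rightarrow> (real \<Rightarrow> complex ^ 'n) \<Rightarrow> bool) \<Rightarrow>
   (real set \<Rightarrow> (real \<Rightarrow> complex ^ 'n) \<Rightarrow> (real \<Rightarrow> complex ^ 'n)) \<Rightarrow> bool" where
  "spectral_measure_of A E \<longleftrightarrow> projection_valued_measure E \<and>
     (\<forall>u\<in>L2. (\<exists>v. A u v) \<longleftrightarrow> integrable (scalar_spectral_measure E u) (\<lambda>t. t\<^sup>2)) \<and>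
     (\<forall>u v. A u v \<longrightarrow> l2_inner v u = of_real (\<integral>t. t \<partial>scalar_spectral_measure E u))"


section \<open>Integral kernels\<close>

definition has_kernel ::
  "((real \<Rightarrow> complex ^ 'n::finite) \<Rightarrow> (real \<Rightarrow> complex ^ 'n)) \<Rightarrow>
   ('n \<Rightarrow> 'n \<Rightarrow> real \<Rightarrow> real \<Rightarrow> real) \<Rightarrow> bool" where
  "has_kernel P K \<longleftrightarrow> (\<forall>f. test_function f \<longrightarrow>
     (\<forall>x>0. \<forall>j l. integrable half_line (\<lambda>y. of_real (K j l x y) * f y $ l)) \<and>
     (AE x in half_line. \<forall>j.
        P f x $ j = (\<Sum>l\<in>UNIV. \<integral>y. of_real (K j l x y) * f y $ l \<partial>half_line)))"

definition sigma_S :: "real \<Rightarrow> 'n::finite \<Rightarrow> 'n \<Rightarrow> real \<Rightarrow> real \<Rightarrow> real \<Rightarrow> real" where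
  "sigma_S \<alpha> j l \<omega> x y = (let N = real CARD('n) in
     2 / pi * (if j = l then 1 else 0) * sin (\<omega> * x) * sin (\<omega> * y)
     + (2 / pi) / (\<alpha>\<^sup>2 + N\<^sup>2 * \<omega>\<^sup>2)
         * (N * \<omega>\<^sup>2 * cos (\<omega> * (x + y)) + \<alpha> * \<omega> * sin (\<omega> * (x + y))))"

end

(*
  Existence of a spectral measure is assumed, so it only has to be identified.  Write
  R = (H + c)^-1 with c = k^2.  On continuous, exponentially decaying f the resolvent R is an
  explicit integral operator, and the Fourier integrals of cos and sin show that its kernel is the
  integral of sigma_S(w) / (c + w^2) over w > 0; moreover sigma_S(w) R = sigma_S(w) / (c + w^2),
  since the columns of sigma_S(w) satisfy the vertex condition.  Hence
    <R^n f, f> = integral over w > 0 of (c + w^2)^-n <sigma_S(w) f, f>   for n >= 1.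
  On the spectral side, the measure mu_f of f satisfies mu_f = (c + t)^2 mu_(R f), which is read off
  from the quadratic form of H on short spectral intervals, so that <R^n f, f> is also the n-th moment of
  mu_f in the variable x = 1 / (c + t).  These moments confine x to a bounded interval (so
  nonnegativity of H never has to be proved), and by the Weierstrass theorem they determine mu_f.
  This gives <E[0,lam] f, f>; polarization gives the kernel.
*)
theory Submission
  imports Defs "HOL-Probability.Sinc_Integral"
begin

section \<open>Measures on the line and their moments\<close>

text \<open>The definition of the spectral measure prescribes only the domain and the quadratic form
  of H; that H commutes with the projections is not part of it. So the relation between the measures
  of f and R f cannot be read off by applying E S to an equation. Instead the form is varied in a
  direction from the range of E S, for S inside an interval of length d; the error is of first order
  in d and disappears as the intervals shrink.

  On the frequency side <sigma_S(w) f, f> is bounded in w, but neither its sign nor its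
  integrability over w > 0 is available. This shapes the moment argument: moments start at n = 1,
  polynomials carry the factor x^2, and two linear functionals are compared rather than two
  measures. A single real energy - k^2 suffices, with no boundary values from complex energies.

  Exponential decay at a rate below k is preserved by R, so all powers R^n f stay explicit. The
  functions sigma_S(w) f are only bounded; hence they enter through pairings with decaying
  functions.\<close>

text \<open>The square roots are norms: in the application they are the lengths of the projections
  of u and (A + c) u to the spectral set S. On cells of length d the hypothesis compares N with (c +
  t)^2 M up to an error of first order in d. The errors sum to a multiple of d because M is finite
  and |c + t| is M-integrable; then d tends to 0.\<close>

lemma density_square_of_sandwich:
  fixes M N :: "real measure" and c :: real
  assumes fM: "finite_measure M" and fN: "finite_measure N"
    and sM: "sets M = sets borel" and sN: "sets N = sets borel"
    and sq: "integrable M (\<lambda>t. t\<^sup>2)"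
    and sand: "\<And>a b S. a < b \<Longrightarrow> S \<in> sets borel \<Longrightarrow> S \<subseteq> {a..b} \<Longrightarrow>
      \<bar>sqrt (measure N S) - \<bar>c + a\<bar> * sqrt (measure M S)\<bar> \<le> (b - a) * sqrt (measure M S)"
  shows "N = density M (\<lambda>t. ennreal ((c + t)\<^sup>2))"
proof (rule measure_eqI)
  interpret M: finite_measure M by fact
  interpret N: finite_measure N by fact
  have [measurable_cong]: "sets M = sets borel" by fact
  show "sets N = sets (density M (\<lambda>t. ennreal ((c + t)\<^sup>2)))" using sM sN by simp
  fix S assume "S \<in> sets N"
  hence S[measurable]: "S \<in> sets borel" using sN by simp
  define T where "T t = \<bar>c + t\<bar>" for t
  have [measurable]: "T \<in> borel_measurable borel" unfolding T_def by measurable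
  define X where "X = (\<integral>\<^sup>+t. ennreal (T t) * indicator S t \<partial>M)"
  have "integrable M T"
  proof (rule Bochner_Integration.integrable_bound[where f = "\<lambda>t. \<bar>c\<bar> + 1 + t\<^sup>2"])
    show "AE t in M. norm (T t) \<le> norm (\<bar>c\<bar> + 1 + t\<^sup>2)"
    proof (intro always_eventually allI)
      fix t :: real
      have "\<bar>t\<bar> \<le> 1 + t\<^sup>2"
      proof -
        have "0 \<le> (\<bar>t\<bar> - 1)\<^sup>2" by simp
        hence "2 * \<bar>t\<bar> \<le> 1 + t\<^sup>2" by (simp add: power2_diff)
        thus ?thesis by linarith
      qed
      thus "norm (T t) \<le> norm (\<bar>c\<bar> + 1 + t\<^sup>2)" unfolding T_def by auto
    qed
  qed (use sq in auto)
  hence "X < \<infinity>"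
  proof -
    have "X \<le> (\<integral>\<^sup>+t. ennreal (T t) \<partial>M)" unfolding X_def
      by (intro nn_integral_mono) (auto split: split_indicator)
    also have "\<dots> < \<infinity>"
      using \<open>integrable M T\<close> unfolding integrable_iff_bounded by (simp add: T_def)
    finally show ?thesis .
  qed
  define D where "D = (\<integral>\<^sup>+t. ennreal ((T t)\<^sup>2) * indicator S t \<partial>M)"
  \<comment> \<open>Expanding (T + 2 d)^2 leaves the error 4 d T + 4 d^2, which integrates over S to
    at most d K as soon as d \<le> 1.\<close>
  define K where "K = 4 * enn2real X + 4 * measure M S"
  have K0: "0 \<le> K" unfolding K_def by simp
  define I where "I d k = {d * real_of_int k ..< d * (real_of_int k + 1)}" for d k
  have UN: "S = (\<Union>k. S \<inter> I d k)" if "d > 0" for d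
  proof -
    have "t \<in> I d (floor (t / d))" for t
    proof -
      have "real_of_int (floor (t / d)) \<le> t / d" "t / d < real_of_int (floor (t / d)) + 1"
        by linarith+
      hence "d * real_of_int (floor (t / d)) \<le> d * (t / d)" "d * (t / d) < d * (real_of_int (floor (t / d)) + 1)"
        using that by (intro mult_left_mono mult_strict_left_mono; simp)+
      thus ?thesis unfolding I_def using that by simp
    qed
    thus ?thesis by blast
  qed
  have disj: "disjoint_family (\<lambda>k. S \<inter> I d k)" if "d > 0" for d
  proof -
    have "k = floor (t / d)" if "t \<in> I d k" for t k
      using that \<open>d > 0\<close> unfolding I_def
      by (intro floor_unique[symmetric]) (auto simp: field_simps)
    thus ?thesis unfolding disjoint_family_on_def by blast
  qed
  have meas[measurable]: "S \<inter> I d k \<in> sets borel" for d k unfolding I_def by measurable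
  have sub: "S \<inter> I d k \<subseteq> {d * real_of_int k .. d * real_of_int k + d}" for d k
    unfolding I_def by (auto simp: algebra_simps)
  have split: "emeasure L S = (\<integral>\<^sup>+k. emeasure L (S \<inter> I d k) \<partial>count_space UNIV)"
    if "d > 0" "sets L = sets borel" for d and L :: "real measure"
  proof -
    have "emeasure L (\<Union>k. S \<inter> I d k) = (\<integral>\<^sup>+k. emeasure L (S \<inter> I d k) \<partial>count_space UNIV)"
      by (rule emeasure_UN_countable) (use that disj in auto)
    thus ?thesis using UN[OF that(1)] by simp
  qed
  have root: "sqrt (measure L A) ^ 2 = measure L A" for L :: "real measure" and A by simp
  have up: "emeasure N S \<le> D + ennreal (d * K)" if d: "d > 0" "d \<le> 1" for d
  proof -
    \<comment> \<open>One d comes from the hypothesis, the other from replacing the left end of a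
      cell by an arbitrary point t of it.\<close>
    define L where "L = density M (\<lambda>t. ennreal ((T t + 2 * d)\<^sup>2))"
    have sL: "sets L = sets borel" unfolding L_def using sM by simp
    have "emeasure N (S \<inter> I d k) \<le> emeasure L (S \<inter> I d k)" for k
    proof -
      define a where "a = d * real_of_int k"
      let ?S = "S \<inter> I d k"
      have ss: "?S \<subseteq> {a..a+d}" using sub unfolding a_def by auto
      have "\<bar>sqrt (measure N ?S) - \<bar>c + a\<bar> * sqrt (measure M ?S)\<bar> \<le> d * sqrt (measure M ?S)"
        using sand[of a "a + d" ?S] d ss by auto
      hence "sqrt (measure N ?S) \<le> (\<bar>c + a\<bar> + d) * sqrt (measure M ?S)"
        by (simp add: algebra_simps)
      hence "sqrt (measure N ?S) ^ 2 \<le> ((\<bar>c + a\<bar> + d) * sqrt (measure M ?S))\<^sup>2"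
        by (intro power_mono) auto
      hence "measure N ?S \<le> (\<bar>c + a\<bar> + d)\<^sup>2 * measure M ?S"
        by (simp add: power_mult_distrib)
      hence "emeasure N ?S \<le> ennreal ((\<bar>c + a\<bar> + d)\<^sup>2) * emeasure M ?S"
        unfolding N.emeasure_eq_measure M.emeasure_eq_measure
        by (simp add: ennreal_mult[symmetric] ennreal_leI)
      also have "\<dots> = (\<integral>\<^sup>+t. ennreal ((\<bar>c + a\<bar> + d)\<^sup>2) * indicator ?S t \<partial>M)"
        by (subst nn_integral_cmult_indicator) (use meas sM in auto)
      also have "\<dots> \<le> (\<integral>\<^sup>+t. ennreal ((T t + 2 * d)\<^sup>2) * indicator ?S t \<partial>M)"
      proof (intro nn_integral_mono)
        fix t
        show "ennreal ((\<bar>c + a\<bar> + d)\<^sup>2) * indicator ?S t \<le> ennreal ((T t + 2 * d)\<^sup>2) * indicator ?S t"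
        proof (cases "t \<in> ?S")
          case True
          hence "a \<le> t" "t \<le> a + d" using ss by auto
          hence "\<bar>c + a\<bar> + d \<le> T t + 2 * d" unfolding T_def by linarith
          hence "(\<bar>c + a\<bar> + d)\<^sup>2 \<le> (T t + 2 * d)\<^sup>2" using d by (intro power_mono) auto
          thus ?thesis using True by (simp add: ennreal_leI)
        qed simp
      qed
      also have "\<dots> = emeasure L ?S" unfolding L_def
        by (subst emeasure_density) (use meas sM in auto)
      finally show ?thesis .
    qed
    hence "emeasure N S \<le> emeasure L S"
      unfolding split[OF d(1) sN] split[OF d(1) sL] by (intro nn_integral_mono)
    also have "emeasure L S = (\<integral>\<^sup>+t. ennreal ((T t + 2 * d)\<^sup>2) * indicator S t \<partial>M)"
      unfolding L_def by (subst emeasure_density) (use sM in auto)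
    also have "\<dots> = (\<integral>\<^sup>+t. (ennreal ((T t)\<^sup>2) * indicator S t + ennreal (4 * d) * (ennreal (T t) * indicator S t))
         + ennreal (4 * d\<^sup>2) * indicator S t \<partial>M)"
    proof (intro nn_integral_cong)
      fix t
      have "(T t + 2 * d)\<^sup>2 = (T t)\<^sup>2 + 4 * d * T t + 4 * d\<^sup>2" by (simp add: power2_eq_square algebra_simps)
      moreover have "0 \<le> T t" by (simp add: T_def)
      ultimately have "ennreal ((T t + 2 * d)\<^sup>2) = ennreal ((T t)\<^sup>2) + ennreal (4 * d) * ennreal (T t) + ennreal (4 * d\<^sup>2)"
        using d by (simp add: ennreal_mult'[symmetric] ennreal_plus[symmetric] del: ennreal_plus)
      thus "ennreal ((T t + 2 * d)\<^sup>2) * indicator S t = (ennreal ((T t)\<^sup>2) * indicator S t + ennreal (4 * d) * (ennreal (T t) * indicator S t))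
         + ennreal (4 * d\<^sup>2) * indicator S t" by (auto split: split_indicator)
    qed
    also have "\<dots> = D + ennreal (4 * d) * X + ennreal (4 * d\<^sup>2) * emeasure M S"
      unfolding D_def X_def
      by (subst nn_integral_add, measurable, subst nn_integral_add, measurable)
         (use sM in \<open>simp add: nn_integral_cmult\<close>)
    also have "\<dots> = D + ennreal (4 * d * enn2real X + 4 * d\<^sup>2 * measure M S)"
    proof -
      have "ennreal (4 * d) * X = ennreal (4 * d * enn2real X)"
        using \<open>X < \<infinity>\<close> d by (simp add: ennreal_mult)
      moreover have "ennreal (4 * d\<^sup>2) * emeasure M S = ennreal (4 * d\<^sup>2 * measure M S)"
        by (simp add: M.emeasure_eq_measure ennreal_mult)
      ultimately show ?thesis using d by (simp add: add.assoc)
    qed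
    also have "\<dots> \<le> D + ennreal (d * K)"
    proof -
      have "d\<^sup>2 \<le> d" using d by (simp add: power2_eq_square mult_left_le)
      hence "4 * d\<^sup>2 * measure M S \<le> 4 * d * measure M S" by (intro mult_right_mono) auto
      thus ?thesis unfolding K_def by (intro add_left_mono ennreal_leI) (simp add: algebra_simps)
    qed
    finally show ?thesis .
  qed
  have low: "D \<le> emeasure N S + ennreal (d * K)" if d: "d > 0" for d
  proof -
    define L where "L = density M (\<lambda>t. ennreal ((T t)\<^sup>2))"
    define L' where "L' = density M (\<lambda>t. ennreal (4 * d * T t))"
    have sL: "sets L = sets borel" "sets L' = sets borel" unfolding L_def L'_def using sM by auto
    have "emeasure L (S \<inter> I d k) \<le> emeasure N (S \<inter> I d k) + emeasure L' (S \<inter> I d k)" for k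
    proof -
      define a where "a = d * real_of_int k"
      let ?S = "S \<inter> I d k"
      \<comment> \<open>Truncation at 0 makes squaring legitimate on the cells close to - c, where
        the lower bound is vacuous.\<close>
      define e where "e = max 0 (\<bar>c + a\<bar> - d)"
      have ss: "?S \<subseteq> {a..a+d}" using sub unfolding a_def by auto
      have "\<bar>sqrt (measure N ?S) - \<bar>c + a\<bar> * sqrt (measure M ?S)\<bar> \<le> d * sqrt (measure M ?S)"
        using sand[of a "a + d" ?S] d ss by auto
      hence "(\<bar>c + a\<bar> - d) * sqrt (measure M ?S) \<le> sqrt (measure N ?S)"
        by (simp add: algebra_simps)
      hence "e * sqrt (measure M ?S) \<le> sqrt (measure N ?S)"
        unfolding e_def by (auto simp: max_def)
      hence "(e * sqrt (measure M ?S))^2 \<le> (sqrt (measure N ?S))\<^sup>2"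
        by (intro power_mono) (auto simp: e_def)
      hence *: "e\<^sup>2 * measure M ?S \<le> measure N ?S"
        by (simp add: power_mult_distrib)
      have "emeasure L ?S = (\<integral>\<^sup>+t. ennreal ((T t)\<^sup>2) * indicator ?S t \<partial>M)"
        unfolding L_def by (subst emeasure_density) (use meas sM in auto)
      also have "\<dots> \<le> (\<integral>\<^sup>+t. ennreal (e\<^sup>2) * indicator ?S t + ennreal (4 * d * T t) * indicator ?S t \<partial>M)"
      proof (intro nn_integral_mono)
        fix t
        show "ennreal ((T t)\<^sup>2) * indicator ?S t \<le> ennreal (e\<^sup>2) * indicator ?S t + ennreal (4 * d * T t) * indicator ?S t"
        proof (cases "t \<in> ?S")
          case True
          have T0: "0 \<le> T t" by (simp add: T_def)
          have "a \<le> t" "t \<le> a + d" using True ss by auto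
          hence A: "T t - 2 * d \<le> e" unfolding T_def e_def by linarith
          have "(T t)\<^sup>2 \<le> e\<^sup>2 + 4 * d * T t"
          \<comment> \<open>Squaring T - 2 d \<le> e needs T \<ge> 2 d; for smaller T the term 4 d T
            alone dominates T^2.\<close>
          proof (cases "T t \<ge> 2 * d")
            case True
            hence "(T t - 2 * d)\<^sup>2 \<le> e\<^sup>2" using A by (intro power_mono) auto
            moreover have "(T t - 2 * d)\<^sup>2 = (T t)\<^sup>2 - 4 * d * T t + 4 * d\<^sup>2"
              by (simp add: power2_eq_square algebra_simps)
            moreover have "0 \<le> 4 * d\<^sup>2" by simp
            ultimately show ?thesis by linarith
          next
            case False
            hence "T t * T t \<le> (4 * d) * T t" using T0 d by (intro mult_right_mono) auto
            hence "(T t)\<^sup>2 \<le> 4 * d * T t" by (simp add: power2_eq_square)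
            thus ?thesis using zero_le_power2[of e] by linarith
          qed
          hence "ennreal ((T t)\<^sup>2) \<le> ennreal (e\<^sup>2) + ennreal (4 * d * T t)"
            using d T0 by (simp add: ennreal_leI ennreal_plus[symmetric] del: ennreal_plus)
          thus ?thesis using True by simp
        qed simp
      qed
      also have "\<dots> = ennreal (e\<^sup>2) * emeasure M ?S + emeasure L' ?S"
        unfolding L'_def
        by (subst nn_integral_add) (use meas sM in \<open>auto simp: nn_integral_cmult_indicator emeasure_density\<close>)
      also have "ennreal (e\<^sup>2) * emeasure M ?S \<le> emeasure N ?S"
        unfolding N.emeasure_eq_measure M.emeasure_eq_measure using *
        by (simp add: ennreal_mult[symmetric] ennreal_leI)
      finally show ?thesis by (simp add: add_right_mono)
    qed
    hence "emeasure L S \<le> (\<integral>\<^sup>+k. emeasure N (S \<inter> I d k) + emeasure L' (S \<inter> I d k) \<partial>count_space UNIV)"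
      unfolding split[OF d sL(1)] by (intro nn_integral_mono)
    also have "\<dots> = emeasure N S + emeasure L' S"
      unfolding split[OF d sN] split[OF d sL(2)] by (intro nn_integral_add) auto
    also have "emeasure L' S = ennreal (4 * d) * X" unfolding L'_def X_def
      by (subst emeasure_density)
         (use sM d in \<open>auto simp: nn_integral_cmult[symmetric] ennreal_mult' T_def mult.assoc\<close>)
    also have "\<dots> = ennreal (4 * d * enn2real X)"
      using \<open>X < \<infinity>\<close> d by (simp add: ennreal_mult)
    also have "\<dots> \<le> ennreal (d * K)"
      unfolding K_def using d by (intro ennreal_leI) (simp add: algebra_simps)
    also have "emeasure L S = D" unfolding L_def D_def
      by (subst emeasure_density) (use sM in auto)
    finally show ?thesis by (simp add: add_left_mono)
  qed
  \<comment> \<open>The 1 in K + 1 covers K = 0.\<close>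
  have ex: "\<exists>d>0. d \<le> 1 \<and> d * K \<le> e" if "e > 0" for e
    using that K0 by (intro exI[of _ "min 1 (e / (K + 1))"])
      (auto simp: min_def field_simps mult_right_le_one_le intro: order_trans)
  have "emeasure N S \<le> D"
  proof (rule ennreal_le_epsilon)
    fix e :: real assume "0 < e"
    then obtain d where "d > 0" "d \<le> 1" "d * K \<le> e" using ex by blast
    thus "emeasure N S \<le> D + ennreal e" using up[of d]
      by (meson add_left_mono ennreal_leI order_trans)
  qed
  moreover have "D \<le> emeasure N S"
  proof (rule ennreal_le_epsilon)
    fix e :: real assume "0 < e"
    then obtain d where "d > 0" "d \<le> 1" "d * K \<le> e" using ex by blast
    thus "D \<le> emeasure N S + ennreal e" using low[of d]
      by (meson add_left_mono ennreal_leI order_trans)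
  qed
  moreover have "emeasure (density M (\<lambda>t. ennreal ((c + t)\<^sup>2))) S = D"
    unfolding D_def T_def by (subst emeasure_density) (use sM in auto)
  ultimately show "emeasure N S = emeasure (density M (\<lambda>t. ennreal ((c + t)\<^sup>2))) S" by auto
qed

text \<open>The junk value \<open>1 / 0 = 0\<close> at \<open>t = - c\<close> is harmless: \<open>M n\<close> has density \<open>(c + t)\<^sup>2\<close>, so \<open>{- c}\<close> is null.\<close>

lemma density_chain_powers:
  fixes M :: "nat \<Rightarrow> real measure" and c :: real
  assumes sM: "\<And>n. sets (M n) = sets borel"
    and step: "\<And>n. M n = density (M (Suc n)) (\<lambda>t. ennreal ((c + t)\<^sup>2))"
  shows "M n = density (M 0) (\<lambda>t. ennreal ((1 / (c + t)) ^ (2 * n)))"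
proof (induction n)
  case 0
  show ?case by (simp add: density_1)
next
  case (Suc n)
  have [measurable_cong]: "sets (M k) = sets borel" for k by fact
  have null: "emeasure (M k) {- c} = 0" for k
  proof -
    have "emeasure (M k) {- c} = (\<integral>\<^sup>+t. ennreal ((c + t)\<^sup>2) * indicator {- c} t \<partial>M (Suc k))"
      by (subst step, subst emeasure_density) (simp_all add: sM)
    also have "\<dots> = (\<integral>\<^sup>+t. 0 \<partial>M (Suc k))"
      by (intro nn_integral_cong) (auto split: split_indicator)
    finally show ?thesis by simp
  qed
  have "density (M n) (\<lambda>t. ennreal ((1 / (c + t))\<^sup>2))
      = density (M (Suc n)) (\<lambda>t. ennreal ((c + t)\<^sup>2) * ennreal ((1 / (c + t))\<^sup>2))"
    by (subst step, subst density_density_eq) simp_all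
  also have "\<dots> = density (M (Suc n)) (\<lambda>t. 1)"
  proof (rule density_cong)
    have "AE t in M (Suc n). t \<notin> {- c}"
      by (rule AE_not_in) (simp add: null_sets_def null sM)
    thus "AE t in M (Suc n). ennreal ((c + t)\<^sup>2) * ennreal ((1 / (c + t))\<^sup>2) = 1"
    proof eventually_elim
      case (elim t)
      hence "c + t \<noteq> 0" by auto
      hence "(c + t)\<^sup>2 * (1 / (c + t))\<^sup>2 = 1" by (simp add: power_divide)
      thus ?case by (simp add: ennreal_mult[symmetric] del: ennreal_1 add: ennreal_1[symmetric])
    qed
  qed simp_all
  also have "\<dots> = M (Suc n)" by (rule density_1)
  finally have "M (Suc n) = density (M n) (\<lambda>t. ennreal ((1 / (c + t))\<^sup>2))" ..
  also have "\<dots> = density (M 0) (\<lambda>t. ennreal ((1 / (c + t)) ^ (2 * n)) * ennreal ((1 / (c + t))\<^sup>2))"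
    by (subst Suc.IH, subst density_density_eq) simp_all
  also have "\<dots> = density (M 0) (\<lambda>t. ennreal ((1 / (c + t)) ^ (2 * Suc n)))"
    by (intro arg_cong[where f = "density (M 0)"] ext, subst ennreal_mult[symmetric])
       (simp_all add: power_add[symmetric] zero_le_even_power)
  finally show ?case .
qed

text \<open>The mass of \<open>M n\<close> is an even moment of x = 1 / (c + t) under
  \<open>M 0\<close>, and its first moment supplies an odd one, because x^(2 n) (c + t) = x^(2 n -
  1). In the application the masses are squared norms and the first moments are values of the
  quadratic form.\<close>

lemma density_chain_moments:
  fixes M :: "nat \<Rightarrow> real measure" and c :: real
  assumes sM: "\<And>n. sets (M n) = sets borel"
    and fin: "\<And>n. finite_measure (M n)"
    and step: "\<And>n. M n = density (M (Suc n)) (\<lambda>t. ennreal ((c + t)\<^sup>2))"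
  shows "integrable (M 0) (\<lambda>t. (1 / (c + t)) ^ (2 * n))"
    and "(\<integral>t. (1 / (c + t)) ^ (2 * n) \<partial>M 0) = measure (M n) UNIV"
    and "n \<ge> 1 \<Longrightarrow> integrable (M n) (\<lambda>t. t) \<Longrightarrow> integrable (M 0) (\<lambda>t. (1 / (c + t)) ^ (2 * n - 1))"
    and "n \<ge> 1 \<Longrightarrow> integrable (M n) (\<lambda>t. t) \<Longrightarrow>
      (\<integral>t. (1 / (c + t)) ^ (2 * n - 1) \<partial>M 0) = (\<integral>t. c + t \<partial>M n)"
proof -
  interpret finite_measure "M n" by fact
  have [measurable_cong]: "sets (M k) = sets borel" for k by fact
  have d: "M n = density (M 0) (\<lambda>t. ennreal ((1 / (c + t)) ^ (2 * n)))"
    by (rule density_chain_powers) fact+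
  have pos: "AE t in M 0. 0 \<le> (1 / (c + t)) ^ (2 * n)" by (simp add: zero_le_even_power)
  have "integrable (M n) (\<lambda>t. 1 :: real)" by simp
  thus "integrable (M 0) (\<lambda>t. (1 / (c + t)) ^ (2 * n))"
    by (subst (asm) d, subst (asm) integrable_density) (use pos in simp_all)
  have "measure (M n) UNIV = (\<integral>t. 1 \<partial>M n)"
    by (simp add: sets_eq_imp_space_eq[OF sM])
  also have "\<dots> = (\<integral>t. (1 / (c + t)) ^ (2 * n) \<partial>M 0)"
    by (subst d, subst integral_density) (use pos in simp_all)
  finally show "(\<integral>t. (1 / (c + t)) ^ (2 * n) \<partial>M 0) = measure (M n) UNIV" ..
  assume n: "n \<ge> 1" and i: "integrable (M n) (\<lambda>t. t)"
  \<comment> \<open>At t = - c both sides are 0: the left by its last factor, the right because 1 /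
    0 = 0 and n \<ge> 1 makes the exponent positive.\<close>
  have eq: "(1 / (c + t)) ^ (2 * n) *\<^sub>R (c + t) = (1 / (c + t)) ^ (2 * n - 1)" for t
  proof (cases "c + t = 0")
    case True
    with n show ?thesis by simp
  next
    case False
    have "2 * n = Suc (2 * n - 1)" using n by simp
    hence "(1 / (c + t)) ^ (2 * n) = (1 / (c + t)) ^ (2 * n - 1) * (1 / (c + t))"
      by (metis power_Suc2)
    with False show ?thesis by simp
  qed
  have "integrable (M n) (\<lambda>t. c + t)" using i by simp
  thus "integrable (M 0) (\<lambda>t. (1 / (c + t)) ^ (2 * n - 1))"
    by (subst (asm) d, subst (asm) integrable_density) (use pos in \<open>simp_all only: eq, simp_all\<close>)
  have "(\<integral>t. c + t \<partial>M n) = (\<integral>t. (1 / (c + t)) ^ (2 * n) *\<^sub>R (c + t) \<partial>M 0)"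
    by (subst d, subst integral_density) (use pos in simp_all)
  thus "(\<integral>t. (1 / (c + t)) ^ (2 * n - 1) \<partial>M 0) = (\<integral>t. c + t \<partial>M n)"
    by (simp only: eq)
qed

section \<open>A determinate moment problem\<close>

lemma set_integrable_inverse_add_square:
  fixes c :: real
  assumes "c > 0"
  shows "set_integrable lborel {0..} (\<lambda>w. 1 / (c + w\<^sup>2))"
proof -
  have "set_integrable lborel UNIV (\<lambda>x::real. inverse (1 + x^2))"
    using integrable_inverse_1_plus_square by (simp add: einterval_def)
  hence "integrable lborel (\<lambda>x::real. max 1 (1 / c) * inverse (1 + x^2))"
    by (simp add: set_integrable_def)
  thus ?thesis unfolding set_integrable_def
  proof (rule Bochner_Integration.integrable_bound)
    show "AE x in lborel. norm (indicator {0..} x *\<^sub>R (1 / (c + x\<^sup>2))) \<le> norm (max 1 (1 / c) * inverse (1 + x\<^sup>2))"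
    proof (intro always_eventually allI)
      fix x :: real
      have p: "c + x\<^sup>2 > 0" "1 + x\<^sup>2 > 0" using assms by (auto simp: add_pos_nonneg)
      have "1 + x\<^sup>2 \<le> max 1 (1 / c) * (c + x\<^sup>2)"
      proof -
        have "1 \<le> max 1 (1 / c) * c" using assms by (cases "c \<le> 1") (auto simp: max_def field_simps)
        moreover have "1 * x\<^sup>2 \<le> max 1 (1 / c) * x\<^sup>2" by (intro mult_right_mono) auto
        ultimately show ?thesis by (simp add: distrib_left)
      qed
      hence "1 / (c + x\<^sup>2) \<le> max 1 (1 / c) * inverse (1 + x\<^sup>2)"
        using p by (simp add: field_simps)
      thus "norm (indicator {0..} x *\<^sub>R (1 / (c + x\<^sup>2))) \<le> norm (max 1 (1 / c) * inverse (1 + x\<^sup>2))"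
        using p by (auto split: split_indicator simp: abs_mult)
    qed
  qed simp
qed

text \<open>The even moments grow at most like \<open>c\<^bsup>- n\<^esup>\<close>, which forces \<open>\<bar>1 / (c + t)\<bar> \<le> 1 / c\<close> almost everywhere; on
  this compact interval polynomials are dense.\<close>

lemma measure_from_moments:
  fixes M :: "real measure" and \<rho> :: "real \<Rightarrow> complex" and c lam B :: real
  assumes fM: "finite_measure M" and sM: "sets M = sets borel"
    and c: "c > 0" and lam: "lam \<ge> 0"
    and \<rho>[measurable]: "\<rho> \<in> borel_measurable borel" and B: "\<And>w. w \<ge> 0 \<Longrightarrow> norm (\<rho> w) \<le> B"
    and int: "\<And>n. n \<ge> 1 \<Longrightarrow> integrable M (\<lambda>t. (1 / (c + t)) ^ n)"
    and mom: "\<And>n. n \<ge> 1 \<Longrightarrow> of_real (\<integral>t. (1 / (c + t)) ^ n \<partial>M)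
      = (LBINT w:{0..}. of_real ((1 / (c + w\<^sup>2)) ^ n) * \<rho> w)"
  shows "of_real (measure M {0..lam}) = (LBINT w:{0..sqrt lam}. \<rho> w)"
proof -
  interpret finite_measure M by fact
  have [measurable_cong]: "sets M = sets borel" by fact
  have spM[simp]: "space M = UNIV" using sets_eq_imp_space_eq[OF sM] by simp
  have B0: "B \<ge> 0" using B[of 0] norm_ge_zero order_trans by blast
  \<comment> \<open>X and Y are the same variable 1 / (c + energy), read on the spectral side and,
    with energy w^2, on the frequency side.\<close>
  define X where "X t = 1 / (c + t)" for t
  define Y where "Y w = 1 / (c + w\<^sup>2)" for w
  define L where "L = 1 / c"
  have [measurable]: "X \<in> borel_measurable borel" "Y \<in> borel_measurable borel"
    unfolding X_def Y_def by measurable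
  have L: "L > 0" using c by (simp add: L_def)
  have den: "c + w\<^sup>2 > 0" for w using c by (simp add: add_pos_nonneg)
  have Y: "0 < Y w" "Y w \<le> L" for w
    unfolding Y_def L_def using c den[of w] by (auto intro!: divide_left_mono mult_pos_pos)
  have Yint: "integrable lborel (\<lambda>w. indicator {0..} w *\<^sub>R Y w)"
    using set_integrable_inverse_add_square[OF c] unfolding set_integrable_def Y_def .
  define C where "C = (LBINT w. indicator {0..} w *\<^sub>R Y w)"
  have C0: "C \<ge> 0" unfolding C_def by (rule integral_nonneg_AE) (use Y(1) in \<open>auto intro: less_imp_le split: split_indicator\<close>)
  have dom: "set_integrable lborel {0..} (\<lambda>w. of_real (f w) * \<rho> w) \<and>
      norm (LBINT w:{0..}. of_real (f w) * \<rho> w) \<le> K * B * C"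
    if f[measurable]: "f \<in> borel_measurable borel" and K: "\<And>w. \<bar>f w\<bar> \<le> K * Y w" for f :: "real \<Rightarrow> real" and K
  proof -
    have K0: "K \<ge> 0" using K[of 0] Y(1)[of 0] by (metis abs_ge_zero order_trans zero_le_mult_iff not_less)
    have bd: "norm (indicator {0..} w *\<^sub>R (of_real (f w) * \<rho> w)) \<le> K * B * (indicator {0..} w *\<^sub>R Y w)" for w
      using mult_mono[OF K[of w] B[of w]] B0 K0 Y(1)[of w]
      by (auto split: split_indicator simp: norm_mult mult_ac)
    have ig: "integrable lborel (\<lambda>w. K * B * (indicator {0..} w *\<^sub>R Y w))" using Yint by simp
    have i: "set_integrable lborel {0..} (\<lambda>w. of_real (f w) * \<rho> w)"
      unfolding set_integrable_def
      by (rule Bochner_Integration.integrable_bound[OF ig])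
         (auto simp del: norm_scaleR intro!: always_eventually order_trans[OF bd] simp: mult_nonneg_nonneg)
    have "norm (LBINT w:{0..}. of_real (f w) * \<rho> w) \<le> (LBINT w. K * B * (indicator {0..} w *\<^sub>R Y w))"
      unfolding set_lebesgue_integral_def
      by (rule Bochner_Integration.integral_norm_bound_integral[OF i[unfolded set_integrable_def] ig]) (use bd in auto)
    also have "\<dots> = K * B * C" unfolding C_def by (rule Bochner_Integration.integral_mult_right_zero)
    finally show ?thesis using i by blast
  qed
  have powbd: "\<bar>Y w ^ Suc n\<bar> \<le> L ^ n * Y w" for w n
    using Y[of w] by (auto simp: abs_mult power_abs intro!: mult_right_mono power_mono)
  have AEX: "AE t in M. \<bar>X t\<bar> \<le> L"
  proof -
    have zero: "measure M {t. \<bar>X t\<bar> \<ge> L + d} = 0" if d: "d > 0" for d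
    proof -
      let ?A = "{t. \<bar>X t\<bar> \<ge> L + d}"
      have [measurable]: "?A \<in> sets borel" by measurable
      \<comment> \<open>Chebyshev's inequality with the power 2 n + 2: the mass of A times (L +
        d)^(2 n + 2) is at most a moment, which is O(L^(2 n + 1)). The quotient is a geometric
        sequence in n.\<close>
      have bd: "measure M ?A \<le> L * B * C * (1 / (L + d)\<^sup>2) * ((L / (L + d))\<^sup>2) ^ n" for n
      proof -
        have "(L + d) ^ (2 * Suc n) * measure M ?A = (\<integral>t. (L + d) ^ (2 * Suc n) * indicator ?A t \<partial>M)"
          by simp
        also have "\<dots> \<le> (\<integral>t. X t ^ (2 * Suc n) \<partial>M)"
        proof (rule integral_mono)
          show "integrable M (\<lambda>t. X t ^ (2 * Suc n))" unfolding X_def by (rule int) simp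
          show "(L + d) ^ (2 * Suc n) * indicator ?A t \<le> X t ^ (2 * Suc n)" for t
          proof (cases "t \<in> ?A")
            case True
            hence "(L + d) ^ (2 * Suc n) \<le> \<bar>X t\<bar> ^ (2 * Suc n)"
              using L d by (intro power_mono) auto
            thus ?thesis using True power_even_abs[of "2 * Suc n" "X t"]
              by (simp del: power_Suc mult_Suc_right)
          next
            case False
            thus ?thesis using zero_le_even_power[of "2 * Suc n" "X t"]
              by (simp del: power_Suc mult_Suc_right)
          qed
        qed (simp add: emeasure_eq_measure)
        also have "\<dots> = norm (of_real (\<integral>t. X t ^ (2 * Suc n) \<partial>M) :: complex)"
          by (simp add: zero_le_even_power integral_nonneg_AE del: power_Suc mult_Suc_right)
        also have "\<dots> = norm (LBINT w:{0..}. of_real (Y w ^ (2 * Suc n)) * \<rho> w)"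
          unfolding X_def Y_def by (subst mom) auto
        also have "\<dots> \<le> L ^ (2 * n + 1) * B * C"
          using dom[of "\<lambda>w. Y w ^ (2 * Suc n)" "L ^ (2 * n + 1)"] powbd[of _ "2 * n + 1"] by simp
        finally have "measure M ?A \<le> L ^ (2 * n + 1) * B * C / (L + d) ^ (2 * Suc n)"
          using L d by (simp add: pos_le_divide_eq mult.commute del: power_Suc mult_Suc_right)
        also have "\<dots> = L * B * C * (1 / (L + d)\<^sup>2) * ((L / (L + d))\<^sup>2) ^ n"
          using L d by (simp add: power_divide power_mult power_add power2_eq_square mult_ac power_mult_distrib)
        finally show ?thesis .
      qed
      have "(\<lambda>n. L * B * C * (1 / (L + d)\<^sup>2) * ((L / (L + d))\<^sup>2) ^ n) \<longlonglongrightarrow> L * B * C * (1 / (L + d)\<^sup>2) * 0"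
      proof (intro tendsto_mult tendsto_const LIMSEQ_realpow_zero)
        have "L / (L + d) < 1" "0 \<le> L / (L + d)" using L d by auto
        thus "(L / (L + d))\<^sup>2 < 1" by (simp add: power_less_one_iff)
      qed simp
      hence "measure M ?A \<le> 0" using bd by (intro LIMSEQ_le_const) auto
      thus ?thesis by (simp add: measure_le_0_iff)
    qed
    have "AE t in M. \<forall>k::nat. \<not> (\<bar>X t\<bar> \<ge> L + 1 / (Suc k))"
      unfolding AE_all_countable
    proof
      fix k :: nat
      show "AE t in M. \<not> (\<bar>X t\<bar> \<ge> L + 1 / (Suc k))"
        by (rule AE_I[where N = "{t. \<bar>X t\<bar> \<ge> L + 1 / Suc k}"])
           (use zero[of "1 / Suc k"] in \<open>auto simp: emeasure_eq_measure\<close>)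
    qed
    thus ?thesis
    proof eventually_elim
      case (elim t)
      show ?case
      proof (rule ccontr)
        assume "\<not> \<bar>X t\<bar> \<le> L"
        then obtain k where "inverse (real (Suc k)) < \<bar>X t\<bar> - L"
          using reals_Archimedean[of "\<bar>X t\<bar> - L"] by auto
        with elim show False by (auto simp: inverse_eq_divide not_le dest!: spec[of _ k])
      qed
    qed
  qed
  have X2: "integrable M (\<lambda>t. (X t)\<^sup>2)" unfolding X_def by (rule int) simp
  have Y2: "\<bar>(Y w)\<^sup>2\<bar> \<le> L * Y w" for w using powbd[of w 1] by (simp add: power2_eq_square)
  \<comment> \<open>The weight X^2 keeps every exponent at least 2, so a zeroth moment does not
    occur; being nonnegative, it also turns a uniform error in p into an error of the
    integral.\<close>
  have poly: "of_real (\<integral>t. p (X t) * (X t)\<^sup>2 \<partial>M) = (LBINT w:{0..}. of_real (p (Y w) * (Y w)\<^sup>2) * \<rho> w)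
      \<and> integrable M (\<lambda>t. p (X t) * (X t)\<^sup>2)"
    if pf: "real_polynomial_function p" for p
  proof -
    obtain a n where p: "p = (\<lambda>x. \<Sum>i\<le>n. a i * x ^ i)"
      using real_polynomial_function_imp_sum[OF pf] by (elim exE)
    have iX: "integrable M (\<lambda>t. X t ^ (i + 2))" for i unfolding X_def by (rule int) simp
    have iY: "set_integrable lborel {0..} (\<lambda>w. of_real (Y w ^ (i + 2)) * \<rho> w)" for i
      using dom[of "\<lambda>w. Y w ^ (i + 2)" "L ^ (i + 1)"] powbd[of _ "i + 1"] by simp
    have eqX: "p (X t) * (X t)\<^sup>2 = (\<Sum>i\<le>n. a i * X t ^ (i + 2))" for t
      unfolding p by (simp add: sum_distrib_left sum_distrib_right power_add mult_ac power2_eq_square)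
    have eqY: "of_real (p (Y w) * (Y w)\<^sup>2) * \<rho> w = (\<Sum>i\<le>n. of_real (a i) * (of_real (Y w ^ (i + 2)) * \<rho> w))" for w
      unfolding p by (simp add: sum_distrib_left sum_distrib_right power_add mult_ac power2_eq_square)
    have "(\<integral>t. p (X t) * (X t)\<^sup>2 \<partial>M) = (\<Sum>i\<le>n. a i * (\<integral>t. X t ^ (i + 2) \<partial>M))"
      unfolding eqX using iX by (subst Bochner_Integration.integral_sum) auto
    hence "of_real (\<integral>t. p (X t) * (X t)\<^sup>2 \<partial>M) = (\<Sum>i\<le>n. of_real (a i) * complex_of_real (\<integral>t. X t ^ (i + 2) \<partial>M))"
      by simp
    also have "\<dots> = (\<Sum>i\<le>n. of_real (a i) * (LBINT w:{0..}. of_real (Y w ^ (i + 2)) * \<rho> w))"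
      unfolding X_def Y_def by (subst mom) auto
    also have "\<dots> = (LBINT w:{0..}. of_real (p (Y w) * (Y w)\<^sup>2) * \<rho> w)"
    proof -
      have "(LBINT w:{0..}. of_real (p (Y w) * (Y w)\<^sup>2) * \<rho> w)
          = (LBINT w. (\<Sum>i\<le>n. of_real (a i) * (indicator {0..} w *\<^sub>R (of_real (Y w ^ (i + 2)) * \<rho> w))))"
        unfolding set_lebesgue_integral_def eqY
        by (simp add: scaleR_sum_right mult_scaleR_right)
      also have "\<dots> = (\<Sum>i\<le>n. of_real (a i) * (LBINT w:{0..}. of_real (Y w ^ (i + 2)) * \<rho> w))"
        unfolding set_lebesgue_integral_def
        using iY[unfolded set_integrable_def]
        by (subst Bochner_Integration.integral_sum)
           (rule Bochner_Integration.integrable_mult_right, simp, simp only: Bochner_Integration.integral_mult_right_zero)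
      finally show ?thesis ..
    qed
    finally have 1: "of_real (\<integral>t. p (X t) * (X t)\<^sup>2 \<partial>M) = (LBINT w:{0..}. of_real (p (Y w) * (Y w)\<^sup>2) * \<rho> w)" .
    have "integrable M (\<lambda>t. p (X t) * (X t)\<^sup>2)" unfolding eqX using iX by auto
    with 1 show ?thesis by blast
  qed
  have cont: "of_real (\<integral>t. h (X t) * (X t)\<^sup>2 \<partial>M) = (LBINT w:{0..}. of_real (h (Y w) * (Y w)\<^sup>2) * \<rho> w)"
    if h: "continuous_on UNIV h" and hb: "\<And>x. \<bar>h x\<bar> \<le> H" for h :: "real \<Rightarrow> real" and H
  proof -
    have [measurable]: "h \<in> borel_measurable borel" using h by (rule borel_measurable_continuous_onI)
    let ?I = "\<lambda>h. (\<integral>t. h (X t) * (X t)\<^sup>2 \<partial>M)" and ?J = "\<lambda>h. (LBINT w:{0..}. of_real (h (Y w) * (Y w)\<^sup>2) * \<rho> w)"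
    have ih: "integrable M (\<lambda>t. h (X t) * (X t)\<^sup>2)"
    proof (rule Bochner_Integration.integrable_bound)
      show "integrable M (\<lambda>t. H * (X t)\<^sup>2)" using X2 by simp
      show "AE t in M. norm (h (X t) * (X t)\<^sup>2) \<le> norm (H * (X t)\<^sup>2)"
        using hb by (intro always_eventually allI) (auto simp: abs_mult intro!: mult_right_mono intro: order_trans abs_ge_self)
    qed measurable
    \<comment> \<open>Z bounds the effect of a uniform error of size 1 on the two sides
      together.\<close>
    define Z where "Z = (\<integral>t. (X t)\<^sup>2 \<partial>M) + L * B * C"
    have Z0: "Z \<ge> 0" unfolding Z_def using L B0 C0 by (auto intro!: add_nonneg_nonneg integral_nonneg_AE)
    have Ybd: "\<bar>g w * (Y w)\<^sup>2\<bar> \<le> G * L * Y w" if "\<bar>g w\<bar> \<le> G" for g :: "real \<Rightarrow> real" and w G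
      using mult_mono[OF that Y2[of w]] that by (auto simp: abs_mult mult.assoc)
    have ihY: "set_integrable lborel {0..} (\<lambda>w. of_real (h (Y w) * (Y w)\<^sup>2) * \<rho> w)"
      using dom[of "\<lambda>w. h (Y w) * (Y w)\<^sup>2" "H * L"] Ybd[of "\<lambda>w. h (Y w)" _ H] hb by simp
    have eps: "norm (of_real (?I h) - ?J h) \<le> e" if e: "e > 0" for e
    proof -
      define e' where "e' = e / (Z + 1)"
      have e': "e' > 0" "e' * Z \<le> e" unfolding e'_def using e Z0
        by (auto simp: field_simps)
      \<comment> \<open>Approximation on [-L, L] is enough: X lies there almost everywhere by
        \<open>AEX\<close>, and Y always does.\<close>
      obtain p where p: "real_polynomial_function p" "\<And>x. x \<in> {-L..L} \<Longrightarrow> \<bar>h x - p x\<bar> < e'"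
        using Stone_Weierstrass_real_polynomial_function[of "{-L..L}" h e'] continuous_on_subset[OF h] e' by auto
      have [measurable]: "p \<in> borel_measurable borel"
        using p(1) by (intro borel_measurable_continuous_onI continuous_on_polymonial_function)
          (simp add: real_polynomial_function_eq)
      have "\<bar>?I h - ?I p\<bar> = \<bar>(\<integral>t. h (X t) * (X t)\<^sup>2 - p (X t) * (X t)\<^sup>2 \<partial>M)\<bar>"
        using ih poly[OF p(1)] by (subst Bochner_Integration.integral_diff) auto
      also have "\<dots> \<le> (\<integral>t. e' * (X t)\<^sup>2 \<partial>M)"
      proof (rule order_trans[OF integral_abs_bound], rule integral_mono_AE)
        show "integrable M (\<lambda>t. \<bar>h (X t) * (X t)\<^sup>2 - p (X t) * (X t)\<^sup>2\<bar>)"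
          using ih poly[OF p(1)] by auto
        show "AE t in M. \<bar>h (X t) * (X t)\<^sup>2 - p (X t) * (X t)\<^sup>2\<bar> \<le> e' * (X t)\<^sup>2"
          using AEX
        proof eventually_elim
          case (elim t)
          hence "X t \<in> {-L..L}" by auto
          hence "\<bar>h (X t) - p (X t)\<bar> * (X t)\<^sup>2 \<le> e' * (X t)\<^sup>2"
            using p(2)[of "X t"] by (intro mult_right_mono) auto
          thus ?case by (simp add: abs_mult left_diff_distrib[symmetric])
        qed
      qed (use X2 in simp)
      also have "\<dots> = e' * (\<integral>t. (X t)\<^sup>2 \<partial>M)" by simp
      finally have 1: "\<bar>?I h - ?I p\<bar> \<le> e' * (\<integral>t. (X t)\<^sup>2 \<partial>M)" .
      let ?q = "\<lambda>w. h (Y w) * (Y w)\<^sup>2 - p (Y w) * (Y w)\<^sup>2"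
      have qb: "\<bar>?q w\<bar> \<le> e' * L * Y w" for w
      proof -
        have "\<bar>h (Y w) - p (Y w)\<bar> \<le> e'" using p(2)[of "Y w"] Y[of w] L by auto
        thus ?thesis using Ybd[of "\<lambda>w. h (Y w) - p (Y w)" w e'] by (simp add: left_diff_distrib)
      qed
      have d: "set_integrable lborel {0..} (\<lambda>w. of_real (?q w) * \<rho> w)"
        and db: "norm (LBINT w:{0..}. of_real (?q w) * \<rho> w) \<le> e' * L * B * C"
        using dom[of ?q "e' * L"] qb by auto
      have ip: "set_integrable lborel {0..} (\<lambda>w. of_real (p (Y w) * (Y w)\<^sup>2) * \<rho> w)"
      proof -
        have "(\<lambda>w. of_real (p (Y w) * (Y w)\<^sup>2) * \<rho> w) =
          (\<lambda>w. of_real (h (Y w) * (Y w)\<^sup>2) * \<rho> w - of_real (?q w) * \<rho> w)"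
          by (auto simp: algebra_simps)
        thus ?thesis using set_integral_diff(1)[OF ihY d] by simp
      qed
      have "?J h - ?J p = (LBINT w:{0..}. of_real (h (Y w) * (Y w)\<^sup>2) * \<rho> w - of_real (p (Y w) * (Y w)\<^sup>2) * \<rho> w)"
        by (rule set_integral_diff(2)[OF ihY ip, symmetric])
      also have "\<dots> = (LBINT w:{0..}. of_real (?q w) * \<rho> w)"
        by (simp add: left_diff_distrib)
      finally have 2: "norm (?J h - ?J p) \<le> e' * L * B * C" using db by simp
      have "of_real (?I h) - ?J h = of_real (?I h - ?I p) - (?J h - ?J p)"
        using poly[OF p(1)] by simp
      hence "norm (of_real (?I h) - ?J h) \<le> norm (of_real (?I h - ?I p) :: complex) + norm (?J h - ?J p)"
        by (simp only: norm_triangle_ineq4)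
      also have "\<dots> \<le> e' * (\<integral>t. (X t)\<^sup>2 \<partial>M) + e' * L * B * C"
        using 1 2 by (intro add_mono) (simp_all only: norm_of_real real_norm_def)
      also have "\<dots> = e' * Z" unfolding Z_def by (simp add: algebra_simps)
      finally show ?thesis using e'(2) by linarith
    qed
    have "norm (of_real (?I h) - ?J h) \<le> 0"
    proof (rule ccontr)
      assume "\<not> ?thesis"
      thus False using eps[of "norm (of_real (?I h) - ?J h) / 2"] by linarith
    qed
    thus ?thesis by (simp only: norm_le_zero_iff right_minus_eq)
  qed
  define x0 where "x0 = 1 / (c + lam)"
  have x0: "x0 > 0" unfolding x0_def using c lam by simp
  \<comment> \<open>Continuous ramps decreasing to the indicator of [x0, infinity). They equal 1 at
    x0 itself, so the closed end t = lam is included. A slope of at least 2 / x0 makes them vanish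
    below x0 / 2; hence they are divisible by x^2 and dominated by a multiple of Y.\<close>
  define cl where "cl n x = max 0 (min 1 ((2 / x0 + real n) * (x - x0) + 1))" for n x
  \<comment> \<open>The \<open>max\<close> changes the denominator only where \<open>cl\<close>
    vanishes, so h x^2 = cl everywhere.\<close>
  define h where "h n x = cl n x / (max x (x0 / 2))\<^sup>2" for n x
  have cl0: "cl n x = 0" if "x \<le> x0 / 2" for n x
  proof -
    have "(2 / x0 + real n) * (x - x0) \<le> (2 / x0 + real n) * (- (x0 / 2))"
      using that x0 by (intro mult_left_mono) auto
    also have "\<dots> \<le> (2 / x0) * (- (x0 / 2))"
      using x0 by (intro mult_right_mono_neg) auto
    also have "\<dots> = -1" using x0 by simp
    finally show ?thesis unfolding cl_def by auto
  qed
  have cl_bd: "0 \<le> cl n x" "cl n x \<le> 1" for n x unfolding cl_def by auto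
  have hx: "h n x * x\<^sup>2 = cl n x" for n x
    using cl0[of x n] x0 unfolding h_def by (cases "x \<le> x0 / 2") (auto simp: max_def)
  have h_cont: "continuous_on UNIV (h n)" for n
  proof -
    have "max x (x0 / 2) \<noteq> 0" for x using x0 by (auto simp: max_def)
    thus ?thesis unfolding h_def cl_def by (intro continuous_intros) auto
  qed
  have h_bd: "\<bar>h n x\<bar> \<le> 1 / (x0 / 2)\<^sup>2" for n x
  proof -
    have "(x0 / 2)\<^sup>2 \<le> (max x (x0 / 2))\<^sup>2" using x0 by (intro power_mono) auto
    thus ?thesis unfolding h_def using cl_bd[of n x] x0
      by (auto simp: abs_divide intro!: frac_le)
  qed
  have [measurable]: "cl n \<in> borel_measurable borel" for n unfolding cl_def by measurable
  have main: "complex_of_real (\<integral>t. cl n (X t) \<partial>M) = (LBINT w:{0..}. of_real (cl n (Y w)) * \<rho> w)" for n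
    using cont[OF h_cont h_bd, of n] by (simp only: hx)
  have cl_lim: "(\<lambda>n. cl n x) \<longlonglongrightarrow> indicator {x0..} x" for x
  proof (cases "x \<ge> x0")
    case True
    hence "cl n x = 1" for n unfolding cl_def using x0 by (auto simp: min_def max_def not_le)
    thus ?thesis using True by simp
  next
    case False
    obtain k :: nat where k: "1 / (x0 - x) < k" using reals_Archimedean2 by blast
    have "cl n x = 0" if "n \<ge> k" for n
    proof -
      have "1 / (x0 - x) < 2 / x0 + real n" using k that x0
        by (smt (verit) divide_pos_pos of_nat_mono)
      hence "1 < (2 / x0 + real n) * (x0 - x)" using False by (simp add: pos_divide_less_eq)
      moreover have "(2 / x0 + real n) * (x - x0) = - ((2 / x0 + real n) * (x0 - x))"
        by (simp only: mult_minus_right[symmetric] minus_diff_eq)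
      ultimately show ?thesis unfolding cl_def by linarith
    qed
    hence "eventually (\<lambda>n. cl n x = 0) sequentially" by (auto simp: eventually_sequentially)
    thus ?thesis using False by (simp add: tendsto_eventually)
  qed
  have lim1: "(\<lambda>n. (\<integral>t. cl n (X t) \<partial>M)) \<longlonglongrightarrow> (\<integral>t. indicator {x0..} (X t) \<partial>M)"
    by (rule integral_dominated_convergence[where w = "\<lambda>_. 1"])
       (use cl_lim cl_bd in auto)
  have lim2: "(\<lambda>n. (LBINT w:{0..}. of_real (cl n (Y w)) * \<rho> w))
      \<longlonglongrightarrow> (LBINT w:{0..}. of_real (indicator {x0..} (Y w)) * \<rho> w)"
    unfolding set_lebesgue_integral_def
  proof (rule integral_dominated_convergence[where w = "\<lambda>w. (2 / x0) * B * (indicator {0..} w *\<^sub>R Y w)"])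
    show "integrable lborel (\<lambda>w. (2 / x0) * B * (indicator {0..} w *\<^sub>R Y w))" using Yint by simp
    show "AE w in lborel. norm (indicator {0..} w *\<^sub>R (complex_of_real (cl n (Y w)) * \<rho> w))
        \<le> (2 / x0) * B * (indicator {0..} w *\<^sub>R Y w)" for n
    proof (intro always_eventually allI)
      fix w
      have "cl n (Y w) \<le> (2 / x0) * Y w"
        using cl0[of "Y w" n] cl_bd[of n "Y w"] x0 Y(1)[of w]
        by (cases "Y w \<le> x0 / 2") 
          (simp, rule order_trans[of _ 1], simp, subst times_divide_eq_left, subst pos_le_divide_eq, simp_all)
      hence *: "cl n (Y w) * norm (\<rho> w) \<le> (2 / x0) * Y w * B" if "w \<ge> 0"
        using cl_bd[of n "Y w"] B[OF that] x0 Y(1)[of w] by (intro mult_mono) auto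
      show "norm (indicator {0..} w *\<^sub>R (complex_of_real (cl n (Y w)) * \<rho> w))
        \<le> (2 / x0) * B * (indicator {0..} w *\<^sub>R Y w)"
      proof (cases "w \<ge> 0")
        case True
        have "norm (indicator {0..} w *\<^sub>R (complex_of_real (cl n (Y w)) * \<rho> w)) = cl n (Y w) * norm (\<rho> w)"
          using True cl_bd[of n "Y w"] by (simp add: norm_mult)
        also have "\<dots> \<le> (2 / x0) * Y w * B" by (rule *[OF True])
        also have "\<dots> = (2 / x0) * B * (indicator {0..} w *\<^sub>R Y w)" using True by simp
        finally show ?thesis .
      qed simp
    qed
    show "AE w in lborel. (\<lambda>n. indicator {0..} w *\<^sub>R (complex_of_real (cl n (Y w)) * \<rho> w))
       \<longlonglongrightarrow> indicator {0..} w *\<^sub>R (complex_of_real (indicator {x0..} (Y w)) * \<rho> w)"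
      by (intro always_eventually allI tendsto_intros cl_lim)
  qed measurable
  have e1: "(\<integral>t. indicator {x0..} (X t) \<partial>M) = measure M {0..lam}"
  proof -
    have "(\<integral>t. indicator {x0..} (X t) \<partial>M) = (\<integral>t. (indicator {0..lam} t :: real) \<partial>M)"
    proof (rule integral_cong_AE)
      show "AE t in M. (indicator {x0..} (X t) :: real) = indicator {0..lam} t"
        using AEX
      proof eventually_elim
        case (elim t)
        \<comment> \<open>For - c < t < 0 the value X would exceed 1 / c, against
          \<open>elim\<close>, and for t \<le> - c it is at most 0. So the bound on X is what
          excludes negative energies.\<close>
        have "X t \<ge> x0 \<longleftrightarrow> t \<in> {0..lam}"
        proof
          assume a: "X t \<ge> x0"
          hence "c + t > 0" using x0 unfolding X_def
            by (metis less_le_trans zero_less_divide_1_iff)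
          thus "t \<in> {0..lam}" using elim a c lam
            unfolding X_def x0_def L_def by (auto simp: field_simps)
        next
          assume "t \<in> {0..lam}"
          thus "X t \<ge> x0" unfolding X_def x0_def using c by (auto intro!: divide_left_mono mult_pos_pos)
        qed
        thus ?case by (auto split: split_indicator)
      qed
    qed measurable
    thus ?thesis by simp
  qed
  have e2: "(LBINT w:{0..}. of_real (indicator {x0..} (Y w)) * \<rho> w) = (LBINT w:{0..sqrt lam}. \<rho> w)"
    unfolding set_lebesgue_integral_def
  proof (rule Bochner_Integration.integral_cong[OF refl])
    fix w :: real
    have "Y w \<ge> x0 \<longleftrightarrow> w\<^sup>2 \<le> lam"
      unfolding Y_def x0_def using den[of w] c lam by (auto simp: field_simps)
    moreover have "w\<^sup>2 \<le> lam \<longleftrightarrow> w \<le> sqrt lam" if "w \<ge> 0"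
      using that lam by (metis real_le_rsqrt real_sqrt_le_iff real_sqrt_unique)
    ultimately show "indicator {0..} w *\<^sub>R (of_real (indicator {x0..} (Y w)) * \<rho> w)
        = indicator {0..sqrt lam} w *\<^sub>R \<rho> w"
      by (auto split: split_indicator)
  qed
  have "(\<lambda>n. complex_of_real (\<integral>t. cl n (X t) \<partial>M)) \<longlonglongrightarrow> of_real (measure M {0..lam})"
    using tendsto_of_real[OF lim1] unfolding e1 .
  moreover have "(\<lambda>n. complex_of_real (\<integral>t. cl n (X t) \<partial>M)) \<longlonglongrightarrow> (LBINT w:{0..sqrt lam}. \<rho> w)"
    unfolding main using lim2 unfolding e2 .
  ultimately show ?thesis by (rule LIMSEQ_unique)
qed

section \<open>The inner product\<close>

lemma borel_measurable_vec_nth [measurable (raw)]: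
  fixes f :: "'a \<Rightarrow> complex ^ 'n"
  assumes "f \<in> borel_measurable M"
  shows "(\<lambda>x. f x $ j) \<in> borel_measurable M"
  using assms by (rule borel_measurable_continuous_on[rotated]) (intro continuous_intros)

lemma borel_measurable_cnj [measurable (raw)]:
  fixes f :: "'a \<Rightarrow> complex"
  assumes "f \<in> borel_measurable M"
  shows "(\<lambda>x. cnj (f x)) \<in> borel_measurable M"
  using assms by (rule borel_measurable_continuous_on[rotated]) (intro continuous_intros)

lemma borel_measurable_vecI:
  fixes f :: "'a \<Rightarrow> complex ^ 'n"
  assumes "\<And>j. (\<lambda>x. f x $ j) \<in> borel_measurable M"
  shows "f \<in> borel_measurable M"
  using assms
  by (subst borel_measurable_euclidean_space) (auto simp: Basis_vec_def inner_axis intro!: borel_measurable_inner)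

lemma L2_measurable:
  fixes u :: "real \<Rightarrow> complex ^ 'n"
  shows "u \<in> L2 \<Longrightarrow> u \<in> borel_measurable half_line"
  by (simp add: L2_def)

lemma norm_vec_square: "(norm (v :: complex ^ 'n))\<^sup>2 = (\<Sum>j\<in>UNIV. (cmod (v $ j))\<^sup>2)"
  by (simp add: norm_vec_def L2_set_def sum_nonneg)

lemma L2_comp:
  fixes u :: "real \<Rightarrow> complex ^ 'n"
  assumes "u \<in> L2"
  shows "(\<lambda>x. u x $ j) \<in> L2"
proof -
  have [measurable]: "u \<in> borel_measurable half_line" using assms by (rule L2_measurable)
  have "integrable half_line (\<lambda>x. (norm (u x $ j))\<^sup>2)"
  proof (rule Bochner_Integration.integrable_bound)
    show "integrable half_line (\<lambda>x. (norm (u x))\<^sup>2)" using assms by (simp add: L2_def)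
    show "AE x in half_line. norm ((norm (u x $ j))\<^sup>2) \<le> norm ((norm (u x))\<^sup>2)"
      by (auto intro!: always_eventually power_mono Finite_Cartesian_Product.norm_nth_le)
  qed measurable
  thus ?thesis by (simp add: L2_def)
qed

lemma L2_vecI:
  fixes u :: "real \<Rightarrow> complex ^ 'n"
  assumes "\<And>j. (\<lambda>x. u x $ j) \<in> L2"
  shows "u \<in> L2"
  using assms by (auto simp: L2_def norm_vec_square intro!: borel_measurable_vecI)

lemma L2_comp_lin:
  fixes f g :: "real \<Rightarrow> complex"
  assumes "f \<in> L2" "g \<in> L2"
  shows "(\<lambda>x. a * f x + b * g x) \<in> L2"
proof -
  have [measurable]: "f \<in> borel_measurable half_line" "g \<in> borel_measurable half_line"
    using assms by (auto simp: L2_def)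
  have "integrable half_line (\<lambda>x. (norm (a * f x + b * g x))\<^sup>2)"
  proof (rule Bochner_Integration.integrable_bound)
    show "integrable half_line (\<lambda>x. 2 * (cmod a)\<^sup>2 * (norm (f x))\<^sup>2 + 2 * (cmod b)\<^sup>2 * (norm (g x))\<^sup>2)"
      using assms by (auto simp: L2_def)
    show "AE x in half_line. norm ((norm (a * f x + b * g x))\<^sup>2)
        \<le> norm (2 * (cmod a)\<^sup>2 * (norm (f x))\<^sup>2 + 2 * (cmod b)\<^sup>2 * (norm (g x))\<^sup>2)"
    proof (intro always_eventually allI)
      fix x
      define p q where "p = cmod a * norm (f x)" and "q = cmod b * norm (g x)"
      have "norm (a * f x + b * g x) \<le> p + q"
        unfolding p_def q_def by (metis norm_mult norm_triangle_ineq)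
      hence "(norm (a * f x + b * g x))\<^sup>2 \<le> (p + q)\<^sup>2" by (intro power_mono) auto
      also have "\<dots> \<le> 2 * p\<^sup>2 + 2 * q\<^sup>2"
        using zero_le_power2[of "p - q"] by (simp add: power2_sum power2_diff)
      finally show "norm ((norm (a * f x + b * g x))\<^sup>2)
        \<le> norm (2 * (cmod a)\<^sup>2 * (norm (f x))\<^sup>2 + 2 * (cmod b)\<^sup>2 * (norm (g x))\<^sup>2)"
        unfolding p_def q_def by (simp add: power_mult_distrib)
    qed
  qed measurable
  thus ?thesis by (simp add: L2_def)
qed

lemma L2_lin:
  fixes u v :: "real \<Rightarrow> complex ^ 'n"
  assumes "u \<in> L2" "v \<in> L2"
  shows "(\<lambda>x. a *s u x + b *s v x) \<in> L2"
  by (rule L2_vecI) (use L2_comp_lin[OF L2_comp[OF assms(1)] L2_comp[OF assms(2)]] in simp)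

section \<open>Sesquilinearity, Cauchy-Schwarz and triangle inequalities\<close>

lemma l2_inner_integrable:
  fixes u v :: "real \<Rightarrow> complex ^ 'n"
  assumes "u \<in> L2" "v \<in> L2"
  shows "integrable half_line (\<lambda>x. \<Sum>j\<in>UNIV. u x $ j * cnj (v x $ j))"
proof (intro Bochner_Integration.integrable_sum)
  fix j :: 'n
  have [measurable]: "u \<in> borel_measurable half_line" "v \<in> borel_measurable half_line"
    using assms by (auto simp: L2_def)
  show "integrable half_line (\<lambda>x. u x $ j * cnj (v x $ j))"
  proof (rule Bochner_Integration.integrable_bound)
    show "integrable half_line (\<lambda>x. (norm (u x $ j))\<^sup>2 + (norm (v x $ j))\<^sup>2)"
      using L2_comp[OF assms(1)] L2_comp[OF assms(2)] by (simp add: L2_def)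
    show "AE x in half_line. norm (u x $ j * cnj (v x $ j)) \<le> norm ((norm (u x $ j))\<^sup>2 + (norm (v x $ j))\<^sup>2)"
    proof (intro always_eventually allI)
      fix x
      have "2 * (p * q) \<le> p\<^sup>2 + q\<^sup>2" for p q :: real
        using zero_le_power2[of "p - q"] by (simp add: power2_diff)
      moreover have "0 \<le> norm (u x $ j) * norm (v x $ j)" by simp
      ultimately have "norm (u x $ j) * norm (v x $ j) \<le> (norm (u x $ j))\<^sup>2 + (norm (v x $ j))\<^sup>2"
        by (smt (verit, best))
      thus "norm (u x $ j * cnj (v x $ j)) \<le> norm ((norm (u x $ j))\<^sup>2 + (norm (v x $ j))\<^sup>2)"
        by (simp add: norm_mult)
    qed
  qed measurable
qed

lemma l2_inner_lin_left:
  fixes u v w :: "real \<Rightarrow> complex ^ 'n"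
  assumes "u \<in> L2" "v \<in> L2" "w \<in> L2"
  shows "l2_inner (\<lambda>x. a *s u x + b *s v x) w = a * l2_inner u w + b * l2_inner v w"
proof -
  have "l2_inner (\<lambda>x. a *s u x + b *s v x) w =
    (\<integral>x. a * (\<Sum>j\<in>UNIV. u x $ j * cnj (w x $ j)) + b * (\<Sum>j\<in>UNIV. v x $ j * cnj (w x $ j)) \<partial>half_line)"
    unfolding l2_inner_def
    by (intro Bochner_Integration.integral_cong refl) (simp add: sum_distrib_left sum.distrib algebra_simps)
  also have "\<dots> = a * l2_inner u w + b * l2_inner v w"
    unfolding l2_inner_def using l2_inner_integrable[OF assms(1,3)] l2_inner_integrable[OF assms(2,3)]
    by (subst Bochner_Integration.integral_add) (simp_all del: sum.cong)
  finally show ?thesis .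
qed

lemma l2_inner_commute: "l2_inner v u = cnj (l2_inner u v)"
  unfolding l2_inner_def Bochner_Integration.integral_cnj[symmetric] by (simp add: mult.commute)

lemma l2_inner_lin_right:
  fixes u v w :: "real \<Rightarrow> complex ^ 'n"
  assumes "u \<in> L2" "v \<in> L2" "w \<in> L2"
  shows "l2_inner w (\<lambda>x. a *s u x + b *s v x) = cnj a * l2_inner w u + cnj b * l2_inner w v"
  unfolding l2_inner_commute[of w] l2_inner_lin_left[OF assms] by simp

lemma l2_inner_self: "l2_inner u u = of_real ((l2_norm u)\<^sup>2)"
proof -
  have "l2_inner u u = (\<integral>x. of_real ((norm (u x))\<^sup>2) \<partial>half_line)"
    unfolding l2_inner_def
    by (intro Bochner_Integration.integral_cong refl)
       (simp add: norm_vec_square complex_norm_square of_real_power[symmetric] del: of_real_power)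
  also have "\<dots> = of_real (\<integral>x. (norm (u x))\<^sup>2 \<partial>half_line)" by (rule integral_complex_of_real)
  finally show ?thesis unfolding l2_norm_def by (simp add: integral_nonneg_AE)
qed

lemma l2_norm_nonneg [simp]: "0 \<le> l2_norm u"
  by (simp add: l2_norm_def integral_nonneg_AE)

lemma l2_inner_cong:
  fixes u v u' v' :: "real \<Rightarrow> complex ^ 'n"
  assumes "l2_eq u u'" "l2_eq v v'" and L: "u \<in> L2" "u' \<in> L2" "v \<in> L2" "v' \<in> L2"
  shows "l2_inner u v = l2_inner u' v'"
proof -
  have [measurable]: "u \<in> borel_measurable half_line" "v \<in> borel_measurable half_line"
    "u' \<in> borel_measurable half_line" "v' \<in> borel_measurable half_line"
    using L by (auto simp: L2_def)
  have "AE x in half_line. u x = u' x \<and> v x = v' x"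
    using assms(1,2) unfolding l2_eq_def by eventually_elim auto
  thus ?thesis unfolding l2_inner_def by (intro integral_cong_AE) (auto elim: eventually_mono)
qed

lemma l2_norm_eq_inner: "l2_norm u = sqrt (Re (l2_inner u u))"
  by (simp add: l2_inner_self)

lemma l2_norm_cong:
  fixes u v :: "real \<Rightarrow> complex ^ 'n"
  assumes "l2_eq u v" "u \<in> L2" "v \<in> L2"
  shows "l2_norm u = l2_norm v"
  unfolding l2_norm_eq_inner using l2_inner_cong[OF assms(1,1,2,3,2,3)] by simp

lemma l2_norm_lin_square:
  fixes u v :: "real \<Rightarrow> complex ^ 'n"
  assumes "u \<in> L2" "v \<in> L2"
  shows "(l2_norm (\<lambda>x. 1 *s u x + c *s v x))\<^sup>2
    = (l2_norm u)\<^sup>2 + 2 * Re (cnj c * l2_inner u v) + (cmod c)\<^sup>2 * (l2_norm v)\<^sup>2"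
proof -
  let ?w = "\<lambda>x. 1 *s u x + c *s v x"
  have w: "?w \<in> L2" using assms by (rule L2_lin)
  have "l2_inner ?w ?w = l2_inner u u + cnj c * l2_inner u v + c * l2_inner v u + c * cnj c * l2_inner v v"
    unfolding l2_inner_lin_left[OF assms w] l2_inner_lin_right[OF assms assms(1)] l2_inner_lin_right[OF assms assms(2)]
    by (simp add: algebra_simps)
  also have "\<dots> = of_real ((l2_norm u)\<^sup>2) + (cnj c * l2_inner u v + cnj (cnj c * l2_inner u v)) + of_real ((cmod c)\<^sup>2 * (l2_norm v)\<^sup>2)"
    unfolding l2_inner_self l2_inner_commute[of v u] by (simp add: complex_norm_square[symmetric])
  also have "\<dots> = of_real ((l2_norm u)\<^sup>2 + 2 * Re (cnj c * l2_inner u v) + (cmod c)\<^sup>2 * (l2_norm v)\<^sup>2)"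
    unfolding complex_add_cnj by simp
  finally show ?thesis unfolding l2_inner_self of_real_eq_iff .
qed

text \<open>The squared norm of u - t a v, with a the inner product, is nonnegative for every real
  t; t = 1 / q is the minimiser. For q = 0 the expression is affine in t, and t = (p + 1) / |a|^2
  would make it negative unless a = 0.\<close>

lemma l2_Cauchy_Schwarz:
  fixes u v :: "real \<Rightarrow> complex ^ 'n"
  assumes "u \<in> L2" "v \<in> L2"
  shows "cmod (l2_inner u v) \<le> l2_norm u * l2_norm v"
proof -
  define a where "a = l2_inner u v"
  define p q where "p = (l2_norm u)\<^sup>2" and "q = (l2_norm v)\<^sup>2"
  have *: "0 \<le> p - 2 * t * (cmod a)\<^sup>2 + t\<^sup>2 * (cmod a)\<^sup>2 * q" for t
  proof -
    let ?c = "- of_real t * a"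
    have "0 \<le> (l2_norm (\<lambda>x. 1 *s u x + ?c *s v x))\<^sup>2" by simp
    also have "\<dots> = p + 2 * Re (cnj ?c * a) + (cmod ?c)\<^sup>2 * q"
      unfolding l2_norm_lin_square[OF assms] p_def q_def a_def ..
    also have "cnj ?c * a = of_real (- t * (cmod a)\<^sup>2)"
      by (simp add: complex_norm_square[symmetric] mult.commute)
    finally show ?thesis by (simp add: norm_mult power_mult_distrib)
  qed
  have pq: "p \<ge> 0" "q \<ge> 0" by (simp_all add: p_def q_def)
  have "(cmod a)\<^sup>2 \<le> p * q"
  proof (cases "q = 0")
    case True
    show ?thesis
    proof (cases "a = 0")
      case False
      hence "(cmod a)\<^sup>2 > 0" by simp
      hence "p - 2 * ((p + 1) / (cmod a)\<^sup>2) * (cmod a)\<^sup>2 < 0" using pq by simp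
      with *[of "(p + 1) / (cmod a)\<^sup>2"] True show ?thesis by simp
    qed (use pq in simp)
  next
    case False
    hence "q > 0" using pq by simp
    have "0 \<le> p - 2 * (1 / q) * (cmod a)\<^sup>2 + (1 / q)\<^sup>2 * (cmod a)\<^sup>2 * q" by (rule *)
    also have "\<dots> = p - (cmod a)\<^sup>2 / q" using \<open>q > 0\<close> by (simp add: field_simps power2_eq_square)
    finally show ?thesis using \<open>q > 0\<close> by (simp add: field_simps)
  qed
  also have "p * q = (l2_norm u * l2_norm v)\<^sup>2" by (simp add: p_def q_def power_mult_distrib)
  finally show ?thesis unfolding a_def by (rule power2_le_imp_le) simp
qed

lemma l2_triangle:
  fixes u v :: "real \<Rightarrow> complex ^ 'n"
  assumes "u \<in> L2" "v \<in> L2"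
  shows "l2_norm (\<lambda>x. 1 *s u x + c *s v x) \<le> l2_norm u + cmod c * l2_norm v"
proof (rule power2_le_imp_le)
  have "Re (cnj c * l2_inner u v) \<le> cmod c * (l2_norm u * l2_norm v)"
    using complex_Re_le_cmod[of "cnj c * l2_inner u v"] l2_Cauchy_Schwarz[OF assms]
    by (simp add: norm_mult) (meson mult_left_mono norm_ge_zero order_trans)
  thus "(l2_norm (\<lambda>x. 1 *s u x + c *s v x))\<^sup>2 \<le> (l2_norm u + cmod c * l2_norm v)\<^sup>2"
    unfolding l2_norm_lin_square[OF assms] power2_sum power_mult_distrib
    by (simp only: mult.left_commute[of "l2_norm u"] mult.assoc)
qed (simp add: add_nonneg_nonneg)

lemma l2_reverse_triangle:
  fixes u v :: "real \<Rightarrow> complex ^ 'n"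
  assumes "u \<in> L2" "v \<in> L2"
  shows "\<bar>l2_norm (\<lambda>x. 1 *s u x + c *s v x) - cmod c * l2_norm v\<bar> \<le> l2_norm u"
proof -
  let ?w = "\<lambda>x. 1 *s u x + c *s v x"
  have w: "?w \<in> L2" using assms by (rule L2_lin)
  \<comment> \<open>c v is recovered as (u + c v) - u; the zero summand brings it into the shape of
    \<open>l2_norm_lin_square\<close>.\<close>
  have eq: "(\<lambda>x. 1 *s ?w x + (-1) *s u x) = (\<lambda>x. 1 *s (0 *s u x) + c *s v x)"
    by (auto simp: vec_eq_iff)
  have "cmod c * l2_norm v \<le> l2_norm ?w + l2_norm u"
  proof -
    have "(cmod c * l2_norm v)\<^sup>2 = (l2_norm (\<lambda>x. 1 *s ?w x + (-1) *s u x))\<^sup>2"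
    proof -
      have z: "(\<lambda>x. 0 *s u x) \<in> L2" using L2_lin[OF assms(1,1), of 0 0] by simp
      have "l2_norm (\<lambda>x. 0 *s u x) = 0" "l2_inner (\<lambda>x. 0 *s u x) v = 0"
        by (simp_all add: l2_norm_def l2_inner_def)
      thus ?thesis unfolding eq l2_norm_lin_square[OF z assms(2)] by (simp add: power_mult_distrib)
    qed
    hence "cmod c * l2_norm v = l2_norm (\<lambda>x. 1 *s ?w x + (-1) *s u x)"
      by (simp add: power2_eq_iff_nonneg)
    also have "\<dots> \<le> l2_norm ?w + l2_norm u"
      using l2_triangle[OF w assms(1), of "-1"] by simp
    finally show ?thesis .
  qed
  with l2_triangle[OF assms, of c] show ?thesis by (simp add: abs_le_iff)
qed

lemma l2_eq_refl [simp]: "l2_eq u u" by (simp add: l2_eq_def)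
lemma l2_eq_sym: "l2_eq u v \<Longrightarrow> l2_eq v u"
  unfolding l2_eq_def by (auto elim: eventually_mono)
lemma l2_eq_trans [trans]: "l2_eq u v \<Longrightarrow> l2_eq v w \<Longrightarrow> l2_eq u w"
  unfolding l2_eq_def by (auto elim: eventually_elim2)
lemma l2_eq_lin: "l2_eq u u' \<Longrightarrow> l2_eq v v' \<Longrightarrow> l2_eq (\<lambda>x. a *s u x + b *s v x) (\<lambda>x. a *s u' x + b *s v' x)"
  unfolding l2_eq_def by (auto elim: eventually_elim2)

section \<open>Projection valued measures\<close>

locale pvm =
  fixes E :: "real set \<Rightarrow> (real \<Rightarrow> complex ^ 'n::finite) \<Rightarrow> (real \<Rightarrow> complex ^ 'n)"
  assumes pvm: "projection_valued_measure E"
begin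

abbreviation "\<mu> \<equiv> scalar_spectral_measure E"

context
  fixes S :: "real set" assumes S: "S \<in> sets borel"
begin

lemma op: "orthogonal_projection (E S)"
  using pvm S by (simp add: projection_valued_measure_def)

lemma L2: "u \<in> L2 \<Longrightarrow> E S u \<in> L2"
  using op by (simp add: orthogonal_projection_def)

lemma cong: "u \<in> L2 \<Longrightarrow> v \<in> L2 \<Longrightarrow> l2_eq u v \<Longrightarrow> l2_eq (E S u) (E S v)"
  using op by (simp add: orthogonal_projection_def)

lemma lin: "u \<in> L2 \<Longrightarrow> v \<in> L2 \<Longrightarrow>
    l2_eq (E S (\<lambda>x. a *s u x + b *s v x)) (\<lambda>x. a *s E S u x + b *s E S v x)"
  using op by (simp add: orthogonal_projection_def)

lemma idem: "u \<in> L2 \<Longrightarrow> l2_eq (E S (E S u)) (E S u)"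
  using op by (simp add: orthogonal_projection_def)

lemma sym: "u \<in> L2 \<Longrightarrow> v \<in> L2 \<Longrightarrow> l2_inner (E S u) v = l2_inner u (E S v)"
  using op by (simp add: orthogonal_projection_def)

text \<open>Idempotence and symmetry. The squared norm becomes linear in the projection, and
  additivity of the scalar measure rests on this.\<close>

lemma norm_square_eq:
  assumes "u \<in> L2"
  shows "of_real ((l2_norm (E S u))\<^sup>2) = l2_inner (E S u) u"
proof -
  have "of_real ((l2_norm (E S u))\<^sup>2) = l2_inner (E S u) (E S u)" by (rule l2_inner_self[symmetric])
  also have "\<dots> = l2_inner (E S (E S u)) u" using assms by (intro sym[symmetric] L2)
  also have "\<dots> = l2_inner (E S u) u"
    by (rule l2_inner_cong) (use assms idem L2 in auto)
  finally show ?thesis .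
qed

end

lemma int: "S \<in> sets borel \<Longrightarrow> T \<in> sets borel \<Longrightarrow> u \<in> L2 \<Longrightarrow> l2_eq (E (S \<inter> T) u) (E S (E T u))"
  using pvm by (simp add: projection_valued_measure_def)

lemma empty: "u \<in> L2 \<Longrightarrow> l2_eq (E {} u) (\<lambda>x. 0)"
  using pvm by (simp add: projection_valued_measure_def)

lemma univ: "u \<in> L2 \<Longrightarrow> l2_eq (E UNIV u) u"
  using pvm by (simp add: projection_valued_measure_def)

lemma empty_norm: "u \<in> L2 \<Longrightarrow> l2_norm (E {} u) = 0"
  using l2_norm_cong[OF empty L2[of "{}"]] by (simp add: l2_norm_def L2_def)

text \<open>Both claims go through one induction, since additivity of the inner product is available
  only for members of \<open>L2\<close>.\<close>

lemma diff_sum_L2: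
  fixes A :: "nat \<Rightarrow> real set"
  assumes "range A \<subseteq> sets borel" "u \<in> L2" "S \<in> sets borel"
  shows "(\<lambda>x. E S u x - (\<Sum>i<n. E (A i) u x)) \<in> L2 \<and>
     l2_inner (\<lambda>x. E S u x - (\<Sum>i<n. E (A i) u x)) u = l2_inner (E S u) u - (\<Sum>i<n. l2_inner (E (A i) u) u)"
proof (induction n)
  case 0
  show ?case using L2[OF assms(3,2)] by simp
next
  case (Suc n)
  let ?f = "\<lambda>x. E S u x - (\<Sum>i<n. E (A i) u x)"
  have eq: "(\<lambda>x. E S u x - (\<Sum>i<Suc n. E (A i) u x)) = (\<lambda>x. 1 *s ?f x + (-1) *s E (A n) u x)"
    by (auto simp: algebra_simps vec_eq_iff)
  have f: "?f \<in> L2" and A: "E (A n) u \<in> L2" using Suc assms by (auto intro!: L2)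
  show ?case unfolding eq l2_inner_lin_left[OF f A assms(2)] using L2_lin[OF f A, of 1 "-1"] Suc by simp
qed

lemma sets_\<mu> [simp, measurable_cong]: "sets (\<mu> u) = sets borel"
  using sets.sigma_sets_eq[of "borel :: real measure"] by (simp add: scalar_spectral_measure_def)

lemma space_\<mu> [simp]: "space (\<mu> u) = UNIV"
  by (simp add: scalar_spectral_measure_def)

text \<open>\<open>measure_of\<close> takes the intended values only once countable additivity is
  checked. It follows from the norm convergence of the partial sums by Cauchy-Schwarz against u,
  through \<open>norm_square_eq\<close>.\<close>

lemma emeasure_\<mu>:
  assumes u: "u \<in> L2" and S: "S \<in> sets borel"
  shows "emeasure (\<mu> u) S = ennreal ((l2_norm (E S u))\<^sup>2)"
proof (rule emeasure_measure_of[OF scalar_spectral_measure_def])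
  show "positive (sets (\<mu> u)) (\<lambda>S. ennreal ((l2_norm (E S u))\<^sup>2))"
    using empty_norm[OF u] by (simp add: positive_def)
  show "countably_additive (sets (\<mu> u)) (\<lambda>S. ennreal ((l2_norm (E S u))\<^sup>2))"
  proof (rule countably_additiveI)
    fix A :: "nat \<Rightarrow> real set"
    assume "range A \<subseteq> sets (\<mu> u)" and disj: "disjoint_family A"
    hence A: "range A \<subseteq> sets borel" by simp
    let ?U = "\<Union>i. A i"
    have U: "?U \<in> sets borel" using A by auto
    let ?d = "\<lambda>n x. E ?U u x - (\<Sum>i<n. E (A i) u x)"
    have lim: "(\<lambda>n. l2_norm (?d n)) \<longlonglongrightarrow> 0"
      using pvm A disj u by (simp add: projection_valued_measure_def)
    have "(\<lambda>n. (l2_norm (E ?U u))\<^sup>2 - (\<Sum>i<n. (l2_norm (E (A i) u))\<^sup>2)) \<longlonglongrightarrow> 0"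
    proof (rule tendsto_rabs_zero_cancel, rule tendsto_sandwich[OF _ _ tendsto_const])
      show "(\<lambda>n. l2_norm (?d n) * l2_norm u) \<longlonglongrightarrow> 0"
        using tendsto_mult_right[OF lim, of "l2_norm u"] by simp
      have "\<bar>(l2_norm (E ?U u))\<^sup>2 - (\<Sum>i<n. (l2_norm (E (A i) u))\<^sup>2)\<bar> \<le> l2_norm (?d n) * l2_norm u" for n
      proof -
        have "l2_inner (?d n) u = of_real ((l2_norm (E ?U u))\<^sup>2 - (\<Sum>i<n. (l2_norm (E (A i) u))\<^sup>2))"
          using diff_sum_L2[OF A u U, of n] norm_square_eq[OF U u] norm_square_eq[OF _ u] A
          by (auto simp: range_subsetD)
        thus ?thesis using l2_Cauchy_Schwarz[OF conjunct1[OF diff_sum_L2[OF A u U]] u, of n]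
          by (simp only: norm_of_real)
      qed
      thus "\<forall>\<^sub>F n in sequentially. \<bar>(l2_norm (E ?U u))\<^sup>2 - (\<Sum>i<n. (l2_norm (E (A i) u))\<^sup>2)\<bar> \<le> l2_norm (?d n) * l2_norm u"
        by simp
    qed simp
    hence "(\<lambda>n. (l2_norm (E ?U u))\<^sup>2 - ((l2_norm (E ?U u))\<^sup>2 - (\<Sum>i<n. (l2_norm (E (A i) u))\<^sup>2)))
        \<longlonglongrightarrow> (l2_norm (E ?U u))\<^sup>2 - 0"
      by (intro tendsto_diff tendsto_const)
    hence "(\<lambda>i. (l2_norm (E (A i) u))\<^sup>2) sums (l2_norm (E ?U u))\<^sup>2" by (simp add: sums_def)
    thus "(\<Sum>i. ennreal ((l2_norm (E (A i) u))\<^sup>2)) = ennreal ((l2_norm (E (\<Union> (range A)) u))\<^sup>2)"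
      by (intro suminf_ennreal_eq) auto
  qed
qed (use S in \<open>auto simp: sets.space_closed\<close>)

lemma finite_\<mu>: "u \<in> L2 \<Longrightarrow> finite_measure (\<mu> u)"
  by (intro finite_measureI) (simp add: emeasure_\<mu>)

lemma measure_\<mu>: "u \<in> L2 \<Longrightarrow> S \<in> sets borel \<Longrightarrow> measure (\<mu> u) S = (l2_norm (E S u))\<^sup>2"
  by (simp add: measure_def emeasure_\<mu>)

lemma measure_\<mu>_UNIV: "u \<in> L2 \<Longrightarrow> measure (\<mu> u) UNIV = (l2_norm u)\<^sup>2"
  using l2_norm_cong[OF univ L2[of UNIV]] by (simp add: measure_\<mu>)

end

section \<open>Self-adjoint relations with a spectral measure\<close>

locale spectral_relation = pvm E
  for E :: "real set \<Rightarrow> (real \<Rightarrow> complex ^ 'n::finite) \<Rightarrow> (real \<Rightarrow> complex ^ 'n)" +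
  fixes A :: "(real \<Rightarrow> complex ^ 'n) \<Rightarrow> (real \<Rightarrow> complex ^ 'n) \<Rightarrow> bool"
  assumes A_L2: "A u f \<Longrightarrow> u \<in> L2 \<and> f \<in> L2"
    and A_lin: "A u f \<Longrightarrow> A v g \<Longrightarrow> A (\<lambda>x. a *s u x + b *s v x) (\<lambda>x. a *s f x + b *s g x)"
    and A_dom: "u \<in> L2 \<Longrightarrow> (\<exists>v. A u v) \<longleftrightarrow> integrable (\<mu> u) (\<lambda>t. t\<^sup>2)"
    and A_form: "A u f \<Longrightarrow> l2_inner f u = of_real (\<integral>t. t \<partial>\<mu> u)"
begin

text \<open>The form is real at every u + c v; its imaginary parts for c = 1 and c = i give the two
  components of the identity.\<close>

lemma A_symmetric:
  assumes u: "A u f" and v: "A v g"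
  shows "l2_inner f v = l2_inner u g"
proof -
  have L: "u \<in> L2" "f \<in> L2" "v \<in> L2" "g \<in> L2" using A_L2 u v by auto
  define P Q where "P = l2_inner f v" and "Q = l2_inner g u"
  have *: "Im (cnj c * P + c * Q) = 0" for c
  proof -
    let ?h = "\<lambda>x. 1 *s f x + c *s g x" and ?z = "\<lambda>x. 1 *s u x + c *s v x"
    have z: "A ?z ?h" by (rule A_lin[OF u v])
    have "l2_inner ?h ?z = l2_inner f u + cnj c * P + c * Q + c * cnj c * l2_inner g v"
      unfolding P_def Q_def l2_inner_lin_left[OF L(2,4) conjunct1[OF A_L2[OF z]]]
        l2_inner_lin_right[OF L(1,3,2)] l2_inner_lin_right[OF L(1,3,4)]
      by (simp add: algebra_simps)
    moreover have "Im (l2_inner ?h ?z) = 0" "Im (l2_inner f u) = 0" "Im (l2_inner g v) = 0"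
      unfolding A_form[OF z] A_form[OF u] A_form[OF v] by simp_all
    ultimately show ?thesis by simp
  qed
  from *[of 1] *[of \<i>] have "P = cnj Q" by (simp add: complex_eq_iff)
  thus ?thesis unfolding P_def Q_def by (simp add: l2_inner_commute[of u g])
qed

lemma integrable_id:
  assumes "A u f"
  shows "integrable (\<mu> u) (\<lambda>t. t)"
proof -
  have u: "u \<in> L2" using A_L2[OF assms] by simp
  interpret finite_measure "\<mu> u" by (rule finite_\<mu>[OF u])
  have "integrable (\<mu> u) (\<lambda>t. t\<^sup>2)" using A_dom[OF u] assms by blast
  hence "integrable (\<mu> u) (\<lambda>t. 1 + t\<^sup>2)" by simp
  thus ?thesis
  proof (rule Bochner_Integration.integrable_bound)
    have "\<bar>t\<bar> \<le> 1 + t\<^sup>2" for t :: real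
      using zero_le_power2[of "\<bar>t\<bar> - 1"] by (simp add: power2_diff)
    thus "AE t in \<mu> u. norm t \<le> norm (1 + t\<^sup>2)" by simp
  qed simp
qed

text \<open>The form \<open>\<langle>(A - a) z, z\<rangle>\<close> takes values in \<open>[0, (b - a) \<parallel>z\<parallel>\<^sup>2]\<close> on the range of \<open>E S\<close>, and that range
  does not interact with the range of \<open>E (- S)\<close>. Hence \<open>\<langle>(A - a) z, z\<rangle>\<close> can drop below its value at \<open>u\<close>
  by at most \<open>(b - a) \<parallel>E S u\<parallel>\<^sup>2\<close> along the line \<open>z = u + s v\<close>, where \<open>v = E S (f - a u)\<close>.\<close>

lemma spectral_localization:
  assumes Au: "A u f" and S: "S \<in> sets borel" and sub: "S \<subseteq> {a..b}" and ab: "a < b"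
  shows "l2_norm (E S (\<lambda>x. 1 *s f x + (- of_real a) *s u x)) \<le> (b - a) * l2_norm (E S u)"
proof -
  have u: "u \<in> L2" and f: "f \<in> L2" using A_L2[OF Au] by auto
  define g where "g = (\<lambda>x. 1 *s f x + (- of_real a) *s u x)"
  have g: "g \<in> L2" unfolding g_def by (rule L2_lin[OF f u])
  define v where "v = E S g"
  have v: "v \<in> L2" unfolding v_def by (rule L2[OF S g])
  define d where "d = b - a"
  have d: "d > 0" using ab by (simp add: d_def)
  define p where "p = (l2_norm (E S u))\<^sup>2"
  define \<beta> where "\<beta> = (l2_norm v)\<^sup>2"
  have vanish: "l2_eq (E T v) (\<lambda>x. 0)" if T: "T \<in> sets borel" "T \<inter> S = {}" for T
  proof -
    have "l2_eq (E T v) (E (T \<inter> S) g)" unfolding v_def by (rule l2_eq_sym[OF int[OF T(1) S g]])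
    also have "l2_eq (E (T \<inter> S) g) (\<lambda>x. 0)" using empty[OF g] T by simp
    finally show ?thesis .
  qed
  have norm0: "l2_norm w = 0" if "l2_eq w (\<lambda>x. 0)" "w \<in> L2" for w :: "real \<Rightarrow> complex ^ 'n"
    using l2_norm_cong[OF that] by (simp add: l2_norm_def L2_def)
  interpret mv: finite_measure "\<mu> v" by (rule finite_\<mu>[OF v])
  interpret mu: finite_measure "\<mu> u" by (rule finite_\<mu>[OF u])
  have AEv: "AE t in \<mu> v. t \<in> S"
  proof (rule AE_I)
    show "emeasure (\<mu> v) (- S) = 0"
      using norm0[OF vanish[of "- S"] L2[OF _ v]] S by (simp add: emeasure_\<mu> v)
  qed (use S in auto)
  \<comment> \<open>A value of A at v comes from the domain condition: the measure of v lives on the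
    bounded set S, so t^2 is integrable. Nothing is known here about the position of k relative to
    the range of E S.\<close>
  obtain k where k: "A v k"
  proof -
    have "integrable (\<mu> v) (\<lambda>t. t\<^sup>2)"
    proof (rule Bochner_Integration.integrable_bound)
      show "integrable (\<mu> v) (\<lambda>t. (\<bar>a\<bar> + \<bar>b\<bar>)\<^sup>2)" by simp
      show "AE t in \<mu> v. norm (t\<^sup>2) \<le> norm ((\<bar>a\<bar> + \<bar>b\<bar>)\<^sup>2)"
        using AEv
      proof eventually_elim
        case (elim t)
        hence "t \<in> {a..b}" using sub by blast
        hence "\<bar>t\<bar> \<le> \<bar>a\<bar> + \<bar>b\<bar>" by auto
        hence "\<bar>t\<bar>\<^sup>2 \<le> (\<bar>a\<bar> + \<bar>b\<bar>)\<^sup>2" by (intro power_mono) auto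
        thus ?case by simp
      qed
    qed simp
    thus ?thesis using A_dom[OF v] that by blast
  qed
  have kL: "k \<in> L2" using A_L2[OF k] by simp
  define q where "q = Re (l2_inner k v) - a * \<beta>"
  have q: "q \<le> d * \<beta>"
  proof -
    have "q = (\<integral>t. t - a \<partial>\<mu> v)"
      unfolding q_def A_form[OF k] \<beta>_def
      using integrable_id[OF k] by (subst Bochner_Integration.integral_diff) (simp_all add: measure_\<mu>_UNIV v)
    also have "\<dots> \<le> (\<integral>t. d \<partial>\<mu> v)"
      using AEv integrable_id[OF k] sub unfolding d_def
      by (intro integral_mono_AE) (auto elim!: eventually_mono)
    also have "\<dots> = d * \<beta>" by (simp add: measure_\<mu>_UNIV v \<beta>_def)
    finally show ?thesis .
  qed
  define R where "R s = Re (l2_inner (\<lambda>x. 1 *s f x + of_real s *s k x) (\<lambda>x. 1 *s u x + of_real s *s v x))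
      - a * (l2_norm (\<lambda>x. 1 *s u x + of_real s *s v x))\<^sup>2" for s
  have Rint: "R s \<ge> R 0 - d * p" for s
  proof -
    define z where "z = (\<lambda>x. 1 *s u x + of_real s *s v x)"
    have Az: "A z (\<lambda>x. 1 *s f x + of_real s *s k x)" unfolding z_def by (rule A_lin[OF Au k])
    have z: "z \<in> L2" using A_L2[OF Az] by simp
    interpret mz: finite_measure "\<mu> z" by (rule finite_\<mu>[OF z])
    have iu: "integrable (\<mu> u) (\<lambda>t. t - a)" and iz: "integrable (\<mu> z) (\<lambda>t. t - a)"
      using integrable_id[OF Au] integrable_id[OF Az] by auto
    have Rs: "R s = (\<integral>t. t - a \<partial>\<mu> z)"
      unfolding R_def z_def[symmetric] A_form[OF Az]
      using integrable_id[OF Az] by (subst Bochner_Integration.integral_diff) (simp_all add: measure_\<mu>_UNIV z)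
    have R0: "R 0 = (\<integral>t. t - a \<partial>\<mu> u)"
      unfolding R_def using integrable_id[OF Au]
      by (subst Bochner_Integration.integral_diff) (simp_all add: A_form[OF Au] measure_\<mu>_UNIV u)
    \<comment> \<open>Off S, u and u + s v have the same spectral measure, because E T v vanishes
      for every T disjoint from S.\<close>
    have res: "restrict_space (\<mu> z) (- S) = restrict_space (\<mu> u) (- S)"
    proof (rule measure_eqI)
      show "sets (restrict_space (\<mu> z) (- S)) = sets (restrict_space (\<mu> u) (- S))"
        by (simp add: sets_restrict_space)
      fix T assume "T \<in> sets (restrict_space (\<mu> z) (- S))"
      hence T: "T \<in> sets borel" "T \<subseteq> - S"
        using S by (auto simp: sets_restrict_space_iff)
      have "l2_eq (E T z) (\<lambda>x. 1 *s E T u x + of_real s *s E T v x)"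
        unfolding z_def by (rule lin[OF T(1) u v])
      also have "l2_eq \<dots> (\<lambda>x. 1 *s E T u x + of_real s *s 0)"
        by (rule l2_eq_lin[OF l2_eq_refl vanish]) (use T in auto)
      also have "(\<lambda>x. 1 *s E T u x + of_real s *s 0) = E T u" by (auto simp: vec_eq_iff)
      finally have "emeasure (\<mu> z) T = emeasure (\<mu> u) T"
        using l2_norm_cong[OF _ L2[OF T(1) z] L2[OF T(1) u]] by (simp add: emeasure_\<mu> z u T)
      thus "emeasure (restrict_space (\<mu> z) (- S)) T = emeasure (restrict_space (\<mu> u) (- S)) T"
        using T S by (subst (1 2) emeasure_restrict_space) auto
    qed
    have split: "(\<integral>t. t - a \<partial>\<mu> w) = (\<integral>t. indicator S t * (t - a) \<partial>\<mu> w) + (\<integral>t. t - a \<partial>restrict_space (\<mu> w) (- S))"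
      if "integrable (\<mu> w) (\<lambda>t. t - a)" for w
    proof -
      have 1: "integrable (\<mu> w) (\<lambda>t. indicator S t * (t - a))" "integrable (\<mu> w) (\<lambda>t. indicator (- S) t * (t - a))"
        using that S by (auto intro!: integrable_real_mult_indicator simp: mult.commute[of "indicator _ _"])
      have "(\<integral>t. t - a \<partial>\<mu> w) = (\<integral>t. indicator S t * (t - a) + indicator (- S) t * (t - a) \<partial>\<mu> w)"
        by (intro Bochner_Integration.integral_cong) (auto split: split_indicator)
      also have "\<dots> = (\<integral>t. indicator S t * (t - a) \<partial>\<mu> w) + (\<integral>t. indicator (- S) t * (t - a) \<partial>\<mu> w)"
        using 1 by (rule Bochner_Integration.integral_add)
      also have "(\<integral>t. indicator (- S) t * (t - a) \<partial>\<mu> w) = (\<integral>t. t - a \<partial>restrict_space (\<mu> w) (- S))"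
        using S by (subst integral_restrict_space) auto
      finally show ?thesis .
    qed
    have "0 \<le> (\<integral>t. indicator S t * (t - a) \<partial>\<mu> z)"
      using sub by (intro integral_nonneg_AE) (auto simp: subset_iff split: split_indicator)
    moreover have "(\<integral>t. indicator S t * (t - a) \<partial>\<mu> u) \<le> d * p"
    proof -
      have "(\<integral>t. indicator S t * (t - a) \<partial>\<mu> u) \<le> (\<integral>t. d * indicator S t \<partial>\<mu> u)"
        using sub iu S
        by (intro integral_mono)
           (auto simp: d_def mu.emeasure_eq_measure mult.commute[of "indicator _ _"] split: split_indicator
             intro!: integrable_real_mult_indicator)
      also have "\<dots> = d * p" using S by (simp add: measure_\<mu> u p_def)
      finally show ?thesis .
    qed
    ultimately show ?thesis unfolding Rs R0 split[OF iu] split[OF iz] res by linarith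
  qed
  have gv: "Re (l2_inner g v) = \<beta>"
  proof -
    have "l2_inner g v = l2_inner v g" unfolding v_def by (rule sym[OF S g g, symmetric])
    also have "\<dots> = of_real \<beta>" unfolding v_def \<beta>_def by (rule norm_square_eq[OF S g, symmetric])
    finally show ?thesis by simp
  qed
  \<comment> \<open>The cross terms are conjugate by symmetry of A, so the linear coefficient is 2
    Re <g, v>, and <g, E S g> is the squared norm of v = E S g.\<close>
  have Rs: "R s = R 0 + 2 * s * \<beta> + s\<^sup>2 * q" for s
  proof -
    have "l2_inner k u = cnj (l2_inner f v)"
      using A_symmetric[OF Au k] l2_inner_commute[of k u] by simp
    hence "Re (l2_inner (\<lambda>x. 1 *s f x + of_real s *s k x) (\<lambda>x. 1 *s u x + of_real s *s v x))
       = Re (l2_inner f u) + 2 * s * Re (l2_inner f v) + s\<^sup>2 * Re (l2_inner k v)"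
      unfolding l2_inner_lin_left[OF f kL L2_lin[OF u v]] l2_inner_lin_right[OF u v f] l2_inner_lin_right[OF u v kL]
      by (simp add: algebra_simps power2_eq_square)
    moreover have "Re (l2_inner f v) - a * Re (l2_inner u v) = \<beta>"
      using gv unfolding g_def l2_inner_lin_left[OF f u v] by simp
    moreover have "R 0 = Re (l2_inner f u) - a * (l2_norm u)\<^sup>2" unfolding R_def by simp
    ultimately show ?thesis
      unfolding R_def[of s] l2_norm_lin_square[OF u v] q_def
      by (simp add: algebra_simps \<beta>_def[symmetric])
  qed
  \<comment> \<open>s = - 1 / d minimises 2 s \<beta> + s^2 d \<beta>.\<close>
  have "- d * p \<le> 2 * (- (1 / d)) * \<beta> + (- (1 / d))\<^sup>2 * q"
    using Rint[of "- (1 / d)"] Rs[of "- (1 / d)"] by linarith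
  also have "\<dots> \<le> 2 * (- (1 / d)) * \<beta> + (- (1 / d))\<^sup>2 * (d * \<beta>)"
    using q by (intro add_left_mono mult_left_mono) auto
  also have "\<dots> = - \<beta> / d" using d by (simp add: power2_eq_square field_simps)
  finally have "\<beta> \<le> d\<^sup>2 * p" using d by (simp add: field_simps power2_eq_square)
  hence "(l2_norm v)\<^sup>2 \<le> (d * l2_norm (E S u))\<^sup>2" by (simp add: \<beta>_def p_def power_mult_distrib)
  thus ?thesis unfolding v_def g_def d_def[symmetric] by (rule power2_le_imp_le) (use d in simp)
qed

text \<open>F is (A + c) u, so F = (A - a) u + (c + a) u. On S the first summand has length at most
  b - a times that of u by localization, and the reverse triangle inequality turns this into the
  hypothesis of \<open>density_square_of_sandwich\<close>.\<close>

lemma \<mu>_shift: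
  assumes Au: "A u (\<lambda>x. 1 *s F x + (- of_real c) *s u x)" and F: "F \<in> L2"
  shows "\<mu> F = density (\<mu> u) (\<lambda>t. ennreal ((c + t)\<^sup>2))"
proof (rule density_square_of_sandwich)
  have u: "u \<in> L2" using A_L2[OF Au] by simp
  show "finite_measure (\<mu> u)" "finite_measure (\<mu> F)" by (simp_all add: finite_\<mu> u F)
  show "integrable (\<mu> u) power2" using A_dom[OF u] Au by blast
  fix a b :: real and S :: "real set"
  assume ab: "a < b" and S: "S \<in> sets borel" and sub: "S \<subseteq> {a..b}"
  let ?w = "\<lambda>x. 1 *s (1 *s F x + (- of_real c) *s u x) + (- of_real a) *s u x"
  have w: "?w \<in> L2" by (rule L2_lin[OF conjunct2[OF A_L2[OF Au]] u])
  have eq: "F = (\<lambda>x. 1 *s ?w x + of_real (c + a) *s u x)"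
    by (auto simp: vec_eq_iff algebra_simps)
  have "l2_eq (E S F) (\<lambda>x. 1 *s E S ?w x + of_real (c + a) *s E S u x)"
    by (subst eq, rule lin[OF S w u])
  hence "l2_norm (E S F) = l2_norm (\<lambda>x. 1 *s E S ?w x + of_real (c + a) *s E S u x)"
    by (rule l2_norm_cong) (rule L2[OF S F], rule L2_lin[OF L2[OF S w] L2[OF S u]])
  hence "\<bar>l2_norm (E S F) - \<bar>c + a\<bar> * l2_norm (E S u)\<bar> \<le> l2_norm (E S ?w)"
    using l2_reverse_triangle[OF L2[OF S w] L2[OF S u], of "of_real (c + a)"] by (simp only: norm_of_real)
  also have "\<dots> \<le> (b - a) * l2_norm (E S u)"
    by (rule spectral_localization[OF Au S sub ab])
  finally show "\<bar>sqrt (measure (\<mu> F) S) - \<bar>c + a\<bar> * sqrt (measure (\<mu> u) S)\<bar> \<le> (b - a) * sqrt (measure (\<mu> u) S)"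
    by (simp add: measure_\<mu> F u S)
qed simp_all

end

section \<open>Fourier integrals\<close>

lemma FTC_Ioi:
  fixes F f :: "real \<Rightarrow> 'a::euclidean_space"
  assumes F: "\<And>x. (F has_vector_derivative f x) (at x)"
    and f: "continuous_on UNIV f"
    and int: "set_integrable lborel {0<..} f"
    and lim: "(F \<longlongrightarrow> L) at_top"
  shows "(LBINT x:{0<..}. f x) = L - F 0"
proof -
  have e: "einterval 0 \<infinity> = {0<..}" by (auto simp: einterval_def zero_ereal_def)
  have "(LBINT x=0..\<infinity>. f x) = L - F 0"
  proof (rule interval_integral_FTC_integrable)
    have "(F \<longlongrightarrow> F 0) (at_right 0)"
      using has_vector_derivative_continuous[OF F[of 0]] by (auto simp: continuous_at intro: tendsto_within_subset)
    thus "((F \<circ> real_of_ereal) \<longlongrightarrow> F 0) (at_right 0)"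
      unfolding zero_ereal_def ereal_tendsto_simps .
    show "((F \<circ> real_of_ereal) \<longlongrightarrow> L) (at_left \<infinity>)"
      using lim unfolding ereal_tendsto_simps .
    show "isCont f x" for x using f by (simp add: continuous_on_eq_continuous_at)
  qed (use F int e in auto)
  thus ?thesis by (simp add: interval_lebesgue_integral_0_infty)
qed

lemma integrable_pair_bound:
  fixes f :: "real \<times> real \<Rightarrow> 'b::{banach,second_countable_topology}" and g h :: "real \<Rightarrow> real"
  assumes f: "f \<in> borel_measurable (lborel \<Otimes>\<^sub>M lborel)"
    and g: "integrable lborel g" and h: "integrable lborel h"
    and bd: "\<And>x y. norm (f (x, y)) \<le> g x * h y"
  shows "integrable (lborel \<Otimes>\<^sub>M lborel) f"
proof (rule Bochner_Integration.integrable_bound)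
  have [measurable]: "g \<in> borel_measurable borel" "h \<in> borel_measurable borel"
    using g h by (auto dest: borel_measurable_integrable)
  show "integrable (lborel \<Otimes>\<^sub>M lborel) (\<lambda>(x, y). g x * h y)"
    by (rule lborel_pair.Fubini_integrable) (use g h in \<open>auto simp: abs_mult\<close>)
  show "AE x in lborel \<Otimes>\<^sub>M lborel. norm (f x) \<le> norm (case x of (x, y) \<Rightarrow> g x * h y)"
    using bd by (auto intro: order_trans[OF bd abs_ge_self])
qed (fact f)

lemma integrable_exp_Ioi:
  fixes k :: real
  assumes "k > 0"
  shows "integrable lborel (\<lambda>x. indicator {0<..} x * exp (- (k * x)))"
  using integrable_I0i_exp_mscale[OF assms] by (simp add: set_integrable_def mult.commute)

lemma integral_exp_cos:
  fixes w :: real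
  shows "integrable lborel (\<lambda>x. indicator {0<..} x * (exp (- x) * cos (w * x)))"
    and "(LBINT x. indicator {0<..} x * (exp (- x) * cos (w * x))) = 1 / (1 + w\<^sup>2)"
proof -
  show i: "integrable lborel (\<lambda>x. indicator {0<..} x * (exp (- x) * cos (w * x)))"
    by (rule Bochner_Integration.integrable_bound[OF integrable_exp_Ioi[of 1]])
       (auto intro!: always_eventually split: split_indicator simp: abs_mult mult_left_le)
  have p: "1 + w\<^sup>2 > 0" by (simp add: add_pos_nonneg)
  let ?F = "\<lambda>x. exp (- x) * (w * sin (w * x) - cos (w * x)) / (1 + w\<^sup>2)"
  have "(LBINT x:{0<..}. exp (- x) * cos (w * x)) = 0 - ?F 0"
  proof (rule FTC_Ioi)
    fix x
    have "(?F has_real_derivative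
       ((- exp (- x)) * (w * sin (w * x) - cos (w * x)) + exp (- x) * (w * (cos (w * x) * w) + sin (w * x) * w)) / (1 + w\<^sup>2)) (at x)"
      using p by (auto intro!: derivative_eq_intros)
    also have "((- exp (- x)) * (w * sin (w * x) - cos (w * x)) + exp (- x) * (w * (cos (w * x) * w) + sin (w * x) * w)) / (1 + w\<^sup>2)
       = exp (- x) * cos (w * x)"
      using p by (simp add: field_simps power2_eq_square)
    finally show "(?F has_vector_derivative exp (- x) * cos (w * x)) (at x)"
      by (simp add: has_real_derivative_iff_has_vector_derivative)
  next
    show "continuous_on UNIV (\<lambda>x. exp (- x) * cos (w * x))" by (intro continuous_intros)
    show "set_integrable lborel {0<..} (\<lambda>x. exp (- x) * cos (w * x))"
      using i by (simp add: set_integrable_def)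
    have e: "((\<lambda>x::real. exp (- x)) \<longlongrightarrow> 0) at_top"
      by (rule filterlim_compose[OF exp_at_bot]) (rule filterlim_uminus_at_bot_at_top)
    have "((\<lambda>x. exp (- x) * ((\<bar>w\<bar> + 1) / (1 + w\<^sup>2))) \<longlongrightarrow> 0 * ((\<bar>w\<bar> + 1) / (1 + w\<^sup>2))) at_top"
      by (intro tendsto_mult e tendsto_const)
    hence z: "((\<lambda>x. exp (- x) * ((\<bar>w\<bar> + 1) / (1 + w\<^sup>2))) \<longlongrightarrow> 0) at_top" by simp
    show "(?F \<longlongrightarrow> 0) at_top"
    proof (rule tendsto_0_le[OF z, where K = 1], intro always_eventually allI)
      fix x
      have "\<bar>w * sin (w * x) - cos (w * x)\<bar> \<le> \<bar>w\<bar> * 1 + 1"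
        by (rule order_trans[OF abs_triangle_ineq4]) (intro add_mono, simp_all add: abs_mult mult_left_le)
      thus "norm (?F x) \<le> norm (exp (- x) * ((\<bar>w\<bar> + 1) / (1 + w\<^sup>2))) * 1"
        using p by (auto simp: abs_mult abs_divide intro!: divide_right_mono mult_left_mono)
    qed
  qed
  thus "(LBINT x. indicator {0<..} x * (exp (- x) * cos (w * x))) = 1 / (1 + w\<^sup>2)"
    by (simp add: set_lebesgue_integral_def)
qed

lemma abs_sin_le: "\<bar>sin (w * a)\<bar> \<le> \<bar>w\<bar> * \<bar>a\<bar>" for w a :: real
  using abs_sin_x_le_abs_x[of "w * a"] by (simp add: abs_mult)

lemma indicator_mult_mono:
  fixes x y :: real
  assumes "\<bar>x\<bar> \<le> y"
  shows "norm (indicator A w * x) \<le> norm (indicator A w * y)"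
  using assms by (auto split: split_indicator)

text \<open>Since \<open>1 / (1 + w\<^sup>2)\<close> is the cosine transform of \<open>e\<^bsup>- x\<^esup>\<close>, Fubini reduces the integral over
  \<open>{0..T}\<close> to values of \<open>Si\<close>, which tends to \<open>pi / 2\<close>.\<close>

lemma has_integral_sin_over_square1:
  fixes a :: real
  assumes a: "a \<ge> 0"
  shows "has_bochner_integral lborel (\<lambda>w. indicator {0..} w * (sin (w * a) / (w * (1 + w\<^sup>2)))) (pi / 2 * (1 - exp (- a)))"
proof -
  let ?q = "\<lambda>w. sin (w * a) / (w * (1 + w\<^sup>2))"
  have q: "\<bar>?q w\<bar> \<le> a * (1 / (1 + w\<^sup>2))" for w
  proof (cases "w = 0")
    case False
    have p: "1 + w\<^sup>2 > 0" by (simp add: add_pos_nonneg)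
    have "\<bar>?q w\<bar> = \<bar>sin (w * a)\<bar> / (\<bar>w\<bar> * (1 + w\<^sup>2))" using p by (simp add: abs_mult)
    also have "\<dots> \<le> (\<bar>w\<bar> * a) / (\<bar>w\<bar> * (1 + w\<^sup>2))"
      using abs_sin_le[of w a] a p by (intro divide_right_mono) auto
    also have "\<dots> = a * (1 / (1 + w\<^sup>2))" using False by simp
    finally show ?thesis .
  qed (use a in simp)
  have dom: "integrable lborel (\<lambda>w. indicator {0..} w * (a * (1 / (1 + w\<^sup>2))))"
    using Bochner_Integration.integrable_mult_right[OF set_integrable_inverse_add_square[of 1, unfolded set_integrable_def], of a]
    by (simp add: mult_ac)
  have i: "integrable lborel (\<lambda>w. indicator {0..} w * ?q w)"
    by (rule Bochner_Integration.integrable_bound[OF dom])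
       (measurable, intro always_eventually allI indicator_mult_mono q)
  obtain B where B: "\<And>t. \<bar>Si t\<bar> \<le> B" using bounded_Si by blast
  have B0: "B \<ge> 0" using B[of 0] by linarith
  \<comment> \<open>The product-to-sum formula for sin (w a) cos (w x), integrated against 1 / w
    over [0, T]; \<open>sgn\<close> accounts for a - x < 0.\<close>
  define J where "J T x = (sgn (a + x) * Si (T * \<bar>a + x\<bar>) + sgn (a - x) * Si (T * \<bar>a - x\<bar>)) / 2" for T x
  \<comment> \<open>Without the cut at T the double integrand decays only like 1 / w, which for a >
    0 is not absolutely integrable.\<close>
  have fub: "(LBINT w:{0..T}. ?q w) = (LBINT x. indicator {0<..} x * (exp (- x) * J T x))" if T: "T \<ge> 0" for T
  proof -
    define f where "f = (\<lambda>(w, x). indicator {0..T} w * indicator {0<..} x * (exp (- x) * (sin (w * a) * cos (w * x) / w)))"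
    have "integrable (lborel \<Otimes>\<^sub>M lborel) f"
    proof (rule integrable_pair_bound)
      show "integrable lborel (\<lambda>w. indicator {0..T} w * a)"
        by (intro Bochner_Integration.integrable_mult_left integrable_real_indicator) (auto simp: emeasure_lborel_Icc_eq)
      show "integrable lborel (\<lambda>x::real. indicator {0<..} x * exp (- x))" using integrable_exp_Ioi[of 1] by simp
      show "f \<in> borel_measurable (lborel \<Otimes>\<^sub>M lborel)" unfolding f_def by measurable
      fix w x
      have "\<bar>sin (w * a) * cos (w * x) / w\<bar> \<le> a"
      proof (cases "w = 0")
        case False
        have "\<bar>sin (w * a) * cos (w * x)\<bar> \<le> (\<bar>w\<bar> * a) * 1"
          unfolding abs_mult using abs_sin_le[of w a] a by (intro mult_mono) auto
        thus ?thesis using False by (simp add: abs_divide pos_divide_le_eq mult.commute)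
      qed (use a in simp)
      from mult_left_mono[OF this, of "exp (- x)"]
      show "norm (f (w, x)) \<le> indicator {0..T} w * a * (indicator {0<..} x * exp (- x))"
        unfolding f_def by (auto split: split_indicator simp: abs_mult abs_divide mult.commute[of a])
    qed
    hence "(\<integral>x. (\<integral>w. f (w, x) \<partial>lborel) \<partial>lborel) = (\<integral>w. (\<integral>x. f (w, x) \<partial>lborel) \<partial>lborel)"
      by (rule lborel_pair.Fubini_integral[of "\<lambda>w x. f (w, x)", simplified])
    moreover have "(\<integral>x. f (w, x) \<partial>lborel) = indicator {0..T} w * ?q w" for w
    proof -
      have "(\<integral>x. f (w, x) \<partial>lborel) = (\<integral>x. indicator {0..T} w * (sin (w * a) / w) * (indicator {0<..} x * (exp (- x) * cos (w * x))) \<partial>lborel)"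
        unfolding f_def by (intro Bochner_Integration.integral_cong) auto
      also have "\<dots> = indicator {0..T} w * (sin (w * a) / w) * (1 / (1 + w\<^sup>2))"
        unfolding integral_exp_cos(2)[symmetric] by (rule Bochner_Integration.integral_mult_right_zero)
      finally show ?thesis by simp
    qed
    moreover have "(\<integral>w. f (w, x) \<partial>lborel) = indicator {0<..} x * (exp (- x) * J T x)" for x
    proof -
      have s: "set_integrable lborel {0..T} (\<lambda>w. sin (w * \<theta>) / w)"
        "(LBINT w:{0..T}. sin (w * \<theta>) / w) = sgn \<theta> * Si (T * \<bar>\<theta>\<bar>)" for \<theta>
      proof -
        have "integrable lborel (\<lambda>w. indicator {0..T} w * \<bar>\<theta>\<bar>)"
          by (intro Bochner_Integration.integrable_mult_left integrable_real_indicator) (auto simp: emeasure_lborel_Icc_eq)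
        thus "set_integrable lborel {0..T} (\<lambda>w. sin (w * \<theta>) / w)"
          unfolding set_integrable_def real_scaleR_def
        proof (rule Bochner_Integration.integrable_bound, goal_cases)
          case 2
          have "\<bar>sin (w * \<theta>) / w\<bar> \<le> \<bar>\<theta>\<bar>" for w
            using abs_sin_le[of w \<theta>] by (cases "w = 0") (auto simp: abs_divide pos_divide_le_eq mult.commute)
          thus ?case by (intro always_eventually allI indicator_mult_mono)
        qed measurable
        show "(LBINT w:{0..T}. sin (w * \<theta>) / w) = sgn \<theta> * Si (T * \<bar>\<theta>\<bar>)"
          using LBINT_I0c_sin_scale_divide[OF T, of \<theta>]
            interval_integral_Icc[of 0 T "\<lambda>w. sin (w * \<theta>) / w"] T by (simp add: zero_ereal_def)
      qed
      have "(\<integral>w. f (w, x) \<partial>lborel) = (\<integral>w. (indicator {0<..} x * exp (- x) / 2) * (indicator {0..T} w *\<^sub>R (sin (w * (a + x)) / w) + indicator {0..T} w *\<^sub>R (sin (w * (a - x)) / w)) \<partial>lborel)"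
        unfolding f_def
        by (intro Bochner_Integration.integral_cong)
           (auto simp: sin_times_cos distrib_left right_diff_distrib add_divide_distrib[symmetric] split: split_indicator)
      also have "\<dots> = (indicator {0<..} x * exp (- x) / 2) * (sgn (a + x) * Si (T * \<bar>a + x\<bar>) + sgn (a - x) * Si (T * \<bar>a - x\<bar>))"
        unfolding Bochner_Integration.integral_mult_right_zero
        using s[unfolded set_integrable_def set_lebesgue_integral_def]
        by (subst Bochner_Integration.integral_add) auto
      finally show ?thesis unfolding J_def by simp
    qed
    ultimately show ?thesis by (simp add: set_lebesgue_integral_def)
  qed
  have Jb: "\<bar>J T x\<bar> \<le> B" for T x
  proof -
    have "\<bar>sgn t * Si s\<bar> \<le> B" for t s using B[of s] B0 by (auto simp: sgn_real_def)
    moreover have "\<bar>(s + t) / 2\<bar> \<le> B" if "\<bar>s\<bar> \<le> B" "\<bar>t\<bar> \<le> B" for s t :: real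
    proof -
      have "\<bar>s + t\<bar> \<le> 2 * B" using that by linarith
      thus ?thesis by simp
    qed
    ultimately show ?thesis unfolding J_def by blast
  qed
  have [measurable]: "J T \<in> borel_measurable borel" for T unfolding J_def by measurable
  \<comment> \<open>For x < a both terms tend to pi / 2, for x > a they cancel. Hence only the
    integral of e^(- x) over (0, a) survives; the point x = a is null.\<close>
  have Jlim: "(\<lambda>n. J (real n) x) \<longlonglongrightarrow> pi / 2 * indicator {..<a} x" if x: "x > 0" "x \<noteq> a" for x
  proof -
    have s: "(\<lambda>n. sgn \<theta> * Si (real n * \<bar>\<theta>\<bar>)) \<longlonglongrightarrow> sgn \<theta> * (pi / 2)" if "\<theta> \<noteq> 0" for \<theta>
    proof (intro tendsto_mult tendsto_const filterlim_compose[OF Si_at_top])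
      show "filterlim (\<lambda>n. real n * \<bar>\<theta>\<bar>) at_top sequentially"
        using that by (intro filterlim_at_top_mult_tendsto_pos[OF tendsto_const _ filterlim_real_sequentially]) auto
    qed
    have "(\<lambda>n. J (real n) x) \<longlonglongrightarrow> (sgn (a + x) * (pi / 2) + sgn (a - x) * (pi / 2)) / 2"
      unfolding J_def using x a by (intro tendsto_divide tendsto_add s tendsto_const) auto
    moreover have "(sgn (a + x) * (pi / 2) + sgn (a - x) * (pi / 2)) / 2 = pi / 2 * indicator {..<a} x"
      using x a by (auto simp: sgn_real_def split: split_indicator)
    ultimately show ?thesis by (simp only:)
  qed
  have lim1: "(\<lambda>n. (LBINT x. indicator {0<..} x * (exp (- x) * J (real n) x)))
      \<longlonglongrightarrow> (LBINT x. indicator {0<..} x * (exp (- x) * (pi / 2 * indicator {..<a} x)))"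
  proof (rule integral_dominated_convergence[where w = "\<lambda>x. B * (indicator {0<..} x * exp (- x))"])
    show "integrable lborel (\<lambda>x. B * (indicator {0<..} x * exp (- x)))" using integrable_exp_Ioi[of 1] by simp
    have "AE x in lborel. x \<noteq> a" by (rule AE_lborel_singleton)
    thus "AE x in lborel. (\<lambda>n. indicator {0<..} x * (exp (- x) * J (real n) x)) \<longlonglongrightarrow> indicator {0<..} x * (exp (- x) * (pi / 2 * indicator {..<a} x))"
    proof eventually_elim
      case (elim x)
      thus ?case using tendsto_mult_left[OF Jlim[of x], of "exp (- x)"] by (cases "x > 0") auto
    qed
    show "AE x in lborel. norm (indicator {0<..} x * (exp (- x) * J (real n) x)) \<le> B * (indicator {0<..} x * exp (- x))" for n
      using Jb by (auto split: split_indicator simp: abs_mult mult.commute[of B])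
  qed measurable
  have val: "(LBINT x. indicator {0<..} x * (exp (- x) * (pi / 2 * indicator {..<a} x))) = pi / 2 * (1 - exp (- a))"
  proof -
    have "(LBINT x. indicator {0<..} x * (exp (- x) * (pi / 2 * indicator {..<a} x))) = (LBINT x. pi / 2 * (indicator {0<..<a} x *\<^sub>R exp (- x)))"
      by (intro Bochner_Integration.integral_cong) (auto split: split_indicator)
    also have "\<dots> = pi / 2 * (LBINT x=0..ereal a. exp (- x))"
      unfolding Bochner_Integration.integral_mult_right_zero
      using a by (simp add: interval_lebesgue_integral_def set_lebesgue_integral_def zero_ereal_def)
    also have "(LBINT x=0..ereal a. exp (- x)) = (- exp (- a)) - (- exp (- 0))"
      unfolding zero_ereal_def
      by (rule interval_integral_FTC_finite)
         (auto intro!: continuous_intros derivative_eq_intros simp flip: has_real_derivative_iff_has_vector_derivative)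
    finally show ?thesis by simp
  qed
  have lim2: "(\<lambda>n. LBINT w:{0..real n}. ?q w) \<longlonglongrightarrow> (LBINT w. indicator {0..} w * ?q w)"
    unfolding set_lebesgue_integral_def
  proof (rule integral_dominated_convergence[where w = "\<lambda>w. indicator {0..} w * (a * (1 / (1 + w\<^sup>2)))"])
    show "AE w in lborel. (\<lambda>n. indicator {0..real n} w *\<^sub>R ?q w) \<longlonglongrightarrow> indicator {0..} w * ?q w"
    proof (intro always_eventually allI)
      fix w :: real
      obtain k :: nat where "w \<le> real k" using real_arch_simple by blast
      hence "\<forall>n\<ge>k. indicator {0..real n} w *\<^sub>R ?q w = indicator {0..} w * ?q w"
        by (auto split: split_indicator)
      thus "(\<lambda>n. indicator {0..real n} w *\<^sub>R ?q w) \<longlonglongrightarrow> indicator {0..} w * ?q w"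
        by (intro tendsto_eventually) (auto simp: eventually_sequentially)
    qed
    show "AE w in lborel. norm (indicator {0..real n} w *\<^sub>R ?q w) \<le> indicator {0..} w * (a * (1 / (1 + w\<^sup>2)))" for n
      using indicator_mult_mono[OF q, of "{0..real n}"] a
      by (intro always_eventually allI) (auto split: split_indicator intro: order_trans[OF q] simp del: abs_divide)
  qed (use dom in measurable)
  have "(LBINT w. indicator {0..} w * ?q w) = pi / 2 * (1 - exp (- a))"
    by (rule LIMSEQ_unique[OF lim2]) (use lim1 val fub in simp)
  with i show ?thesis by (simp add: has_bochner_integral_iff)
qed


lemma has_integral_sin_over_square:
  fixes a k :: real
  assumes a: "a \<ge> 0" and k: "k > 0"
  shows "has_bochner_integral lborel (\<lambda>w. indicator {0..} w * (sin (w * a) / (w * (k\<^sup>2 + w\<^sup>2))))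
    (pi / (2 * k\<^sup>2) * (1 - exp (- (k * a))))"
proof -
  let ?f = "\<lambda>w. indicator {0..} w * (sin (w * (k * a)) / (w * (1 + w\<^sup>2)))"
  have "has_bochner_integral lborel ?f (pi / 2 * (1 - exp (- (k * a))))"
    by (rule has_integral_sin_over_square1) (use a k in simp)
  hence "has_bochner_integral lborel (\<lambda>w. ?f (0 + (1 / k) * w)) ((pi / 2 * (1 - exp (- (k * a)))) /\<^sub>R \<bar>1 / k\<bar>)"
    using k by (subst (asm) lborel_has_bochner_integral_real_affine_iff[where c = "1 / k" and t = 0]) auto
  \<comment> \<open>Scaling by 1 / k turns w (1 + w^2) into w (k^2 + w^2) / k^3, which calls for the
    factor 1 / k^3; the Jacobian returns one k.\<close>
  hence "has_bochner_integral lborel (\<lambda>w. (1 / k ^ 3) * ?f (0 + (1 / k) * w)) ((1 / k ^ 3) * ((pi / 2 * (1 - exp (- (k * a)))) /\<^sub>R \<bar>1 / k\<bar>))"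
    by (rule has_bochner_integral_mult_right)
  moreover have "(1 / k ^ 3) * ?f (0 + (1 / k) * w) = indicator {0..} w * (sin (w * a) / (w * (k\<^sup>2 + w\<^sup>2)))" for w
  proof -
    have *: "w / k * (1 + (w / k)\<^sup>2) = w * (k\<^sup>2 + w\<^sup>2) / k ^ 3"
      using k by (simp add: field_simps power2_eq_square power3_eq_cube)
    have ind: "indicator {0..} (w / k) = (indicator {0..} w :: real)"
      using k by (auto split: split_indicator simp: zero_le_divide_iff)
    have e: "0 + (1 / k) * w = w / k" "w / k * (k * a) = w * a" using k by simp_all
    show ?thesis unfolding e ind * using k by simp
  qed
  moreover have "(1 / k ^ 3) * ((pi / 2 * (1 - exp (- (k * a)))) /\<^sub>R \<bar>1 / k\<bar>) = pi / (2 * k\<^sup>2) * (1 - exp (- (k * a)))"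
    using k by (simp add: power2_eq_square power3_eq_cube)
  ultimately show ?thesis by simp
qed

lemma integrable_cos_over_square:
  fixes a k :: real
  assumes k: "k > 0"
  shows "integrable lborel (\<lambda>w. indicator {0..} w * (cos (w * a) / (k\<^sup>2 + w\<^sup>2)))"
proof -
  have "integrable lborel (\<lambda>w. indicator {0..} w * (1 / (k\<^sup>2 + w\<^sup>2)))"
    using set_integrable_inverse_add_square[of "k\<^sup>2"] k by (simp add: set_integrable_def)
  thus ?thesis
  proof (rule Bochner_Integration.integrable_bound)
    have "\<bar>cos (w * a) / (k\<^sup>2 + w\<^sup>2)\<bar> \<le> 1 / (k\<^sup>2 + w\<^sup>2)" for w
      using k by (auto simp: abs_divide intro!: divide_right_mono)
    thus "AE w in lborel. norm (indicator {0..} w * (cos (w * a) / (k\<^sup>2 + w\<^sup>2))) \<le> norm (indicator {0..} w * (1 / (k\<^sup>2 + w\<^sup>2)))"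
      by (intro always_eventually allI indicator_mult_mono)
  qed measurable
qed

text \<open>By Fubini the integral of G over [0, x] is the sine integral already known, and G is
  continuous, so G is its derivative. The two-sided derivative settles a > 0, and a = 0 follows by
  continuity.\<close>

lemma has_integral_cos_over_square:
  fixes a k :: real
  assumes a: "a \<ge> 0" and k: "k > 0"
  shows "has_bochner_integral lborel (\<lambda>w. indicator {0..} w * (cos (w * a) / (k\<^sup>2 + w\<^sup>2)))
    (pi / (2 * k) * exp (- (k * a)))"
proof -
  define G where "G a = (LBINT w. indicator {0..} w * (cos (w * a) / (k\<^sup>2 + w\<^sup>2)))" for a
  have den: "k\<^sup>2 + w\<^sup>2 > 0" for w using k by (simp add: add_pos_nonneg)
  have bd: "\<bar>cos (w * a) / (k\<^sup>2 + w\<^sup>2)\<bar> \<le> 1 / (k\<^sup>2 + w\<^sup>2)" for w a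
    using k by (auto simp: abs_divide intro!: divide_right_mono)
  have dom: "integrable lborel (\<lambda>w. indicator {0..} w * (1 / (k\<^sup>2 + w\<^sup>2)))"
    using integrable_cos_over_square[OF k, of 0] by simp
  have G_cont: "continuous_on UNIV G"
    unfolding continuous_on_sequentially G_def comp_def
  proof (intro ballI allI impI)
    fix X :: "nat \<Rightarrow> real" and a assume "(\<forall>n. X n \<in> UNIV) \<and> X \<longlonglongrightarrow> a"
    hence X: "X \<longlonglongrightarrow> a" by simp
    show "(\<lambda>n. LBINT w. indicator {0..} w * (cos (w * X n) / (k\<^sup>2 + w\<^sup>2))) \<longlonglongrightarrow> (LBINT w. indicator {0..} w * (cos (w * a) / (k\<^sup>2 + w\<^sup>2)))"
    proof (rule integral_dominated_convergence[OF _ _ dom])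
      show "AE w in lborel. (\<lambda>n. indicator {0..} w * (cos (w * X n) / (k\<^sup>2 + w\<^sup>2))) \<longlonglongrightarrow> indicator {0..} w * (cos (w * a) / (k\<^sup>2 + w\<^sup>2))"
        by (intro always_eventually allI tendsto_intros X) (metis den less_irrefl)
      show "AE w in lborel. norm (indicator {0..} w * (cos (w * X n) / (k\<^sup>2 + w\<^sup>2))) \<le> indicator {0..} w * (1 / (k\<^sup>2 + w\<^sup>2))" for n
      proof (intro always_eventually allI)
        fix w
        have "norm (indicator {0..} w * (cos (w * X n) / (k\<^sup>2 + w\<^sup>2))) \<le> norm (indicator {0..} w * (1 / (k\<^sup>2 + w\<^sup>2)))"
          by (rule indicator_mult_mono[OF bd])
        also have "\<dots> = indicator {0..} w * (1 / (k\<^sup>2 + w\<^sup>2))" using den[of w] by (auto split: split_indicator)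
        finally show "norm (indicator {0..} w * (cos (w * X n) / (k\<^sup>2 + w\<^sup>2))) \<le> indicator {0..} w * (1 / (k\<^sup>2 + w\<^sup>2))" .
      qed
    qed measurable
  qed
  let ?S = "\<lambda>x. pi / (2 * k\<^sup>2) * (1 - exp (- (k * x)))"
  have S: "(LBINT s=ereal 0..ereal x. G s) = ?S x" if x: "x \<ge> 0" for x
  proof -
    define f where "f = (\<lambda>(w, s). indicator {0..} w * indicator {0..x} s * (cos (w * s) / (k\<^sup>2 + w\<^sup>2)))"
    have "integrable (lborel \<Otimes>\<^sub>M lborel) f"
    proof (rule integrable_pair_bound[OF _ dom])
      show "integrable lborel (indicator {0..x} :: real \<Rightarrow> real)"
        by (intro integrable_real_indicator) (auto simp: emeasure_lborel_Icc_eq)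
      show "f \<in> borel_measurable (lborel \<Otimes>\<^sub>M lborel)" unfolding f_def by measurable
      fix w s
      show "norm (f (w, s)) \<le> indicator {0..} w * (1 / (k\<^sup>2 + w\<^sup>2)) * indicator {0..x} s"
        using bd[of w s] unfolding f_def by (auto split: split_indicator)
    qed
    hence "(\<integral>s. (\<integral>w. f (w, s) \<partial>lborel) \<partial>lborel) = (\<integral>w. (\<integral>s. f (w, s) \<partial>lborel) \<partial>lborel)"
      by (rule lborel_pair.Fubini_integral[of "\<lambda>w x. f (w, x)", simplified])
    moreover have "(\<integral>w. f (w, s) \<partial>lborel) = indicator {0..x} s *\<^sub>R G s" for s
    proof -
      have "(\<integral>w. f (w, s) \<partial>lborel) = (\<integral>w. indicator {0..x} s * (indicator {0..} w * (cos (w * s) / (k\<^sup>2 + w\<^sup>2))) \<partial>lborel)"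
        unfolding f_def by (intro Bochner_Integration.integral_cong) auto
      thus ?thesis unfolding Bochner_Integration.integral_mult_right_zero G_def by simp
    qed
    moreover have "(\<integral>s. f (w, s) \<partial>lborel) = indicator {0..} w * (sin (w * x) / (w * (k\<^sup>2 + w\<^sup>2)))" if "w \<noteq> 0" for w
    proof -
      have "(\<integral>s. f (w, s) \<partial>lborel) = (\<integral>s. (indicator {0..} w / (k\<^sup>2 + w\<^sup>2)) * (indicator {0..x} s *\<^sub>R cos (w * s)) \<partial>lborel)"
        unfolding f_def by (intro Bochner_Integration.integral_cong) auto
      also have "\<dots> = (indicator {0..} w / (k\<^sup>2 + w\<^sup>2)) * (LBINT s=ereal 0..ereal x. cos (w * s))"
        unfolding Bochner_Integration.integral_mult_right_zero
        using interval_integral_Icc[OF x, of "\<lambda>s. cos (w * s)"] by (simp add: set_lebesgue_integral_def)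
      also have "(LBINT s=ereal 0..ereal x. cos (w * s)) = sin (w * x) / w - sin (w * 0) / w"
        using that
        by (intro interval_integral_FTC_finite)
         (auto intro!: continuous_intros derivative_eq_intros simp flip: has_real_derivative_iff_has_vector_derivative)
      finally show ?thesis by simp
    qed
    moreover have "(\<integral>w. (\<integral>s. f (w, s) \<partial>lborel) \<partial>lborel) = (\<integral>w. indicator {0..} w * (sin (w * x) / (w * (k\<^sup>2 + w\<^sup>2))) \<partial>lborel)"
    \<comment> \<open>At w = 0 the quotient sin (w x) / w is 0 by convention, whereas the integral
      of the cosine is x; a single point does not matter.\<close>
    proof (rule integral_discrete_difference[of "{0}"])
      fix w :: real assume "w \<notin> {0}"
      thus "(\<integral>s. f (w, s) \<partial>lborel) = indicator {0..} w * (sin (w * x) / (w * (k\<^sup>2 + w\<^sup>2)))"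
        using calculation(3)[of w] by simp
    qed auto
    ultimately have "(LBINT s:{0..x}. G s) = (\<integral>w. indicator {0..} w * (sin (w * x) / (w * (k\<^sup>2 + w\<^sup>2))) \<partial>lborel)"
      by (simp add: set_lebesgue_integral_def)
    also have "\<dots> = ?S x" using has_integral_sin_over_square[OF x k] by (simp add: has_bochner_integral_iff)
    finally show ?thesis using interval_integral_Icc[OF x, of G] by simp
  qed
  have pos: "G x = pi / (2 * k) * exp (- (k * x))" if x: "x > 0" for x
  proof -
    have "((\<lambda>u. LBINT s=ereal 0..ereal u. G s) has_vector_derivative G x) (at x within {0..x + 1})"
      by (rule interval_integral_FTC2) (use x G_cont in \<open>auto intro: continuous_on_subset\<close>)
    hence "((\<lambda>u. LBINT s=ereal 0..ereal u. G s) has_vector_derivative G x) (at x within {0<..<x + 1})"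
      by (rule has_vector_derivative_within_subset) auto
    moreover have "at x within {0<..<x + 1} = at x" by (rule at_within_open) (use x in auto)
    ultimately have "((\<lambda>u. LBINT s=ereal 0..ereal u. G s) has_vector_derivative G x) (at x)"
      by (simp only:)
    hence "(?S has_vector_derivative G x) (at x)"
    proof (rule has_vector_derivative_transform_within_open[where S = "{0<..}"])
      fix u :: real assume "u \<in> {0<..}"
      thus "(LBINT s=ereal 0..ereal u. G s) = ?S u" by (intro S) simp
    qed (use x in simp_all)
    hence 1: "(?S has_real_derivative G x) (at x)" by (simp add: has_real_derivative_iff_has_vector_derivative)
    have "(?S has_real_derivative pi / (2 * k\<^sup>2) * (0 - exp (- (k * x)) * (- k))) (at x)"
      using k by (auto intro!: derivative_eq_intros simp: power2_eq_square)
    from DERIV_unique[OF 1 this] show ?thesis using k by (simp add: power2_eq_square)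
  qed
  have "G a = pi / (2 * k) * exp (- (k * a))"
  proof (cases "a = 0")
    case True
    have "(G \<longlongrightarrow> G 0) (at_right 0)"
      using G_cont by (auto simp: continuous_on_def intro: tendsto_within_subset)
    moreover have "((\<lambda>x. pi / (2 * k) * exp (- (k * x))) \<longlongrightarrow> pi / (2 * k) * exp (- (k * 0))) (at_right 0)"
      by (intro tendsto_intros)
    hence "(G \<longlongrightarrow> pi / (2 * k) * exp (- (k * 0))) (at_right 0)"
      by (rule Lim_transform_eventually)
         (auto simp: pos eventually_at_filter)
    ultimately show ?thesis using True tendsto_unique[of "at_right (0::real)" G] by simp
  qed (use pos a in simp)
  thus ?thesis using integrable_cos_over_square[OF k, of a] unfolding G_def by (simp add: has_bochner_integral_iff)
qed

section \<open>Partial fractions and the resolvent kernel\<close>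

text \<open>w^2 / ((b^2 + w^2) (k^2 + w^2)) is the difference of k^2 / (k^2 + w^2) and b^2 / (b^2 +
  w^2), divided by k^2 - b^2. Multiplied by sin (w a) / w it consists of known integrals.\<close>

lemma has_integral_sin_product:
  fixes a k b :: real
  assumes a: "a \<ge> 0" and k: "k > 0" and b: "b > 0" and kb: "k \<noteq> b"
  shows "has_bochner_integral lborel (\<lambda>w. indicator {0..} w * (w * sin (w * a) / ((b\<^sup>2 + w\<^sup>2) * (k\<^sup>2 + w\<^sup>2))))
    (pi / 2 * (exp (- (b * a)) - exp (- (k * a))) / (k\<^sup>2 - b\<^sup>2))"
proof -
  have nz: "k\<^sup>2 - b\<^sup>2 \<noteq> 0" using k b kb by (simp add: power2_eq_iff)
  let ?q = "\<lambda>k w. indicator {0..} w * (sin (w * a) / (w * (k\<^sup>2 + w\<^sup>2)))"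
  have "has_bochner_integral lborel (\<lambda>w. (k\<^sup>2 / (k\<^sup>2 - b\<^sup>2)) * ?q k w - (b\<^sup>2 / (k\<^sup>2 - b\<^sup>2)) * ?q b w)
     ((k\<^sup>2 / (k\<^sup>2 - b\<^sup>2)) * (pi / (2 * k\<^sup>2) * (1 - exp (- (k * a)))) - (b\<^sup>2 / (k\<^sup>2 - b\<^sup>2)) * (pi / (2 * b\<^sup>2) * (1 - exp (- (b * a)))))"
    by (intro has_bochner_integral_diff has_bochner_integral_mult_right has_integral_sin_over_square assms)
  moreover have "(k\<^sup>2 / (k\<^sup>2 - b\<^sup>2)) * ?q k w - (b\<^sup>2 / (k\<^sup>2 - b\<^sup>2)) * ?q b w
      = indicator {0..} w * (w * sin (w * a) / ((b\<^sup>2 + w\<^sup>2) * (k\<^sup>2 + w\<^sup>2)))" for w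
  proof (cases "w = 0")
    case False
    have d: "b\<^sup>2 + w\<^sup>2 \<noteq> 0" "k\<^sup>2 + w\<^sup>2 \<noteq> 0"
      using k b by (simp_all add: sum_power2_eq_zero_iff)
    have *: "(k2 / (k2 - b2)) * (s / (w * (k2 + w2))) - (b2 / (k2 - b2)) * (s / (w * (b2 + w2))) = w * s / ((b2 + w2) * (k2 + w2))"
      if "k2 - b2 \<noteq> 0" "b2 + w2 \<noteq> 0" "k2 + w2 \<noteq> 0" "w2 = w * w" for k2 b2 w2 s :: real
      using that False by (simp add: divide_simps) (simp add: algebra_simps)
    show ?thesis using *[OF nz d, of "sin (w * a)"] by (auto simp: power2_eq_square split: split_indicator)
  qed simp
  moreover have "(k\<^sup>2 / (k\<^sup>2 - b\<^sup>2)) * (pi / (2 * k\<^sup>2) * (1 - exp (- (k * a)))) - (b\<^sup>2 / (k\<^sup>2 - b\<^sup>2)) * (pi / (2 * b\<^sup>2) * (1 - exp (- (b * a))))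
     = pi / 2 * (exp (- (b * a)) - exp (- (k * a))) / (k\<^sup>2 - b\<^sup>2)"
    using k b nz by (simp add: divide_simps) (simp add: algebra_simps)
  ultimately show ?thesis by (simp only:)
qed

lemma has_integral_cos_product:
  fixes a k b :: real
  assumes a: "a \<ge> 0" and k: "k > 0" and b: "b > 0" and kb: "k \<noteq> b"
  shows "has_bochner_integral lborel (\<lambda>w. indicator {0..} w * (w\<^sup>2 * cos (w * a) / ((b\<^sup>2 + w\<^sup>2) * (k\<^sup>2 + w\<^sup>2))))
    (pi / 2 * (k * exp (- (k * a)) - b * exp (- (b * a))) / (k\<^sup>2 - b\<^sup>2))"
proof -
  have nz: "k\<^sup>2 - b\<^sup>2 \<noteq> 0" using k b kb by (simp add: power2_eq_iff)
  let ?q = "\<lambda>k w. indicator {0..} w * (cos (w * a) / (k\<^sup>2 + w\<^sup>2))"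
  have "has_bochner_integral lborel (\<lambda>w. (k\<^sup>2 / (k\<^sup>2 - b\<^sup>2)) * ?q k w - (b\<^sup>2 / (k\<^sup>2 - b\<^sup>2)) * ?q b w)
     ((k\<^sup>2 / (k\<^sup>2 - b\<^sup>2)) * (pi / (2 * k) * exp (- (k * a))) - (b\<^sup>2 / (k\<^sup>2 - b\<^sup>2)) * (pi / (2 * b) * exp (- (b * a))))"
    by (intro has_bochner_integral_diff has_bochner_integral_mult_right has_integral_cos_over_square assms)
  moreover have "(k\<^sup>2 / (k\<^sup>2 - b\<^sup>2)) * ?q k w - (b\<^sup>2 / (k\<^sup>2 - b\<^sup>2)) * ?q b w
      = indicator {0..} w * (w\<^sup>2 * cos (w * a) / ((b\<^sup>2 + w\<^sup>2) * (k\<^sup>2 + w\<^sup>2)))" for w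
  proof -
    have d: "b\<^sup>2 + w\<^sup>2 \<noteq> 0" "k\<^sup>2 + w\<^sup>2 \<noteq> 0"
      using k b by (simp_all add: sum_power2_eq_zero_iff)
    have *: "(k2 / (k2 - b2)) * (s / (k2 + w2)) - (b2 / (k2 - b2)) * (s / (b2 + w2)) = w2 * s / ((b2 + w2) * (k2 + w2))"
      if "k2 - b2 \<noteq> 0" "b2 + w2 \<noteq> 0" "k2 + w2 \<noteq> 0" for k2 b2 w2 s :: real
      using that by (simp add: divide_simps) (simp add: algebra_simps)
    show ?thesis using *[OF nz d, of "cos (w * a)"] by (auto split: split_indicator)
  qed
  moreover have "(k\<^sup>2 / (k\<^sup>2 - b\<^sup>2)) * (pi / (2 * k) * exp (- (k * a))) - (b\<^sup>2 / (k\<^sup>2 - b\<^sup>2)) * (pi / (2 * b) * exp (- (b * a)))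
     = pi / 2 * (k * exp (- (k * a)) - b * exp (- (b * a))) / (k\<^sup>2 - b\<^sup>2)"
    using k b nz by (simp add: divide_simps) (simp add: algebra_simps power2_eq_square)
  ultimately show ?thesis by (simp only:)
qed

text \<open>The kernel of \<open>(H + k\<^sup>2)\<inverse>\<close>. The assumption \<open>N k \<noteq> \<alpha>\<close> below only serves the partial fraction
  decomposition of \<open>1 / ((b\<^sup>2 + w\<^sup>2) (k\<^sup>2 + w\<^sup>2))\<close> with \<open>b = \<alpha> / N\<close>; the summand \<open>e\<^bsup>- b (x + y)\<^esup>\<close> cancels.\<close>

definition resolvent_kernel :: "real \<Rightarrow> real \<Rightarrow> 'n::finite \<Rightarrow> 'n \<Rightarrow> real \<Rightarrow> real \<Rightarrow> real" where
  "resolvent_kernel \<alpha> k j l x y = (if j = l then 1 else 0) * (exp (- (k * \<bar>x - y\<bar>)) - exp (- (k * (x + y)))) / (2 * k)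
    + exp (- (k * (x + y))) / (real CARD('n) * k + \<alpha>)"

lemma has_integral_sigma_S:
  fixes \<alpha> k x y :: real and j l :: "'n::finite"
  assumes \<alpha>: "\<alpha> > 0" and k: "k > 0" and kn: "real CARD('n) * k \<noteq> \<alpha>" and x: "x \<ge> 0" and y: "y \<ge> 0"
  shows "has_bochner_integral lborel (\<lambda>w. indicator {0..} w * (1 / (k\<^sup>2 + w\<^sup>2) * sigma_S \<alpha> j l w x y))
    (resolvent_kernel \<alpha> k j l x y)"
proof -
  define N where "N = real CARD('n)"
  have N: "N > 0" by (simp add: N_def)
  \<comment> \<open>\<alpha> / N makes the denominator of \<open>sigma_S\<close> equal to N^2 (b^2 +
    w^2), so the vertex term is a combination of the two product integrals at x + y.\<close>
  define b where "b = \<alpha> / N"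
  have b: "b > 0" and kb: "k \<noteq> b" and ab: "\<alpha> = N * b"
    using \<alpha> N kn by (auto simp: b_def N_def[symmetric] field_simps)
  define e where "e = (if j = l then 1 else 0 :: real)"
  let ?c = "\<lambda>a w. indicator {0..} w * (cos (w * a) / (k\<^sup>2 + w\<^sup>2))"
  let ?C = "\<lambda>w. indicator {0..} w * (w\<^sup>2 * cos (w * (x + y)) / ((b\<^sup>2 + w\<^sup>2) * (k\<^sup>2 + w\<^sup>2)))"
  let ?D = "\<lambda>w. indicator {0..} w * (w * sin (w * (x + y)) / ((b\<^sup>2 + w\<^sup>2) * (k\<^sup>2 + w\<^sup>2)))"
  let ?v = "e / pi * (pi / (2 * k) * exp (- (k * \<bar>x - y\<bar>)) - pi / (2 * k) * exp (- (k * (x + y))))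
      + (2 / pi / N * (pi / 2 * (k * exp (- (k * (x + y))) - b * exp (- (b * (x + y)))) / (k\<^sup>2 - b\<^sup>2))
       + 2 / pi * b / N * (pi / 2 * (exp (- (b * (x + y))) - exp (- (k * (x + y)))) / (k\<^sup>2 - b\<^sup>2)))"
  have "has_bochner_integral lborel (\<lambda>w. e / pi * (?c \<bar>x - y\<bar> w - ?c (x + y) w) + (2 / pi / N * ?C w + 2 / pi * b / N * ?D w)) ?v"
    by (intro has_bochner_integral_diff has_bochner_integral_add has_bochner_integral_mult_right
       has_integral_cos_over_square has_integral_cos_product has_integral_sin_product k b kb)
       (use x y in auto)
  moreover have "e / pi * (?c \<bar>x - y\<bar> w - ?c (x + y) w) + (2 / pi / N * ?C w + 2 / pi * b / N * ?D w)
     = indicator {0..} w * (1 / (k\<^sup>2 + w\<^sup>2) * sigma_S \<alpha> j l w x y)" for w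
  proof -
    have ca: "cos (w * \<bar>x - y\<bar>) = cos (w * (x - y))"
      using cos_minus[of "w * (x - y)"] by (cases "x \<ge> y") (auto simp: algebra_simps)
    have ss: "2 * (sin (w * x) * sin (w * y)) = cos (w * \<bar>x - y\<bar>) - cos (w * (x + y))"
      unfolding ca by (simp add: right_diff_distrib distrib_left cos_diff cos_add)
    have d: "b\<^sup>2 + w\<^sup>2 \<noteq> 0" "k\<^sup>2 + w\<^sup>2 \<noteq> 0"
      using k b by (simp_all add: sum_power2_eq_zero_iff)
    have D: "\<alpha>\<^sup>2 + N\<^sup>2 * w\<^sup>2 = N\<^sup>2 * (b\<^sup>2 + w\<^sup>2)" unfolding ab by (simp add: power_mult_distrib distrib_left)
    have "sigma_S \<alpha> j l w x y = e / pi * (2 * (sin (w * x) * sin (w * y)))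
       + (2 / pi) / (N\<^sup>2 * (b\<^sup>2 + w\<^sup>2)) * (N * w\<^sup>2 * cos (w * (x + y)) + (N * b) * w * sin (w * (x + y)))"
      unfolding sigma_S_def Let_def N_def[symmetric] e_def[symmetric] D using ab by simp
    also have "\<dots> = e / pi * (cos (w * \<bar>x - y\<bar>) - cos (w * (x + y)))
        + (2 / pi / N * (w\<^sup>2 * cos (w * (x + y)) / (b\<^sup>2 + w\<^sup>2)) + 2 / pi * b / N * (w * sin (w * (x + y)) / (b\<^sup>2 + w\<^sup>2)))"
      unfolding ss using N d by (simp add: divide_simps) (simp add: algebra_simps power2_eq_square)
    finally have s: "sigma_S \<alpha> j l w x y = \<dots>" .
    have "1 / K * (e / pi * (A - B) + (2 / pi / N * (C / L) + 2 / pi * b / N * (D / L)))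
      = e / pi * (A / K - B / K) + (2 / pi / N * (C / (L * K)) + 2 / pi * b / N * (D / (L * K)))" for A B C D K L
      by (simp add: right_diff_distrib distrib_left diff_divide_distrib mult_ac)
    thus ?thesis unfolding s by (simp split: split_indicator)
  qed
  moreover have "?v = resolvent_kernel \<alpha> k j l x y"
  proof -
    have nz: "k\<^sup>2 - b\<^sup>2 = (k - b) * (k + b)" by (simp add: power2_eq_square algebra_simps)
    have nn: "k - b \<noteq> 0" "k + b \<noteq> 0" using kb k b by auto
    define p q where "p = exp (- (k * (x + y)))" and "q = exp (- (b * (x + y)))"
    \<comment> \<open>The factor k - b of the numerator cancels against k^2 - b^2, which leaves N (k
      + b) = N k + \<alpha>.\<close>
    have "2 / pi / N * (pi / 2 * (k * p - b * q) / (k\<^sup>2 - b\<^sup>2)) + 2 / pi * b / N * (pi / 2 * (q - p) / (k\<^sup>2 - b\<^sup>2)) = p / (N * k + \<alpha>)"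
    proof -
      have "N * k + \<alpha> = N * (k + b)" unfolding ab by (simp add: distrib_left)
      moreover have "2 / pi / N * (pi / 2 * (k * p - b * q) / (k\<^sup>2 - b\<^sup>2)) + 2 / pi * b / N * (pi / 2 * (q - p) / (k\<^sup>2 - b\<^sup>2))
         = ((k * p - b * q) + b * (q - p)) / (N * (k\<^sup>2 - b\<^sup>2))"
      proof -
        have "2 / pi / N * (pi / 2 * X / Y) = X / (N * Y)" "2 / pi * b / N * (pi / 2 * X / Y) = b * X / (N * Y)" for X Y
          by simp_all
        thus ?thesis by (simp only: add_divide_distrib)
      qed
      moreover have "(k * p - b * q) + b * (q - p) = (k - b) * p" by (simp add: algebra_simps)
      ultimately show ?thesis unfolding nz using nn N by simp
    qed
    moreover have "e / pi * (pi / (2 * k) * A - pi / (2 * k) * B) = e * (A - B) / (2 * k)" for A B :: real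
      by (simp add: right_diff_distrib diff_divide_distrib)
    ultimately show ?thesis unfolding resolvent_kernel_def p_def q_def N_def e_def by (simp only:)
  qed
  ultimately show ?thesis by (simp only:)
qed

section \<open>Exponentially decaying functions\<close>

lemma half_line_integral: "(\<integral>x. f x \<partial>half_line) = (LBINT x:{0<..}. f x)"
  for f :: "real \<Rightarrow> 'a::{banach, second_countable_topology}"
  by (simp add: integral_restrict_space set_lebesgue_integral_def)

lemma half_line_integrable: "integrable half_line f \<longleftrightarrow> set_integrable lborel {0<..} f"
  for f :: "real \<Rightarrow> 'a::{banach, second_countable_topology}"
  by (simp add: integrable_restrict_space set_integrable_def)

lemma borel_measurable_half_line:
  "f \<in> borel_measurable borel \<Longrightarrow> f \<in> borel_measurable half_line"
  by (rule measurable_restrict_space1) simp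

text \<open>Continuity is required on the whole line although the graph lives on x > 0, so that
  derivatives at the vertex can be taken two-sided. For a rate b < k the resolvent maps the class
  into itself and can be iterated inside it.\<close>

definition decaying :: "real \<Rightarrow> (real \<Rightarrow> complex) \<Rightarrow> bool" where
  "decaying b g \<longleftrightarrow> continuous_on UNIV g \<and> (\<exists>C. \<forall>x\<ge>0. cmod (g x) \<le> C * exp (- (b * x)))"

lemma decayingE:
  assumes "decaying b g"
  obtains C where "C \<ge> 0" "\<And>x. x \<ge> 0 \<Longrightarrow> cmod (g x) \<le> C * exp (- (b * x))"
proof -
  obtain C where C: "\<forall>x\<ge>0. cmod (g x) \<le> C * exp (- (b * x))"
    using assms by (auto simp: decaying_def)
  hence "cmod (g 0) \<le> C" by (auto dest: spec[of _ 0])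
  hence "C \<ge> 0" using norm_ge_zero order_trans by blast
  with C that show ?thesis by blast
qed

lemma decaying_measurable: "decaying b g \<Longrightarrow> g \<in> borel_measurable borel"
  unfolding decaying_def by (auto intro: borel_measurable_continuous_onI)

lemma decaying_lin:
  assumes "decaying b f" "decaying b g"
  shows "decaying b (\<lambda>x. c * f x + d * g x)"
proof -
  obtain C where C: "\<And>x. x \<ge> 0 \<Longrightarrow> cmod (f x) \<le> C * exp (- (b * x))" using assms(1) by (rule decayingE) blast
  obtain D where D: "\<And>x. x \<ge> 0 \<Longrightarrow> cmod (g x) \<le> D * exp (- (b * x))" using assms(2) by (rule decayingE) blast
  have "cmod (c * f x + d * g x) \<le> (cmod c * C + cmod d * D) * exp (- (b * x))" if "x \<ge> 0" for x
  proof -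
    have "cmod (c * f x + d * g x) \<le> cmod c * cmod (f x) + cmod d * cmod (g x)"
      by (metis norm_mult norm_triangle_ineq)
    also have "\<dots> \<le> cmod c * (C * exp (- (b * x))) + cmod d * (D * exp (- (b * x)))"
      using C[OF that] D[OF that] by (intro add_mono mult_left_mono) auto
    finally show ?thesis by (simp add: algebra_simps)
  qed
  moreover have "continuous_on UNIV (\<lambda>x. c * f x + d * g x)"
    using assms by (auto simp: decaying_def intro!: continuous_intros)
  ultimately show ?thesis unfolding decaying_def by blast
qed

lemma decaying_integrable:
  assumes g: "decaying b g" and b: "b > 0"
  shows "integrable lborel (\<lambda>x. indicator {0<..} x *\<^sub>R g x)"
proof -
  have [measurable]: "g \<in> borel_measurable borel" by (rule decaying_measurable[OF g])
  obtain C where C: "C \<ge> 0" "\<And>x. x \<ge> 0 \<Longrightarrow> cmod (g x) \<le> C * exp (- (b * x))" using g by (rule decayingE) blast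
  have "integrable lborel (\<lambda>x. C * (indicator {0<..} x * exp (- (b * x))))"
    using integrable_exp_Ioi[OF b] by (rule Bochner_Integration.integrable_mult_right)
  thus ?thesis
    by (rule Bochner_Integration.integrable_bound) (auto split: split_indicator simp: abs_mult C)
qed

lemma decaying_L2:
  assumes g: "decaying b g" and b: "b > 0"
  shows "g \<in> L2"
proof -
  have [measurable]: "g \<in> borel_measurable borel" by (rule decaying_measurable[OF g])
  obtain C where C: "C \<ge> 0" "\<And>x. x \<ge> 0 \<Longrightarrow> cmod (g x) \<le> C * exp (- (b * x))" using g by (rule decayingE) blast
  have "integrable lborel (\<lambda>x. C\<^sup>2 * (indicator {0<..} x * exp (- (2 * b * x))))"
    using integrable_exp_Ioi[of "2 * b"] b by (intro Bochner_Integration.integrable_mult_right) simp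
  hence "integrable lborel (\<lambda>x. indicator {0<..} x *\<^sub>R (cmod (g x))\<^sup>2)"
  proof (rule Bochner_Integration.integrable_bound)
    show "AE x in lborel. norm (indicator {0<..} x *\<^sub>R (cmod (g x))\<^sup>2) \<le> norm (C\<^sup>2 * (indicator {0<..} x * exp (- (2 * b * x))))"
    proof (intro always_eventually allI)
      fix x
      have "x > 0 \<Longrightarrow> (cmod (g x))\<^sup>2 \<le> (C * exp (- (b * x)))\<^sup>2"
        using C(2)[of x] by (intro power_mono) auto
      thus "norm (indicator {0<..} x *\<^sub>R (cmod (g x))\<^sup>2) \<le> norm (C\<^sup>2 * (indicator {0<..} x * exp (- (2 * b * x))))"
        by (auto split: split_indicator simp: power_mult_distrib exp_double[symmetric] mult.assoc)
    qed
  qed measurable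
  thus ?thesis
    by (auto simp: L2_def half_line_integrable set_integrable_def intro!: borel_measurable_half_line decaying_measurable[OF g])
qed

lemma decaying_tendsto:
  assumes g: "decaying b g" and b: "b > 0"
  shows "(g \<longlongrightarrow> 0) at_top"
proof -
  obtain C where C: "C \<ge> 0" "\<And>x. x \<ge> 0 \<Longrightarrow> cmod (g x) \<le> C * exp (- (b * x))" using g by (rule decayingE) blast
  have "filterlim (\<lambda>x. b * x) at_top at_top"
    by (rule filterlim_tendsto_pos_mult_at_top[OF tendsto_const b filterlim_ident])
  hence "((\<lambda>x. exp (- (b * x))) \<longlongrightarrow> 0) at_top"
    by (intro filterlim_compose[OF exp_at_bot]) (simp add: filterlim_uminus_at_bot)
  thus ?thesis
  proof (rule tendsto_0_le[where K = C])
    show "\<forall>\<^sub>F x in at_top. cmod (g x) \<le> norm (exp (- (b * x))) * C"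
      using eventually_ge_at_top[of 0] by eventually_elim (use C in \<open>simp add: mult.commute\<close>)
  qed
qed

section \<open>The relation \<open>star_H\<close>\<close>

lemma test_function_derivative:
  fixes \<phi> :: "real \<Rightarrow> 'a::real_normed_vector"
  assumes "test_function \<phi>"
  obtains K \<psi> where "compact K" "K \<subseteq> {0<..}" "\<And>x. x \<notin> K \<Longrightarrow> \<phi> x = 0" "\<And>x. x \<notin> K \<Longrightarrow> \<psi> x = 0"
    "\<And>x. (\<phi> has_vector_derivative \<psi> x) (at x)" "continuous_on UNIV \<phi>" "continuous_on UNIV \<psi>"
    "\<And>x. vector_derivative \<phi> (at x) = \<psi> x"
proof -
  obtain D K where D: "D 0 = \<phi>" "\<And>k x. (D k has_vector_derivative D (Suc k) x) (at x)"
    and K: "compact K" "K \<subseteq> {0<..}" "\<And>x. x \<notin> K \<Longrightarrow> \<phi> x = 0"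
    using assms unfolding test_function_def by blast
  have d: "(\<phi> has_vector_derivative D 1 x) (at x)" for x using D(2)[of 0 x] D(1) by simp
  have "D 1 x = 0" if "x \<notin> K" for x
  proof -
    have "((\<lambda>_. 0) has_vector_derivative D 1 x) (at x)"
      by (rule has_vector_derivative_transform_within_open[OF d, where S = "- K"])
         (use that K in \<open>auto intro: compact_imp_closed\<close>)
    from vector_derivative_unique_at[OF this has_vector_derivative_const] show ?thesis .
  qed
  moreover have "continuous_on UNIV (D k)" for k
    using D(2) by (auto simp: continuous_on_eq_continuous_at intro: has_vector_derivative_continuous)
  from this[of 0] this[of 1] have "continuous_on UNIV \<phi>" "continuous_on UNIV (D 1)" using D(1) by auto
  ultimately show ?thesis using that[of K "D 1"] K d vector_derivative_at[OF d] by blast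
qed

lemma locally_integrable_mult:
  assumes u: "locally_integrable u" and \<psi>: "continuous_on UNIV \<psi>"
    and K: "compact K" "K \<subseteq> {0<..}" "\<And>x. x \<notin> K \<Longrightarrow> \<psi> x = 0"
  shows "integrable half_line (\<lambda>x. u x * \<psi> x)"
proof -
  have [measurable]: "\<psi> \<in> borel_measurable borel" using \<psi> by (rule borel_measurable_continuous_onI)
  have i: "integrable lborel (\<lambda>x. indicator K x *\<^sub>R u x)"
    using u K by (auto simp: locally_integrable_def set_integrable_def)
  obtain B where B: "\<And>x. x \<in> K \<Longrightarrow> norm (\<psi> x) \<le> B"
    using compact_imp_bounded[OF compact_continuous_image[OF continuous_on_subset[OF \<psi>] K(1)]]
    by (auto simp: bounded_iff)
  have "integrable lborel (\<lambda>x. \<psi> x * (indicator K x *\<^sub>R u x))"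
  proof (rule Bochner_Integration.integrable_bound)
    show "integrable lborel (\<lambda>x. B * norm (indicator K x *\<^sub>R u x))"
      by (intro Bochner_Integration.integrable_mult_right Bochner_Integration.integrable_norm i)
    show "(\<lambda>x. \<psi> x * (indicator K x *\<^sub>R u x)) \<in> borel_measurable lborel"
      using borel_measurable_integrable[OF i] by measurable
    show "AE x in lborel. norm (\<psi> x * (indicator K x *\<^sub>R u x)) \<le> norm (B * norm (indicator K x *\<^sub>R u x))"
    proof (intro always_eventually allI)
      fix x
      show "norm (\<psi> x * (indicator K x *\<^sub>R u x)) \<le> norm (B * norm (indicator K x *\<^sub>R u x))"
        using B[of x] by (cases "x \<in> K") (auto simp: norm_mult abs_mult intro!: mult_right_mono)
    qed
  qed
  moreover have "\<psi> x * (indicator K x *\<^sub>R u x) = indicator {0<..} x *\<^sub>R (u x * \<psi> x)" for x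
    using K by (cases "x \<in> K") (auto simp: mult.commute split: split_indicator)
  ultimately show ?thesis by (simp add: half_line_integrable set_integrable_def)
qed

lemma continuous_locally_integrable:
  assumes "continuous_on UNIV u"
  shows "locally_integrable u"
  unfolding locally_integrable_def set_integrable_def
  using borel_integrable_compact[OF _ continuous_on_subset[OF assms]] by auto

text \<open>Integration by parts; the boundary terms vanish because a test function is 0 at 0 and
  for large x.\<close>

lemma weak_deriv_classical:
  assumes d: "\<And>x. (u has_vector_derivative v x) (at x)" and v: "continuous_on UNIV v"
  shows "weak_deriv u v"
  unfolding weak_deriv_def
proof (intro conjI allI impI)
  have u: "continuous_on UNIV u"
    using d by (auto simp: continuous_on_eq_continuous_at intro: has_vector_derivative_continuous)
  show lu: "locally_integrable u" and lv: "locally_integrable v"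
    using u v by (auto intro: continuous_locally_integrable)
  fix \<phi> :: "real \<Rightarrow> complex" assume "test_function \<phi>"
  then obtain K \<psi> where K: "compact K" "K \<subseteq> {0<..}" "\<And>x. x \<notin> K \<Longrightarrow> \<phi> x = 0" "\<And>x. x \<notin> K \<Longrightarrow> \<psi> x = 0"
    and d\<phi>: "\<And>x. (\<phi> has_vector_derivative \<psi> x) (at x)" and c: "continuous_on UNIV \<phi>" "continuous_on UNIV \<psi>"
    and vd: "\<And>x. vector_derivative \<phi> (at x) = \<psi> x"
    by (rule test_function_derivative) auto
  have i1: "integrable half_line (\<lambda>x. u x * \<psi> x)" by (rule locally_integrable_mult[OF lu c(2) K(1,2,4)])
  have i2: "integrable half_line (\<lambda>x. v x * \<phi> x)" by (rule locally_integrable_mult[OF lv c(1) K(1,2,3)])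
  have "(LBINT x:{0<..}. u x * \<psi> x + v x * \<phi> x) = 0 - u 0 * \<phi> 0"
  proof (rule FTC_Ioi)
    show "((\<lambda>x. u x * \<phi> x) has_vector_derivative u x * \<psi> x + v x * \<phi> x) (at x)" for x
      by (rule has_vector_derivative_mult[OF d d\<phi>])
    show "continuous_on UNIV (\<lambda>x. u x * \<psi> x + v x * \<phi> x)" by (intro continuous_intros u v c)
    show "set_integrable lborel {0<..} (\<lambda>x. u x * \<psi> x + v x * \<phi> x)"
      using i1 i2 by (simp flip: half_line_integrable)
    obtain B where "\<And>x. x \<in> K \<Longrightarrow> \<bar>x\<bar> \<le> B" using compact_imp_bounded[OF K(1)] by (auto simp: bounded_iff)
    hence "\<phi> x = 0" if "x > B" for x using K(3)[of x] that by (metis abs_le_D1 not_le)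
    hence "\<forall>\<^sub>F x in at_top. u x * \<phi> x = 0" by (intro eventually_mono[OF eventually_gt_at_top[of B]]) simp
    thus "((\<lambda>x. u x * \<phi> x) \<longlongrightarrow> 0) at_top" by (rule tendsto_eventually)
  qed
  moreover have "\<phi> 0 = 0" using K(2) by (intro K(3)) auto
  ultimately have "(\<integral>x. u x * \<psi> x + v x * \<phi> x \<partial>half_line) = 0" by (simp add: half_line_integral)
  thus "(\<integral>x. u x * vector_derivative \<phi> (at x) \<partial>half_line) = - (\<integral>x. v x * \<phi> x \<partial>half_line)"
    unfolding vd using i1 i2 by (simp add: eq_neg_iff_add_eq_0)
qed

lemma weak_deriv_lin:
  assumes "weak_deriv u v" "weak_deriv u' v'"
  shows "weak_deriv (\<lambda>x. a * u x + b * u' x) (\<lambda>x. a * v x + b * v' x)"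
proof -
  have L: "locally_integrable u" "locally_integrable v" "locally_integrable u'" "locally_integrable v'"
    using assms by (auto simp: weak_deriv_def)
  have loc: "locally_integrable (\<lambda>x. a * f x + b * g x)" if "locally_integrable f" "locally_integrable g" for f g
    using that unfolding locally_integrable_def by (auto intro!: set_integral_add set_integrable_mult_right)
  show ?thesis unfolding weak_deriv_def
  proof (intro conjI allI impI loc L)
    fix \<phi> :: "real \<Rightarrow> complex" assume t: "test_function \<phi>"
    then obtain K \<psi> where K: "compact K" "K \<subseteq> {0<..}" "\<And>x. x \<notin> K \<Longrightarrow> \<phi> x = 0" "\<And>x. x \<notin> K \<Longrightarrow> \<psi> x = 0"
      and c: "continuous_on UNIV \<phi>" "continuous_on UNIV \<psi>"
      and vd: "\<And>x. vector_derivative \<phi> (at x) = \<psi> x"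
      by (rule test_function_derivative) auto
    note i1 = locally_integrable_mult[OF _ c(2) K(1,2,4)] and i2 = locally_integrable_mult[OF _ c(1) K(1,2,3)]
    have e: "(\<integral>x. u x * \<psi> x \<partial>half_line) = - (\<integral>x. v x * \<phi> x \<partial>half_line)"
      "(\<integral>x. u' x * \<psi> x \<partial>half_line) = - (\<integral>x. v' x * \<phi> x \<partial>half_line)"
      using assms t unfolding weak_deriv_def vd[symmetric] by blast+
    have s: "(\<integral>x. (a * f x + b * g x) * h x \<partial>half_line) = a * (\<integral>x. f x * h x \<partial>half_line) + b * (\<integral>x. g x * h x \<partial>half_line)"
      if "integrable half_line (\<lambda>x. f x * h x)" "integrable half_line (\<lambda>x. g x * h x)" for f g h :: "real \<Rightarrow> complex"
      using that by (simp add: distrib_right mult.assoc)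
    show "(\<integral>x. (a * u x + b * u' x) * vector_derivative \<phi> (at x) \<partial>half_line) = - (\<integral>x. (a * v x + b * v' x) * \<phi> x \<partial>half_line)"
    proof -
      have "(\<integral>x. (a * u x + b * u' x) * \<psi> x \<partial>half_line) = a * (\<integral>x. u x * \<psi> x \<partial>half_line) + b * (\<integral>x. u' x * \<psi> x \<partial>half_line)"
        by (rule s[OF i1[OF L(1)] i1[OF L(3)]])
      moreover have "(\<integral>x. (a * v x + b * v' x) * \<phi> x \<partial>half_line) = a * (\<integral>x. v x * \<phi> x \<partial>half_line) + b * (\<integral>x. v' x * \<phi> x \<partial>half_line)"
        by (rule s[OF i2[OF L(2)] i2[OF L(4)]])
      ultimately show ?thesis unfolding vd e by (simp only:) (simp add: algebra_simps)
    qed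
  qed
qed

lemma boundary_value_lin:
  assumes "boundary_value u c" "boundary_value v d"
  shows "boundary_value (\<lambda>x. a * u x + b * v x) (a * c + b * d)"
proof -
  obtain g h where "continuous_on {0..} g" "l2_eq u g" "g 0 = c" "continuous_on {0..} h" "l2_eq v h" "h 0 = d"
    using assms by (auto simp: boundary_value_def)
  thus ?thesis unfolding boundary_value_def
    by (intro exI[of _ "\<lambda>x. a * g x + b * h x"]) (auto intro!: continuous_intros simp: l2_eq_def elim: eventually_elim2)
qed

section \<open>Linearity of the operator and its classical elements\<close>

lemma star_H_L2: "star_H \<alpha> u f \<Longrightarrow> u \<in> L2 \<and> f \<in> L2"
  by (auto simp: star_H_def star_domain_def sobolev_H2_def intro: L2_vecI)

lemma star_H_lin:
  fixes u v f g :: "real \<Rightarrow> complex ^ 'n"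
  assumes "star_H \<alpha> u f" "star_H \<alpha> v g"
  shows "star_H \<alpha> (\<lambda>x. a *s u x + b *s v x) (\<lambda>x. a *s f x + b *s g x)"
proof -
  have sob: "(\<lambda>x. a * p x + b * q x) \<in> sobolev_H2" if pq: "p \<in> sobolev_H2" "q \<in> sobolev_H2" for p q
  proof -
    obtain p' p'' q' q'' where "p \<in> L2" "p' \<in> L2" "p'' \<in> L2" "weak_deriv p p'" "weak_deriv p' p''"
      "q \<in> L2" "q' \<in> L2" "q'' \<in> L2" "weak_deriv q q'" "weak_deriv q' q''"
      using pq unfolding sobolev_H2_def by blast
    thus ?thesis unfolding sobolev_H2_def using L2_comp_lin weak_deriv_lin by blast
  qed
  obtain c d where u: "\<And>j. boundary_value (\<lambda>x. u x $ j) c"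
    "\<And>j. \<exists>v. weak_deriv (\<lambda>x. u x $ j) v \<and> boundary_value v (d $ j)" "(\<Sum>j\<in>UNIV. d $ j) = of_real \<alpha> * c"
    using assms(1) unfolding star_H_def star_domain_def by blast
  obtain c' d' where v: "\<And>j. boundary_value (\<lambda>x. v x $ j) c'"
    "\<And>j. \<exists>w. weak_deriv (\<lambda>x. v x $ j) w \<and> boundary_value w (d' $ j)" "(\<Sum>j\<in>UNIV. d' $ j) = of_real \<alpha> * c'"
    using assms(2) unfolding star_H_def star_domain_def by blast
  have "(\<lambda>x. a *s u x + b *s v x) \<in> star_domain \<alpha>"
    unfolding star_domain_def
  proof (intro CollectI conjI allI exI[of _ "a * c + b * c'"] exI[of _ "a *s d + b *s d'"])
    fix j
    show "(\<lambda>x. (a *s u x + b *s v x) $ j) \<in> sobolev_H2"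
      using sob assms by (simp add: star_H_def star_domain_def)
    show "boundary_value (\<lambda>x. (a *s u x + b *s v x) $ j) (a * c + b * c')"
      using boundary_value_lin[OF u(1) v(1)] by simp
    obtain p q where "weak_deriv (\<lambda>x. u x $ j) p" "boundary_value p (d $ j)"
      "weak_deriv (\<lambda>x. v x $ j) q" "boundary_value q (d' $ j)" using u(2) v(2) by blast
    thus "\<exists>w. weak_deriv (\<lambda>x. (a *s u x + b *s v x) $ j) w \<and> boundary_value w ((a *s d + b *s d') $ j)"
      using weak_deriv_lin boundary_value_lin by (intro exI[of _ "\<lambda>x. a * p x + b * q x"]) simp
  next
    show "(\<Sum>j\<in>UNIV. (a *s d + b *s d') $ j) = of_real \<alpha> * (a * c + b * c')"
      using u(3) v(3) by (simp add: sum.distrib sum_distrib_left[symmetric] algebra_simps)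
  qed
  moreover have "(\<lambda>x. a *s f x + b *s g x) \<in> L2" using assms by (intro L2_lin) (auto simp: star_H_def)
  moreover have "\<exists>w. weak_deriv (\<lambda>x. (a *s u x + b *s v x) $ j) w \<and> weak_deriv w (\<lambda>x. - ((a *s f x + b *s g x) $ j))" for j
  proof -
    obtain p q where pq: "weak_deriv (\<lambda>x. u x $ j) p" "weak_deriv p (\<lambda>x. - (f x $ j))"
      "weak_deriv (\<lambda>x. v x $ j) q" "weak_deriv q (\<lambda>x. - (g x $ j))" using assms unfolding star_H_def by blast
    have w1: "weak_deriv (\<lambda>x. a * u x $ j + b * v x $ j) (\<lambda>x. a * p x + b * q x)"
      by (rule weak_deriv_lin[OF pq(1,3)])
    have w2: "weak_deriv (\<lambda>x. a * p x + b * q x) (\<lambda>x. a * - (f x $ j) + b * - (g x $ j))"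
      by (rule weak_deriv_lin[OF pq(2,4)])
    have e: "(\<lambda>x. a * - (f x $ j) + b * - (g x $ j)) = (\<lambda>x. - ((a *s f x + b *s g x) $ j))" by auto
    show ?thesis using w1 w2[unfolded e] by (intro exI[of _ "\<lambda>x. a * p x + b * q x"] conjI) auto
  qed
  ultimately show ?thesis unfolding star_H_def by blast
qed

text \<open>Each function is its own continuous representative, so weak derivatives and boundary
  values are read off from genuine derivatives and values at 0. The resolvent enters
  \<open>star_H\<close> through this criterion.\<close>

lemma star_H_classical:
  fixes u v f :: "real \<Rightarrow> complex ^ 'n"
  assumes d: "\<And>j x. ((\<lambda>x. u x $ j) has_vector_derivative v x $ j) (at x)"
    "\<And>j x. ((\<lambda>x. v x $ j) has_vector_derivative - (f x $ j)) (at x)"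
    and dec: "\<And>j. decaying b (\<lambda>x. u x $ j)" "\<And>j. decaying b (\<lambda>x. v x $ j)" "\<And>j. decaying b (\<lambda>x. f x $ j)"
    and b: "b > 0" and c: "\<And>j. u 0 $ j = c" and s: "(\<Sum>j\<in>UNIV. v 0 $ j) = of_real \<alpha> * c"
  shows "star_H \<alpha> u f"
proof -
  have cont: "continuous_on UNIV (\<lambda>x. u x $ j)" "continuous_on UNIV (\<lambda>x. v x $ j)" "continuous_on UNIV (\<lambda>x. - (f x $ j))" for j
    using dec[of j] by (auto simp: decaying_def intro!: continuous_on_minus)
  have w: "weak_deriv (\<lambda>x. u x $ j) (\<lambda>x. v x $ j)" "weak_deriv (\<lambda>x. v x $ j) (\<lambda>x. - (f x $ j))" for j
    using d cont by (auto intro!: weak_deriv_classical)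
  have bv: "boundary_value g (g 0)" if "continuous_on UNIV g" for g
    using that unfolding boundary_value_def by (intro exI[of _ g]) (auto simp: l2_eq_def intro: continuous_on_subset)
  have L: "(\<lambda>x. u x $ j) \<in> L2" "(\<lambda>x. v x $ j) \<in> L2" "(\<lambda>x. f x $ j) \<in> L2" "(\<lambda>x. - (f x $ j)) \<in> L2" for j
    using decaying_L2[OF dec(1) b] decaying_L2[OF dec(2) b] decaying_L2[OF dec(3) b]
      L2_comp_lin[OF decaying_L2[OF dec(3) b] decaying_L2[OF dec(3) b], of "-1" j 0 j] by auto
  have "(\<lambda>x. u x $ j) \<in> sobolev_H2" for j
    using w L unfolding sobolev_H2_def by blast
  moreover have "boundary_value (\<lambda>x. u x $ j) c" for j using bv[OF cont(1)] c by simp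
  moreover have "\<exists>w. weak_deriv (\<lambda>x. u x $ j) w \<and> boundary_value w (v 0 $ j)" for j
    using w(1) bv[OF cont(2)] by blast
  ultimately have "u \<in> star_domain \<alpha>" unfolding star_domain_def using s by blast
  thus ?thesis unfolding star_H_def using L2_vecI[OF L(3)] w by blast
qed

section \<open>The resolvent\<close>

lemma antiderivative_from_0:
  fixes g :: "real \<Rightarrow> complex"
  assumes "continuous_on UNIV g"
  shows "((\<lambda>u. LBINT y=ereal 0..ereal u. g y) has_vector_derivative g x) (at x)"
proof -
  define a b where "a = min 0 x - 1" and "b = max 0 x + 1"
  have "((\<lambda>u. LBINT y=ereal 0..ereal u. g y) has_vector_derivative g x) (at x within {a..b})"
    by (rule interval_integral_FTC2) (use assms in \<open>auto simp: a_def b_def intro: continuous_on_subset\<close>)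
  hence "((\<lambda>u. LBINT y=ereal 0..ereal u. g y) has_vector_derivative g x) (at x within {a<..<b})"
    by (rule has_vector_derivative_within_subset) auto
  moreover have "at x within {a<..<b} = at x"
    by (rule at_within_open) (auto simp: a_def b_def)
  ultimately show ?thesis by (simp only:)
qed

text \<open>Translation and reflection invariance of the integral. That its value does not depend on
  x makes the decay estimate for the free resolvent uniform.\<close>

lemma integrable_exp_abs:
  fixes c x :: real
  assumes c: "c > 0"
  shows "integrable lborel (\<lambda>y. exp (- (c * \<bar>x - y\<bar>)))"
    and "(LBINT y. exp (- (c * \<bar>x - y\<bar>))) = (LBINT y. exp (- (c * \<bar>y\<bar>)))"
proof -
  have p: "integrable lborel (\<lambda>y. indicator {0<..} y * exp (- (c * y)))" by (rule integrable_exp_Ioi[OF c])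
  have n: "integrable lborel (\<lambda>y. indicator {0<..} (-y) * exp (- (c * (-y))))"
    using lborel_integrable_real_affine[OF p, of "-1" 0] by simp
  have 0: "integrable lborel (\<lambda>y. exp (- (c * \<bar>y\<bar>)))"
  proof (subst integrable_discrete_difference[of "{0}"])
    show "integrable lborel (\<lambda>y. indicator {0<..} y * exp (- (c * y)) + indicator {0<..} (-y) * exp (- (c * (-y))))"
      using p n by simp
  qed (auto split: split_indicator)
  from lborel_integrable_real_affine[OF 0, of "-1" x] show "integrable lborel (\<lambda>y. exp (- (c * \<bar>x - y\<bar>)))" by simp
  show "(LBINT y. exp (- (c * \<bar>x - y\<bar>))) = (LBINT y. exp (- (c * \<bar>y\<bar>)))"
    by (subst (2) lborel_integral_real_affine[of "-1" _ x]) simp_all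
qed

text \<open>The solution of \<open>u'' = k\<^sup>2 u - g\<close> given by the free kernel \<open>e\<^bsup>- k |x - y|\<^esup> / (2 k)\<close>.\<close>

lemma free_resolvent:
  fixes g :: "real \<Rightarrow> complex" and k b :: real
  assumes g: "decaying b g" and b: "b > 0" and bk: "b < k"
  defines "q \<equiv> (LBINT y:{0<..}. of_real (exp (- (k * y))) * g y)"
  obtains u v where "decaying b u" "decaying b v"
    "\<And>x. (u has_vector_derivative v x) (at x)"
    "\<And>x. (v has_vector_derivative of_real (k\<^sup>2) * u x - g x) (at x)"
    "u 0 = q / of_real (2 * k)" "v 0 = q / 2"
    "\<And>x. x \<ge> 0 \<Longrightarrow> u x = (LBINT y:{0<..}. of_real (exp (- (k * \<bar>x - y\<bar>)) / (2 * k)) * g y)"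
proof -
  have k: "k > 0" using b bk by simp
  have gc: "continuous_on UNIV g" using g by (simp add: decaying_def)
  have [measurable]: "g \<in> borel_measurable borel" by (rule decaying_measurable[OF g])
  obtain C where C: "C \<ge> 0" "\<And>x. x \<ge> 0 \<Longrightarrow> cmod (g x) \<le> C * exp (- (b * x))" using g by (rule decayingE) blast
  \<comment> \<open>With A = e^(- k x) P and B = e^(k x) Q the equation splits into A' = g - k A and
    B' = k B - g. For x \<ge> 0, Q is the tail integral from x; writing it as q minus an integral
    from 0 makes it differentiable on the whole line.\<close>
  define P where "P x = (LBINT y=ereal 0..ereal x. of_real (exp (k * y)) * g y)" for x
  define Q where "Q x = q - (LBINT y=ereal 0..ereal x. of_real (exp (- (k * y))) * g y)" for x
  have dP: "(P has_vector_derivative of_real (exp (k * x)) * g x) (at x)" for x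
    unfolding P_def by (rule antiderivative_from_0) (intro continuous_intros gc)
  have dQ: "(Q has_vector_derivative 0 - of_real (exp (- (k * x))) * g x) (at x)" for x
    unfolding Q_def by (intro has_vector_derivative_diff has_vector_derivative_const antiderivative_from_0) (intro continuous_intros gc)
  define A where "A x = of_real (exp (- (k * x))) * P x" for x
  define B where "B x = of_real (exp (k * x)) * Q x" for x
  have de: "((\<lambda>x. complex_of_real (exp (c * x))) has_vector_derivative of_real (c * exp (c * x))) (at x)" for c x
  proof -
    have "((\<lambda>x. exp (c * x)) has_real_derivative c * exp (c * x)) (at x)"
      by (auto intro!: derivative_eq_intros)
    thus ?thesis by (intro has_vector_derivative_of_real) (simp add: has_real_derivative_iff_has_vector_derivative)
  qed
  have dA: "(A has_vector_derivative g x - of_real k * A x) (at x)" for x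
  proof -
    have e: "of_real (exp (- (k * x))) * of_real (exp (k * x)) = (1 :: complex)"
      by (simp add: of_real_mult[symmetric] exp_minus del: of_real_mult)
    have "(A has_vector_derivative (of_real (exp (- (k * x))) * (of_real (exp (k * x)) * g x) + of_real (- k * exp (- k * x)) * P x)) (at x)"
      unfolding A_def using has_vector_derivative_mult[OF de[of "-k" x] dP[of x]] by simp
    thus ?thesis unfolding mult.assoc[symmetric] e A_def by (simp add: algebra_simps)
  qed
  have dB: "(B has_vector_derivative of_real k * B x - g x) (at x)" for x
  proof -
    have e: "of_real (exp (k * x)) * of_real (exp (- (k * x))) = (1 :: complex)"
      by (simp add: of_real_mult[symmetric] exp_minus del: of_real_mult)
    have D: "(B has_vector_derivative (of_real (exp (k * x)) * (0 - of_real (exp (- (k * x))) * g x) + of_real (k * exp (k * x)) * Q x)) (at x)"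
      unfolding B_def using has_vector_derivative_mult[OF de[of k x] dQ[of x]] by simp
    have "of_real (exp (k * x)) * (0 - of_real (exp (- (k * x))) * g x) = - g x"
      using e by (metis diff_0 mult_minus_right mult.assoc mult_1)
    hence "of_real (exp (k * x)) * (0 - of_real (exp (- (k * x))) * g x) + of_real (k * exp (k * x)) * Q x = of_real k * B x - g x"
      unfolding B_def by (simp only: of_real_mult) (simp add: mult.assoc)
    with D show ?thesis by (simp only:)
  qed
  have ker: "set_integrable lborel {0<..} (\<lambda>y. of_real (exp (- (k * \<bar>x - y\<bar>))) * g y)" for x
    unfolding set_integrable_def
  proof (rule Bochner_Integration.integrable_bound[OF decaying_integrable[OF g b]])
    show "AE y in lborel. norm (indicator {0<..} y *\<^sub>R (of_real (exp (- (k * \<bar>x - y\<bar>))) * g y)) \<le> norm (indicator {0<..} y *\<^sub>R g y)"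
      using k by (auto intro!: always_eventually mult_left_le_one_le split: split_indicator simp: norm_mult)
  qed measurable
  have rep: "A x = (LBINT y:{0<..x}. of_real (exp (- (k * \<bar>x - y\<bar>))) * g y)"
    "B x = (LBINT y:{x<..}. of_real (exp (- (k * \<bar>x - y\<bar>))) * g y)"  if x: "x \<ge> 0" for x
  proof -
    have "P x = (LBINT y:{0<..x}. of_real (exp (k * y)) * g y)"
      unfolding P_def by (rule interval_integral_Ioc) (use x in simp)
    hence "A x = (LBINT y:{0<..x}. of_real (exp (- (k * x))) * (of_real (exp (k * y)) * g y))"
      unfolding A_def by simp
    also have "\<dots> = (LBINT y:{0<..x}. of_real (exp (- (k * \<bar>x - y\<bar>))) * g y)"
    proof (rule set_lebesgue_integral_cong, simp, intro allI impI)
      fix y assume "y \<in> {0<..x}"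
      hence e: "- (k * x) + k * y = - (k * \<bar>x - y\<bar>)" by (simp add: algebra_simps)
      show "of_real (exp (- (k * x))) * (of_real (exp (k * y)) * g y) = of_real (exp (- (k * \<bar>x - y\<bar>))) * g y"
        by (simp only: mult.assoc[symmetric] of_real_mult[symmetric] exp_add[symmetric] e)
    qed
    finally show "A x = (LBINT y:{0<..x}. of_real (exp (- (k * \<bar>x - y\<bar>))) * g y)" .
    have i0: "set_integrable lborel {0<..} (\<lambda>y. of_real (exp (- (k * y))) * g y)"
    proof -
      have "set_integrable lborel {0<..} (\<lambda>y. of_real (exp (- (k * \<bar>0 - y\<bar>))) * g y)" by (rule ker)
      thus ?thesis by (rule set_integrable_cong[THEN iffD1, rotated -1]) auto
    qed
    have "q = (LBINT y:{0<..x}. of_real (exp (- (k * y))) * g y) + (LBINT y:{x<..}. of_real (exp (- (k * y))) * g y)"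
    proof -
      have U: "{0<..} = {0<..x} \<union> {x<..}" using x by auto
      show ?thesis unfolding q_def
        by (subst U, rule set_integral_Un) (auto intro: set_integrable_subset[OF i0] simp: x less_le_trans[OF _ x] order.strict_trans1[OF x])
    qed
    moreover have "(LBINT y=ereal 0..ereal x. of_real (exp (- (k * y))) * g y) = (LBINT y:{0<..x}. of_real (exp (- (k * y))) * g y)"
      by (rule interval_integral_Ioc) (use x in simp)
    ultimately have "B x = (LBINT y:{x<..}. of_real (exp (k * x)) * (of_real (exp (- (k * y))) * g y))"
      unfolding B_def Q_def by simp
    also have "\<dots> = (LBINT y:{x<..}. of_real (exp (- (k * \<bar>x - y\<bar>))) * g y)"
    proof (rule set_lebesgue_integral_cong, simp, intro allI impI)
      fix y assume "y \<in> {x<..}"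
      hence e: "k * x + - (k * y) = - (k * \<bar>x - y\<bar>)" by (simp add: algebra_simps)
      show "of_real (exp (k * x)) * (of_real (exp (- (k * y))) * g y) = of_real (exp (- (k * \<bar>x - y\<bar>))) * g y"
        by (simp only: mult.assoc[symmetric] of_real_mult[symmetric] exp_add[symmetric] e)
    qed
    finally show "B x = (LBINT y:{x<..}. of_real (exp (- (k * \<bar>x - y\<bar>))) * g y)" .
  qed
  define M where "M = (LBINT y. exp (- ((k - b) * \<bar>y\<bar>)))"
  have bound: "cmod (LBINT y:S. of_real (exp (- (k * \<bar>x - y\<bar>))) * g y) \<le> (C * M) * exp (- (b * x))"
    if S: "S \<subseteq> {0<..}" "S \<in> sets borel" for S x
  proof -
    have "cmod (LBINT y:S. of_real (exp (- (k * \<bar>x - y\<bar>))) * g y) \<le> (LBINT y. C * exp (- (b * x)) * exp (- ((k - b) * \<bar>x - y\<bar>)))"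
      unfolding set_lebesgue_integral_def
    proof (rule Bochner_Integration.integral_norm_bound_integral)
      show "integrable lborel (\<lambda>y. indicator S y *\<^sub>R (of_real (exp (- (k * \<bar>x - y\<bar>))) * g y))"
        using set_integrable_subset[OF ker, of S x] S by (simp add: set_integrable_def)
      show "integrable lborel (\<lambda>y. C * exp (- (b * x)) * exp (- ((k - b) * \<bar>x - y\<bar>)))"
        using integrable_exp_abs(1)[of "k - b" x] bk by (intro Bochner_Integration.integrable_mult_right) simp
      fix y
      show "norm (indicator S y *\<^sub>R (of_real (exp (- (k * \<bar>x - y\<bar>))) * g y)) \<le> C * exp (- (b * x)) * exp (- ((k - b) * \<bar>x - y\<bar>))"
      proof (cases "y \<in> S")
        case True
        hence y: "y > 0" using S by auto
        \<comment> \<open>The triangle inequality trades decay of the kernel for decay in x: of the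
          rate k, the part b is spent, and k - b > 0 remains for integrability in y.\<close>
        have "b * x \<le> b * \<bar>x - y\<bar> + b * y"
          using b by (simp add: distrib_left[symmetric])
        hence "- (k * \<bar>x - y\<bar>) + - (b * y) \<le> - (b * x) + - ((k - b) * \<bar>x - y\<bar>)"
          by (simp add: algebra_simps)
        hence "exp (- (k * \<bar>x - y\<bar>)) * exp (- (b * y)) \<le> exp (- (b * x)) * exp (- ((k - b) * \<bar>x - y\<bar>))"
          unfolding exp_add[symmetric] by simp
        hence *: "C * (exp (- (k * \<bar>x - y\<bar>)) * exp (- (b * y))) \<le> C * (exp (- (b * x)) * exp (- ((k - b) * \<bar>x - y\<bar>)))"
          using C(1) by (rule mult_left_mono)
        have "norm (indicator S y *\<^sub>R (of_real (exp (- (k * \<bar>x - y\<bar>))) * g y)) = exp (- (k * \<bar>x - y\<bar>)) * cmod (g y)"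
          using True by (simp add: norm_mult)
        also have "\<dots> \<le> exp (- (k * \<bar>x - y\<bar>)) * (C * exp (- (b * y)))"
          using C(2)[of y] y by (intro mult_left_mono) auto
        also have "\<dots> = C * (exp (- (k * \<bar>x - y\<bar>)) * exp (- (b * y)))" by (simp only: mult_ac)
        also note *
        finally show ?thesis by (simp only: mult.assoc)
      qed (use C(1) in simp)
    qed
    also have "\<dots> = C * exp (- (b * x)) * M"
      unfolding Bochner_Integration.integral_mult_right_zero M_def using integrable_exp_abs(2)[of "k - b" x] bk by simp
    finally show ?thesis by (simp add: mult_ac)
  qed
  have cA: "continuous_on UNIV A" and cB: "continuous_on UNIV B"
    using dA dB by (auto simp: continuous_on_eq_continuous_at intro: has_vector_derivative_continuous)
  have decA: "decaying b A" unfolding decaying_def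
    using cA rep(1) bound[of "{0<..x}" x for x] by (intro conjI exI[of _ "C * M"]) (auto simp: greaterThanAtMost_def)
  have decB: "decaying b B" unfolding decaying_def
    using cB rep(2) bound[of "{x<..}" x for x] by (intro conjI exI[of _ "C * M"]) auto
  \<comment> \<open>The terms with g cancel in the derivative of A + B and add up in that of B -
    A.\<close>
  define u where "u x = (1 / of_real (2 * k)) * A x + (1 / of_real (2 * k)) * B x" for x
  define v where "v x = (-1 / 2) * A x + (1 / 2) * B x" for x
  have k0: "complex_of_real k \<noteq> 0" using k by simp
  show thesis
  proof (rule that)
    show "decaying b u" "decaying b v" unfolding u_def v_def by (intro decaying_lin decA decB)+
    show "(u has_vector_derivative v x) (at x)" for x
    proof -
      have "(u has_vector_derivative (1 / of_real (2 * k)) * (g x - of_real k * A x) + (1 / of_real (2 * k)) * (of_real k * B x - g x)) (at x)"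
        unfolding u_def by (intro has_vector_derivative_add has_vector_derivative_mult_right dA dB)
      moreover have "(1 / of_real (2 * k)) * (g x - of_real k * A x) + (1 / of_real (2 * k)) * (of_real k * B x - g x) = v x"
        unfolding v_def using k0 by (simp add: divide_simps) (simp add: algebra_simps)
      ultimately show ?thesis by (simp only:)
    qed
    show "(v has_vector_derivative of_real (k\<^sup>2) * u x - g x) (at x)" for x
    proof -
      have "(v has_vector_derivative (-1 / 2) * (g x - of_real k * A x) + (1 / 2) * (of_real k * B x - g x)) (at x)"
        unfolding v_def by (intro has_vector_derivative_add has_vector_derivative_mult_right dA dB)
      moreover have "(-1 / 2) * (g x - of_real k * A x) + (1 / 2) * (of_real k * B x - g x) = of_real (k\<^sup>2) * u x - g x"
        unfolding u_def using k0 by (simp add: divide_simps power2_eq_square) (simp add: algebra_simps)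
      ultimately show ?thesis by (simp only:)
    qed
    have "P 0 = 0" "Q 0 = q" unfolding P_def Q_def by simp_all
    hence "A 0 = 0" "B 0 = q" unfolding A_def B_def by simp_all
    thus "u 0 = q / of_real (2 * k)" "v 0 = q / 2" unfolding u_def v_def by simp_all
    fix x :: real assume x: "x \<ge> 0"
    have "(LBINT y:{0<..}. of_real (exp (- (k * \<bar>x - y\<bar>))) * g y) = A x + B x"
    proof -
      have U: "{0<..} = {0<..x} \<union> {x<..}" using x by auto
      show ?thesis unfolding rep[OF x]
        by (subst U, rule set_integral_Un) (use x in \<open>auto intro!: set_integrable_subset[OF ker]\<close>)
    qed
    moreover have "(LBINT y:{0<..}. of_real (exp (- (k * \<bar>x - y\<bar>)) / (2 * k)) * g y)
        = (LBINT y:{0<..}. (1 / of_real (2 * k)) * (of_real (exp (- (k * \<bar>x - y\<bar>))) * g y))"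
      by (rule set_lebesgue_integral_cong) auto
    ultimately show "u x = (LBINT y:{0<..}. of_real (exp (- (k * \<bar>x - y\<bar>)) / (2 * k)) * g y)"
      unfolding u_def by (simp add: distrib_left add_divide_distrib)
  qed
qed

section \<open>From a single half-line to the star\<close>

lemma decaying_mult:
  assumes u: "decaying b u" and e: "continuous_on UNIV e" "\<And>x. \<bar>e x\<bar> \<le> C"
  shows "decaying b (\<lambda>x. complex_of_real (e x) * u x)"
proof -
  obtain D where D: "D \<ge> 0" "\<And>x. x \<ge> 0 \<Longrightarrow> cmod (u x) \<le> D * exp (- (b * x))" using u by (rule decayingE) blast
  have "cmod (complex_of_real (e x) * u x) \<le> (C * D) * exp (- (b * x))" if "x \<ge> 0" for x
  proof -
    have "\<bar>e x\<bar> * cmod (u x) \<le> C * (D * exp (- (b * x)))"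
      using e(2)[of x] D(2)[OF that] by (intro mult_mono) auto
    thus ?thesis by (simp add: norm_mult mult.assoc)
  qed
  moreover have "continuous_on UNIV (\<lambda>x. complex_of_real (e x) * u x)"
    using u e by (auto simp: decaying_def intro!: continuous_intros)
  ultimately show ?thesis unfolding decaying_def by blast
qed

lemma decaying_sum:
  assumes "finite I" "\<And>i. i \<in> I \<Longrightarrow> decaying b (f i)"
  shows "decaying b (\<lambda>x. \<Sum>i\<in>I. f i x)"
  using assms
proof (induction I rule: finite_induct)
  case empty
  show ?case by (auto simp: decaying_def intro!: exI[of _ 0])
next
  case (insert i I)
  thus ?case using decaying_lin[of b "f i" "\<lambda>x. \<Sum>i\<in>I. f i x" 1 1] by simp
qed

definition vdecaying :: "real \<Rightarrow> (real \<Rightarrow> complex ^ 'n) \<Rightarrow> bool" where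
  "vdecaying b f \<longleftrightarrow> (\<forall>j. decaying b (\<lambda>x. f x $ j))"

lemma vdecayingD: "vdecaying b f \<Longrightarrow> decaying b (\<lambda>x. f x $ j)"
  by (simp add: vdecaying_def)

lemma vdecaying_L2: "vdecaying b f \<Longrightarrow> b > 0 \<Longrightarrow> f \<in> L2"
  by (intro L2_vecI decaying_L2[of b]) (auto simp: vdecaying_def)

lemma vdecaying_lin: "vdecaying b f \<Longrightarrow> vdecaying b g \<Longrightarrow> vdecaying b (\<lambda>x. c *s f x + d *s g x)"
  by (simp add: vdecaying_def decaying_lin)

definition kernel_op :: "('n::finite \<Rightarrow> 'n \<Rightarrow> real \<Rightarrow> real \<Rightarrow> real) \<Rightarrow> (real \<Rightarrow> complex ^ 'n) \<Rightarrow> real \<Rightarrow> complex ^ 'n" where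
  "kernel_op r f x = (\<chi> j. \<Sum>l\<in>UNIV. \<integral>y. of_real (r j l x y) * f y $ l \<partial>half_line)"

text \<open>The edges interact only at the vertex: solve on each of them with the free kernel, then
  add a multiple of the decaying homogeneous solution e^(- k x) to meet the vertex
  condition.\<close>

lemma star_resolvent:
  fixes f :: "real \<Rightarrow> complex ^ 'n::finite"
  assumes \<alpha>: "\<alpha> > 0" and b: "b > 0" and bk: "b < k" and f: "vdecaying b f"
  obtains u v c where "vdecaying b u" "vdecaying b v"
    "\<And>j x. ((\<lambda>x. u x $ j) has_vector_derivative v x $ j) (at x)"
    "\<And>j x. ((\<lambda>x. v x $ j) has_vector_derivative of_real (k\<^sup>2) * u x $ j - f x $ j) (at x)"
    "\<And>j. u 0 $ j = c" "(\<Sum>j\<in>UNIV. v 0 $ j) = of_real \<alpha> * c"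
    "\<And>x. x \<ge> 0 \<Longrightarrow> u x = kernel_op (resolvent_kernel \<alpha> k) f x"
proof -
  have k: "k > 0" using b bk by simp
  define N where "N = real CARD('n)"
  have N: "N > 0" by (simp add: N_def)
  define M where "M = N * k + \<alpha>"
  have M: "M > 0" unfolding M_def using N k \<alpha> by (simp add: add_pos_pos)
  define q where "q l = (LBINT y:{0<..}. of_real (exp (- (k * y))) * f y $ l)" for l
  \<comment> \<open>One predicate for the free solution on edge j, so that solutions can be chosen
    for all edges at once.\<close>
  define \<Phi> where "\<Phi> j u v \<longleftrightarrow> decaying b u \<and> decaying b v \<and> (\<forall>x. (u has_vector_derivative v x) (at x)) \<and>
    (\<forall>x. (v has_vector_derivative of_real (k\<^sup>2) * u x - f x $ j) (at x)) \<and>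
    u 0 = q j / of_real (2 * k) \<and> v 0 = q j / 2 \<and>
    (\<forall>x\<ge>0. u x = (LBINT y:{0<..}. of_real (exp (- (k * \<bar>x - y\<bar>)) / (2 * k)) * f y $ j))" for j u v
  have "\<exists>u v. \<Phi> j u v" for j
  proof (rule free_resolvent[OF vdecayingD[OF f, of j] b bk], goal_cases)
    case (1 u v)
    show ?case unfolding \<Phi>_def q_def by (intro exI[of _ u] exI[of _ v] conjI allI impI 1)
  qed
  hence ex: "\<forall>j. \<exists>w. \<Phi> j (fst w) (snd w)" by (metis fst_conv snd_conv)
  from choice[OF ex] obtain z where z: "\<forall>j. \<Phi> j (fst (z j)) (snd (z j))" by (elim exE)
  define p s where "p j = fst (z j)" and "s j = snd (z j)" for j
  have p: "\<And>j. decaying b (p j)" "\<And>j. decaying b (s j)"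
    "\<And>j x. (p j has_vector_derivative s j x) (at x)"
    "\<And>j x. (s j has_vector_derivative of_real (k\<^sup>2) * p j x - f x $ j) (at x)"
    "\<And>j. p j 0 = q j / of_real (2 * k)" "\<And>j. s j 0 = q j / 2"
    "\<And>j x. x \<ge> 0 \<Longrightarrow> p j x = (LBINT y:{0<..}. of_real (exp (- (k * \<bar>x - y\<bar>)) / (2 * k)) * f y $ j)"
    using z unfolding \<Phi>_def p_def s_def by blast+
  define Q where "Q = (\<Sum>l\<in>UNIV. q l)"
  \<comment> \<open>Equal values at 0 force a_j + q_j / (2 k) to be a common c. Then v_j(0) = q_j -
    k c, and summing over the edges Q - N k c = \<alpha> c, so c = Q / M.\<close>
  define a where "a j = Q / of_real M - q j / of_real (2 * k)" for j
  define E where "E x = complex_of_real (exp (- (k * x)))" for x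
  have dE: "(E has_vector_derivative - of_real k * E x) (at x)" for x
  proof -
    have "((\<lambda>x. exp (- (k * x))) has_real_derivative - k * exp (- (k * x))) (at x)"
      by (auto intro!: derivative_eq_intros)
    hence "((\<lambda>x. complex_of_real (exp (- (k * x)))) has_vector_derivative of_real (- k * exp (- (k * x)))) (at x)"
      by (intro has_vector_derivative_of_real) (simp add: has_real_derivative_iff_has_vector_derivative)
    thus ?thesis unfolding E_def by simp
  qed
  have decE: "decaying b E"
    unfolding decaying_def E_def
    using bk by (auto intro!: continuous_intros exI[of _ 1] mult_right_mono)
  define u where "u x = (\<chi> j. 1 * p j x + a j * E x)" for x
  define v where "v x = (\<chi> j. 1 * s j x + (- of_real k * a j) * E x)" for x
  have k0: "complex_of_real k \<noteq> 0" using k by simp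
  have M0: "complex_of_real M \<noteq> 0" using M by simp
  show thesis
  proof (rule that)
    show "vdecaying b u" "vdecaying b v" unfolding vdecaying_def u_def v_def vec_lambda_beta
      by (intro allI decaying_lin p decE)+
    show "((\<lambda>x. u x $ j) has_vector_derivative v x $ j) (at x)" for j x
    proof -
      have "((\<lambda>x. 1 * p j x + a j * E x) has_vector_derivative 1 * s j x + a j * (- of_real k * E x)) (at x)"
        by (intro has_vector_derivative_add has_vector_derivative_mult_right p dE)
      thus ?thesis unfolding u_def v_def by (simp add: mult_ac)
    qed
    show "((\<lambda>x. v x $ j) has_vector_derivative of_real (k\<^sup>2) * u x $ j - f x $ j) (at x)" for j x
    proof -
      have "((\<lambda>x. 1 * s j x + (- of_real k * a j) * E x) has_vector_derivative
         1 * (of_real (k\<^sup>2) * p j x - f x $ j) + (- of_real k * a j) * (- of_real k * E x)) (at x)"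
        by (intro has_vector_derivative_add has_vector_derivative_mult_right p dE)
      moreover have "1 * (of_real (k\<^sup>2) * p j x - f x $ j) + (- of_real k * a j) * (- of_real k * E x)
          = of_real (k\<^sup>2) * u x $ j - f x $ j"
        unfolding u_def by (simp add: algebra_simps power2_eq_square)
      ultimately show ?thesis unfolding v_def vec_lambda_beta by (simp only:)
    qed
    have E0: "E 0 = 1" by (simp add: E_def)
    show "u 0 $ j = Q / of_real M" for j unfolding u_def by (simp add: E0 p(5) a_def)
    have "(\<Sum>j\<in>UNIV. v 0 $ j) = (\<Sum>j\<in>UNIV. q j - of_real k * (Q / of_real M))"
      unfolding v_def by (intro sum.cong refl) (use k0 in \<open>simp add: E0 p(6) a_def field_simps\<close>)
    also have "\<dots> = Q - of_real N * (of_real k * (Q / of_real M))"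
      by (simp add: sum_subtractf Q_def N_def)
    also have "\<dots> = of_real \<alpha> * (Q / of_real M)"
    proof -
      have "of_real M * z - of_real N * (of_real k * z) = of_real \<alpha> * z" for z :: complex
        unfolding M_def by (simp add: algebra_simps)
      from this[of "Q / of_real M"] show ?thesis using M0 by simp
    qed
    finally show "(\<Sum>j\<in>UNIV. v 0 $ j) = of_real \<alpha> * (Q / of_real M)" .
    fix x :: real assume x: "x \<ge> 0"
    have i0: "set_integrable lborel {0<..} (\<lambda>y. of_real (e y) * f y $ l)"
      if "continuous_on UNIV e" "\<And>y. y > 0 \<Longrightarrow> \<bar>e y\<bar> \<le> C" for e :: "real \<Rightarrow> real" and C l
      unfolding set_integrable_def
    proof (rule Bochner_Integration.integrable_bound)
      have [measurable]: "e \<in> borel_measurable borel" "(\<lambda>y. f y $ l) \<in> borel_measurable borel"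
        using that(1) decaying_measurable[OF vdecayingD[OF f]] by (auto intro: borel_measurable_continuous_onI)
      show "(\<lambda>y. indicator {0<..} y *\<^sub>R (of_real (e y) * f y $ l)) \<in> borel_measurable lborel" by measurable
      show "integrable lborel (\<lambda>y. C * norm (indicator {0<..} y *\<^sub>R f y $ l))"
        by (intro Bochner_Integration.integrable_mult_right Bochner_Integration.integrable_norm decaying_integrable[OF vdecayingD[OF f] b])
      have "C \<ge> 0" using that(2)[of 1] by simp
      thus "AE y in lborel. norm (indicator {0<..} y *\<^sub>R (of_real (e y) * f y $ l)) \<le> norm (C * norm (indicator {0<..} y *\<^sub>R f y $ l))"
        using that(2) by (auto intro!: always_eventually mult_right_mono split: split_indicator simp: norm_mult abs_mult)
    qed
    have i1: "set_integrable lborel {0<..} (\<lambda>y. of_real (exp (- (k * \<bar>x - y\<bar>)) / (2 * k)) * f y $ l)" for l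
      using k by (intro i0[where C = "1 / (2 * k)"]) (auto intro!: continuous_intros divide_right_mono simp: abs_divide)
    have i2: "set_integrable lborel {0<..} (\<lambda>y. of_real (exp (- (k * y))) * f y $ l)" for l
      using k by (intro i0[where C = 1]) (auto intro!: continuous_intros)
    have "kernel_op (resolvent_kernel \<alpha> k) f x $ j = u x $ j" for j
    proof -
      have "(\<integral>y. of_real (resolvent_kernel \<alpha> k j l x y) * f y $ l \<partial>half_line)
         = (if l = j then p j x - E x * q j / of_real (2 * k) else 0) + E x * q l / of_real M" for l
      proof -
        define d where "d = (if l = j then 1 else 0 :: real)"
        have "(\<integral>y. of_real (resolvent_kernel \<alpha> k j l x y) * f y $ l \<partial>half_line)
          = (LBINT y:{0<..}. of_real d * (of_real (exp (- (k * \<bar>x - y\<bar>)) / (2 * k)) * f y $ l)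
             + (E x / of_real M - of_real d * E x / of_real (2 * k)) * (of_real (exp (- (k * y))) * f y $ l))"
          unfolding half_line_integral
        proof (rule set_lebesgue_integral_cong, simp, intro allI impI)
          fix y :: real
          have "of_real (exp (- (k * (x + y)))) = E x * complex_of_real (exp (- (k * y)))"
            unfolding E_def of_real_mult[symmetric] exp_add[symmetric] by (simp add: distrib_left)
          hence "complex_of_real (resolvent_kernel \<alpha> k j l x y)
            = of_real d * of_real (exp (- (k * \<bar>x - y\<bar>)) / (2 * k))
             + (E x / of_real M - of_real d * E x / of_real (2 * k)) * of_real (exp (- (k * y)))"
            unfolding resolvent_kernel_def M_def N_def d_def
            by (simp add: algebra_simps diff_divide_distrib)
          thus "of_real (resolvent_kernel \<alpha> k j l x y) * f y $ l
            = of_real d * (of_real (exp (- (k * \<bar>x - y\<bar>)) / (2 * k)) * f y $ l)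
             + (E x / of_real M - of_real d * E x / of_real (2 * k)) * (of_real (exp (- (k * y))) * f y $ l)"
            by (simp only: distrib_right mult.assoc)
        qed
        also have "\<dots> = of_real d * (LBINT y:{0<..}. of_real (exp (- (k * \<bar>x - y\<bar>)) / (2 * k)) * f y $ l)
            + (E x / of_real M - of_real d * E x / of_real (2 * k)) * (LBINT y:{0<..}. of_real (exp (- (k * y))) * f y $ l)"
          by (subst set_integral_add(2)) (auto intro: set_integrable_mult_right[OF i1] set_integrable_mult_right[OF i2] simp del: of_real_divide)
        also have "\<dots> = of_real d * p l x + (E x / of_real M - of_real d * E x / of_real (2 * k)) * q l"
          unfolding p(7)[OF x] q_def ..
        finally show ?thesis unfolding d_def by (simp add: left_diff_distrib)
      qed
      hence "kernel_op (resolvent_kernel \<alpha> k) f x $ j = (\<Sum>l\<in>UNIV. (if l = j then p j x - E x * q j / of_real (2 * k) else 0) + E x * q l / of_real M)"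
        unfolding kernel_op_def by simp
      also have "\<dots> = p j x - E x * q j / of_real (2 * k) + E x * Q / of_real M"
        by (simp add: sum.distrib Q_def sum_distrib_left sum_divide_distrib)
      also have "\<dots> = u x $ j" unfolding u_def a_def by (simp add: algebra_simps)
      finally show ?thesis .
    qed
    thus "u x = kernel_op (resolvent_kernel \<alpha> k) f x" by (simp add: vec_eq_iff)
  qed
qed

section \<open>The generalized eigenfunctions\<close>

text \<open>Uniformity in w, x and y is what the Fubini arguments need. With D the denominator, N
  w^2 \<le> D and |\<alpha> w| \<le> D, so the vertex term is at most 4 / pi; the sine term
  contributes 2 / pi.\<close>

lemma sigma_S_bound: "\<bar>sigma_S \<alpha> j l w x y\<bar> \<le> 6 / pi"
  for j l :: "'n::finite"
proof -
  define N where "N = real CARD('n)"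
  have N: "N \<ge> 1" unfolding N_def by (simp add: Suc_leI)
  define D where "D = \<alpha>\<^sup>2 + N\<^sup>2 * w\<^sup>2"
  have D0: "D \<ge> 0" unfolding D_def by simp
  have NN: "N * w\<^sup>2 \<le> N\<^sup>2 * w\<^sup>2" "w\<^sup>2 \<le> N\<^sup>2 * w\<^sup>2"
    using N by (auto simp: power2_eq_square intro!: mult_right_mono mult_le_cancel_right1[THEN iffD2] order_trans[OF N])
  have 1: "N * w\<^sup>2 \<le> D" using NN unfolding D_def by (smt (verit) zero_le_power2)
  have 2: "\<bar>\<alpha> * w\<bar> \<le> D"
  proof -
    have "2 * (\<bar>\<alpha>\<bar> * \<bar>w\<bar>) \<le> \<alpha>\<^sup>2 + w\<^sup>2"
      using zero_le_power2[of "\<bar>\<alpha>\<bar> - \<bar>w\<bar>"] by (simp add: power2_diff)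
    moreover have "0 \<le> \<bar>\<alpha>\<bar> * \<bar>w\<bar>" by simp
    ultimately show ?thesis using NN unfolding D_def abs_mult by linarith
  qed
  define T where "T = N * w\<^sup>2 * cos (w * (x + y)) + \<alpha> * w * sin (w * (x + y))"
  have "\<bar>T\<bar> \<le> N * w\<^sup>2 * 1 + \<bar>\<alpha> * w\<bar> * 1"
    unfolding T_def by (rule order_trans[OF abs_triangle_ineq], rule add_mono)
       (use N in \<open>auto simp: abs_mult intro!: mult_left_mono mult_left_le\<close>)
  hence T: "\<bar>T\<bar> \<le> 2 * D" using 1 2 by linarith
  have "\<bar>(2 / pi) / D * T\<bar> \<le> (2 / pi) * 2"
  \<comment> \<open>D can vanish, namely for \<alpha> = w = 0; the quotient is then 0 by
    convention.\<close>
  proof (cases "D = 0")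
    case False
    hence "\<bar>T\<bar> / D \<le> 2" using T D0 by (simp add: pos_divide_le_eq)
    hence "(2 / pi) * (\<bar>T\<bar> / D) \<le> (2 / pi) * 2" by (intro mult_left_mono) auto
    moreover have "\<bar>(2 / pi) / D * T\<bar> = (2 / pi) * (\<bar>T\<bar> / D)" using D0 by (simp add: abs_mult abs_divide)
    ultimately show ?thesis by (simp only:)
  qed simp
  moreover have "\<bar>2 / pi * (if j = l then 1 else 0) * sin (w * x) * sin (w * y)\<bar> \<le> 2 / pi * 1"
  proof -
    have "\<bar>(if j = l then 1 else 0) * (sin (w * x) * sin (w * y))\<bar> \<le> 1"
      by (auto simp: abs_mult intro: mult_le_one)
    hence "(2 / pi) * \<bar>(if j = l then 1 else 0) * (sin (w * x) * sin (w * y))\<bar> \<le> (2 / pi) * 1"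
      by (intro mult_left_mono) auto
    thus ?thesis by (simp add: abs_mult mult.assoc)
  qed
  ultimately have "\<bar>sigma_S \<alpha> j l w x y\<bar> \<le> 2 / pi * 1 + (2 / pi) * 2"
    unfolding sigma_S_def Let_def N_def[symmetric] D_def[symmetric] T_def[symmetric]
    by (intro order_trans[OF abs_triangle_ineq] add_mono)
  thus ?thesis by simp
qed

lemma sigma_S_measurable [measurable (raw)]:
  assumes [measurable]: "f \<in> borel_measurable M" "g \<in> borel_measurable M" "h \<in> borel_measurable M"
  shows "(\<lambda>z. sigma_S \<alpha> j l (f z) (g z) (h z)) \<in> borel_measurable M"
  unfolding sigma_S_def Let_def by measurable

text \<open>Green's identity. As a function of y the entries e_l solve e'' = - w^2 e, so the
  Wronskian sum of e_l v_l - e_l' u_l over l has derivative equal to the sum of (k^2 + w^2) e_l u_l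
  - e_l f_l. The boundary terms vanish: at infinity by decay, at the vertex because u and e satisfy
  the same condition.\<close>

lemma kernel_op_sigma_resolvent:
  fixes u v f :: "real \<Rightarrow> complex ^ 'n::finite"
  assumes \<alpha>: "\<alpha> > 0" and b: "b > 0"
    and dec: "vdecaying b u" "vdecaying b v" "vdecaying b f"
    and d: "\<And>j x. ((\<lambda>x. u x $ j) has_vector_derivative v x $ j) (at x)"
      "\<And>j x. ((\<lambda>x. v x $ j) has_vector_derivative of_real (k\<^sup>2) * u x $ j - f x $ j) (at x)"
    and c: "\<And>j. u 0 $ j = c" and s: "(\<Sum>j\<in>UNIV. v 0 $ j) = of_real \<alpha> * c"
  shows "of_real (k\<^sup>2 + w\<^sup>2) *s kernel_op (\<lambda>j l. sigma_S \<alpha> j l w) u x = kernel_op (\<lambda>j l. sigma_S \<alpha> j l w) f x"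
proof -
  define N where "N = real CARD('n)"
  have N: "N > 0" by (simp add: N_def)
  define D where "D = \<alpha>\<^sup>2 + N\<^sup>2 * w\<^sup>2"
  have D: "D > 0" unfolding D_def using \<alpha> by (simp add: add_pos_nonneg)
  have main: "of_real (k\<^sup>2 + w\<^sup>2) * (\<Sum>l\<in>UNIV. LBINT y:{0<..}. of_real (sigma_S \<alpha> j l w x y) * u y $ l)
    = (\<Sum>l\<in>UNIV. LBINT y:{0<..}. of_real (sigma_S \<alpha> j l w x y) * f y $ l)" for j
  proof -
    define e where "e l y = sigma_S \<alpha> j l w x y" for l y
    define A where "A l = 2 / pi * (if j = l then 1 else 0) * sin (w * x)" for l
    define G where "G = (2 / pi) / D"
    have G: "G \<ge> 0" "G * D = 2 / pi" using D by (simp_all add: G_def)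
    define e' where "e' l y = A l * (w * cos (w * y))
      + G * (N * w\<^sup>2 * (- w * sin (w * (x + y))) + \<alpha> * w * (w * cos (w * (x + y))))" for l y
    have e_eq: "e l y = A l * sin (w * y) + G * (N * w\<^sup>2 * cos (w * (x + y)) + \<alpha> * w * sin (w * (x + y)))" for l y
      by (simp add: e_def sigma_S_def Let_def N_def D_def A_def G_def)
    have de: "((e l) has_real_derivative e' l y) (at y)" for l y
      unfolding e_eq[abs_def] e'_def by (auto intro!: derivative_eq_intros)
    have de': "((e' l) has_real_derivative - (w\<^sup>2) * e l y) (at y)" for l y
      unfolding e'_def[abs_def] e_eq
      by (auto intro!: derivative_eq_intros) (simp add: algebra_simps power2_eq_square)
    have ce: "continuous_on UNIV (e l)" "continuous_on UNIV (e' l)" for l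
      using DERIV_isCont[OF de] DERIV_isCont[OF de'] by (auto simp: continuous_on_eq_continuous_at)
    have be: "\<bar>e l y\<bar> \<le> 6 / pi" for l y unfolding e_def by (rule sigma_S_bound)
    define C where "C = 2 / pi * \<bar>w\<bar> + G * (N * w\<^sup>2 * \<bar>w\<bar> + \<bar>\<alpha> * w\<bar> * \<bar>w\<bar>)"
    have be': "\<bar>e' l y\<bar> \<le> C" for l y
    proof -
      have "\<bar>A l\<bar> \<le> 2 / pi" by (simp add: A_def abs_mult divide_right_mono)
      moreover have "\<bar>w * cos (w * y)\<bar> \<le> \<bar>w\<bar>" by (simp add: abs_mult mult_left_le)
      ultimately have 1: "\<bar>A l * (w * cos (w * y))\<bar> \<le> 2 / pi * \<bar>w\<bar>"
        unfolding abs_mult[of "A l"] by (intro mult_mono) auto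
      have "\<bar>N * w\<^sup>2 * (- w * sin (w * (x + y))) + \<alpha> * w * (w * cos (w * (x + y)))\<bar> \<le> N * w\<^sup>2 * \<bar>w\<bar> + \<bar>\<alpha> * w\<bar> * \<bar>w\<bar>"
        by (rule order_trans[OF abs_triangle_ineq], rule add_mono)
           (use N in \<open>auto simp: abs_mult intro!: mult_left_mono mult_left_le\<close>)
      hence 2: "\<bar>G * (N * w\<^sup>2 * (- w * sin (w * (x + y))) + \<alpha> * w * (w * cos (w * (x + y))))\<bar>
          \<le> G * (N * w\<^sup>2 * \<bar>w\<bar> + \<bar>\<alpha> * w\<bar> * \<bar>w\<bar>)"
        unfolding abs_mult[of G] using G by (intro mult_mono) auto
      show ?thesis unfolding e'_def C_def
        by (rule order_trans[OF abs_triangle_ineq add_mono[OF 1 2]])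
    qed
    let ?F = "\<lambda>y. \<Sum>l\<in>UNIV. 1 * (of_real (e l y) * v y $ l) + (-1) * (of_real (e' l y) * u y $ l)"
    let ?f = "\<lambda>y. \<Sum>l\<in>UNIV. of_real (k\<^sup>2 + w\<^sup>2) * (of_real (e l y) * u y $ l) + (-1) * (of_real (e l y) * f y $ l)"
    have decF: "decaying b ?F"
      by (intro decaying_sum decaying_lin decaying_mult[OF vdecayingD[OF dec(2)] ce(1) be]
          decaying_mult[OF vdecayingD[OF dec(1)] ce(2) be']) simp
    have decf: "decaying b ?f"
      by (intro decaying_sum decaying_lin decaying_mult[OF vdecayingD[OF dec(1)] ce(1) be]
          decaying_mult[OF vdecayingD[OF dec(3)] ce(1) be]) simp
    have "(LBINT y:{0<..}. ?f y) = 0 - ?F 0"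
    proof (rule FTC_Ioi)
      fix y
      have vd: "((\<lambda>y. complex_of_real (g y)) has_vector_derivative of_real g') (at y)"
        if "(g has_real_derivative g') (at y)" for g g'
        using that by (intro has_vector_derivative_of_real) (simp add: has_real_derivative_iff_has_vector_derivative)
      have "(?F has_vector_derivative (\<Sum>l\<in>UNIV. 1 * (of_real (e l y) * (of_real (k\<^sup>2) * u y $ l - f y $ l) + of_real (e' l y) * v y $ l)
          + (-1) * (of_real (e' l y) * v y $ l + of_real (- (w\<^sup>2) * e l y) * u y $ l))) (at y)"
        by (intro has_vector_derivative_sum has_vector_derivative_add has_vector_derivative_mult_right
            has_vector_derivative_mult vd de de' d)
      moreover have "(\<Sum>l\<in>UNIV. 1 * (of_real (e l y) * (of_real (k\<^sup>2) * u y $ l - f y $ l) + of_real (e' l y) * v y $ l)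
          + (-1) * (of_real (e' l y) * v y $ l + of_real (- (w\<^sup>2) * e l y) * u y $ l)) = ?f y"
        by (intro sum.cong refl) (simp add: algebra_simps)
      ultimately show "(?F has_vector_derivative ?f y) (at y)" by (simp only:)
    next
      show "continuous_on UNIV ?f" using decf by (simp add: decaying_def)
      show "set_integrable lborel {0<..} ?f" unfolding set_integrable_def by (rule decaying_integrable[OF decf b])
      show "(?F \<longlongrightarrow> 0) at_top" by (rule decaying_tendsto[OF decF b])
    qed
    also have "?F 0 = 0"
    proof -
      define e0 where "e0 = G * (N * w\<^sup>2 * cos (w * x) + \<alpha> * w * sin (w * x))"
      have e0: "e l 0 = e0" for l unfolding e_eq e0_def by simp
      have "(\<Sum>l\<in>UNIV. e' l 0) = \<alpha> * e0"
      proof -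
        define X where "X = N * w\<^sup>2 * (- w * sin (w * x)) + \<alpha> * w * (w * cos (w * x))"
        have "(\<Sum>l\<in>UNIV. A l) = 2 / pi * sin (w * x)"
          unfolding A_def by (simp add: if_distrib[of "\<lambda>z. _ * z"] if_distrib[of "\<lambda>z. z * _"] cong: if_cong)
        hence "(\<Sum>l\<in>UNIV. e' l 0) = G * D * sin (w * x) * w + N * (G * X)"
          unfolding e'_def sum.distrib G(2) X_def by (simp add: N_def sum_distrib_right[symmetric])
        also have "\<dots> = G * (D * sin (w * x) * w + N * X)" by (simp add: algebra_simps)
        \<comment> \<open>G D = 2 / pi puts the delta term over the common denominator; its part N^2
          w^3 sin (w x) cancels against the derivative of the cosine.\<close>
        also have "D * sin (w * x) * w + N * X = \<alpha> * (N * w\<^sup>2 * cos (w * x) + \<alpha> * w * sin (w * x))"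
          unfolding D_def X_def by (simp add: algebra_simps power2_eq_square)
        finally show ?thesis unfolding e0_def by (simp add: mult_ac)
      qed
      hence "(\<Sum>l\<in>UNIV. complex_of_real (e' l 0)) = of_real (\<alpha> * e0)" by (simp flip: of_real_sum)
      moreover have "?F 0 = of_real e0 * (\<Sum>l\<in>UNIV. v 0 $ l) - (\<Sum>l\<in>UNIV. complex_of_real (e' l 0)) * c"
        unfolding e0 c by (simp add: sum_subtractf sum_distrib_left sum_distrib_right)
      ultimately show ?thesis unfolding s by simp
    qed
    finally have 0: "(LBINT y:{0<..}. ?f y) = 0" by simp
    have iu: "set_integrable lborel {0<..} (\<lambda>y. of_real (e l y) * u y $ l)"
      and if': "set_integrable lborel {0<..} (\<lambda>y. of_real (e l y) * f y $ l)" for l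
      unfolding set_integrable_def
      using decaying_integrable[OF decaying_mult[OF vdecayingD[OF dec(1)] ce(1) be] b]
        decaying_integrable[OF decaying_mult[OF vdecayingD[OF dec(3)] ce(1) be] b] by blast+
    have "(LBINT y:{0<..}. ?f y) = (\<Sum>l\<in>UNIV. LBINT y:{0<..}. of_real (k\<^sup>2 + w\<^sup>2) * (of_real (e l y) * u y $ l) + (-1) * (of_real (e l y) * f y $ l))"
      unfolding set_lebesgue_integral_def scaleR_sum_right
      using iu if' by (intro Bochner_Integration.integral_sum, fold set_integrable_def)
        (intro set_integral_add set_integrable_mult_right, blast+)
    also have "\<dots> = (\<Sum>l\<in>UNIV. of_real (k\<^sup>2 + w\<^sup>2) * (LBINT y:{0<..}. of_real (e l y) * u y $ l) + (-1) * (LBINT y:{0<..}. of_real (e l y) * f y $ l))"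
    proof (intro sum.cong refl)
      fix l
      show "(LBINT y:{0<..}. of_real (k\<^sup>2 + w\<^sup>2) * (of_real (e l y) * u y $ l) + (-1) * (of_real (e l y) * f y $ l))
        = of_real (k\<^sup>2 + w\<^sup>2) * (LBINT y:{0<..}. of_real (e l y) * u y $ l) + (-1) * (LBINT y:{0<..}. of_real (e l y) * f y $ l)"
        by (subst set_integral_add(2)[OF set_integrable_mult_right[OF iu] set_integrable_mult_right[OF if']])
           (simp only: set_integral_mult_right)
    qed
    finally show ?thesis using 0 unfolding e_def[symmetric]
      by (simp add: sum_subtractf sum_distrib_left)
  qed
  thus ?thesis unfolding kernel_op_def half_line_integral
    by (simp only: vec_eq_iff vector_smult_component vec_lambda_beta) blast
qed

section \<open>Integral operators with bounded kernels\<close>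

text \<open>Made for \<open>sigma_S\<close>, whose entries oscillate and in general are not
  square-integrable: such operators map decaying functions to bounded ones, and pairings are formed
  with decaying functions.\<close>

definition bounded_kernel :: "('n::finite \<Rightarrow> 'n \<Rightarrow> real \<Rightarrow> real \<Rightarrow> real) \<Rightarrow> bool" where
  "bounded_kernel r \<longleftrightarrow> (\<forall>j l. (\<lambda>(x, y). r j l x y) \<in> borel_measurable (borel \<Otimes>\<^sub>M borel)) \<and>
     (\<exists>C. \<forall>j l x y. \<bar>r j l x y\<bar> \<le> C)"

lemma bounded_kernel_measurable:
  assumes "bounded_kernel r" and [measurable]: "f \<in> borel_measurable M" "g \<in> borel_measurable M"
  shows "(\<lambda>z. r j l (f z) (g z)) \<in> borel_measurable M"
proof -
  have [measurable]: "(\<lambda>(x, y). r j l x y) \<in> borel_measurable (borel \<Otimes>\<^sub>M borel)"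
    using assms(1) by (simp add: bounded_kernel_def)
  have "(\<lambda>z. (\<lambda>(x, y). r j l x y) (f z, g z)) \<in> borel_measurable M" by measurable
  thus ?thesis by simp
qed

lemma kernel_mult_integrable:
  assumes r: "bounded_kernel r" and f: "vdecaying b f" and b: "b > 0"
  shows "set_integrable lborel {0<..} (\<lambda>y. of_real (r j l x y) * f y $ l)"
proof -
  obtain C where C: "\<And>j l x y. \<bar>r j l x y\<bar> \<le> C" using r by (auto simp: bounded_kernel_def)
  have C0: "C \<ge> 0" using C[of j l 0 0] by linarith
  have [measurable]: "(\<lambda>y. f y $ l) \<in> borel_measurable borel" by (rule decaying_measurable[OF vdecayingD[OF f]])
  have [measurable]: "(\<lambda>y. r j l x y) \<in> borel_measurable borel" by (rule bounded_kernel_measurable[OF r]) simp_all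
  have i: "integrable lborel (\<lambda>y. C * norm (indicator {0<..} y *\<^sub>R f y $ l))"
    by (intro Bochner_Integration.integrable_mult_right Bochner_Integration.integrable_norm decaying_integrable[OF vdecayingD[OF f] b])
  show ?thesis
    unfolding set_integrable_def
  proof (rule Bochner_Integration.integrable_bound[OF i])
    show "AE y in lborel. norm (indicator {0<..} y *\<^sub>R (of_real (r j l x y) * f y $ l)) \<le> norm (C * norm (indicator {0<..} y *\<^sub>R f y $ l))"
      using C C0 by (auto intro!: always_eventually mult_right_mono split: split_indicator simp: norm_mult abs_mult)
  qed measurable
qed

lemma kernel_op_lin:
  assumes r: "bounded_kernel r" and f: "vdecaying b f" and g: "vdecaying b g" and b: "b > 0"
  shows "kernel_op r (\<lambda>x. c *s f x + d *s g x) x = c *s kernel_op r f x + d *s kernel_op r g x"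
proof -
  have "(\<integral>y. of_real (r j l x y) * (c *s f y + d *s g y) $ l \<partial>half_line)
    = c * (\<integral>y. of_real (r j l x y) * f y $ l \<partial>half_line) + d * (\<integral>y. of_real (r j l x y) * g y $ l \<partial>half_line)" for j l
  proof -
    have i: "integrable half_line (\<lambda>y. of_real (r j l x y) * f y $ l)" "integrable half_line (\<lambda>y. of_real (r j l x y) * g y $ l)"
      using kernel_mult_integrable[OF r f b] kernel_mult_integrable[OF r g b] by (simp_all add: half_line_integrable)
    have "(\<integral>y. of_real (r j l x y) * (c *s f y + d *s g y) $ l \<partial>half_line)
      = (\<integral>y. c * (of_real (r j l x y) * f y $ l) + d * (of_real (r j l x y) * g y $ l) \<partial>half_line)"
      by (intro Bochner_Integration.integral_cong refl) (simp add: algebra_simps)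
    thus ?thesis using i by simp
  qed
  thus ?thesis unfolding kernel_op_def by (simp add: vec_eq_iff sum.distrib sum_distrib_left)
qed

lemma kernel_op_bounded:
  assumes r: "bounded_kernel r" and f: "vdecaying b f" and b: "b > 0"
  shows "(\<lambda>x. kernel_op r f x $ j) \<in> borel_measurable borel"
    and "\<exists>B. \<forall>x. cmod (kernel_op r f x $ j) \<le> B"
proof -
  obtain C where C: "\<And>j l x y. \<bar>r j l x y\<bar> \<le> C" using r by (auto simp: bounded_kernel_def)
  have C0: "C \<ge> 0" using C[of j j 0 0] by linarith
  have [measurable]: "(\<lambda>y. f y $ l) \<in> borel_measurable borel" for l by (rule decaying_measurable[OF vdecayingD[OF f]])
  have [measurable]: "(\<lambda>(x, y). r j l x y) \<in> borel_measurable (borel \<Otimes>\<^sub>M borel)" for l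
    using r by (simp add: bounded_kernel_def)
  have "(\<lambda>x. LBINT y. indicator {0<..} y *\<^sub>R (of_real (r j l x y) * f y $ l)) \<in> borel_measurable borel" for l
    by measurable
  thus "(\<lambda>x. kernel_op r f x $ j) \<in> borel_measurable borel"
    unfolding kernel_op_def half_line_integral set_lebesgue_integral_def by simp
  let ?B = "\<lambda>l. (LBINT y. C * norm (indicator {0<..} y *\<^sub>R f y $ l))"
  have "cmod (\<integral>y. of_real (r j l x y) * f y $ l \<partial>half_line) \<le> ?B l" for l x
    unfolding half_line_integral set_lebesgue_integral_def
  proof (rule Bochner_Integration.integral_norm_bound_integral)
    show "integrable lborel (\<lambda>y. indicator {0<..} y *\<^sub>R (of_real (r j l x y) * f y $ l))"
      using kernel_mult_integrable[OF r f b] by (simp add: set_integrable_def)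
    show "integrable lborel (\<lambda>y. C * norm (indicator {0<..} y *\<^sub>R f y $ l))"
      by (intro Bochner_Integration.integrable_mult_right Bochner_Integration.integrable_norm decaying_integrable[OF vdecayingD[OF f] b])
    show "norm (indicator {0<..} y *\<^sub>R (of_real (r j l x y) * f y $ l)) \<le> C * norm (indicator {0<..} y *\<^sub>R f y $ l)" for y
      using C[of j l x y] by (auto intro!: mult_right_mono split: split_indicator simp: norm_mult)
  qed
  hence "cmod (kernel_op r f x $ j) \<le> (\<Sum>l\<in>UNIV. ?B l)" for x
    unfolding kernel_op_def vec_lambda_beta by (intro order_trans[OF norm_sum] sum_mono)
  thus "\<exists>B. \<forall>x. cmod (kernel_op r f x $ j) \<le> B" by blast
qed

lemma bounded_mult_decaying_integrable:
  assumes h: "h \<in> borel_measurable borel" "\<And>x. cmod (h x) \<le> B" and g: "decaying b g" and b: "b > 0"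
  shows "integrable half_line (\<lambda>x. h x * cnj (g x))"
proof -
  have [measurable]: "g \<in> borel_measurable borel" "h \<in> borel_measurable borel"
    by (rule decaying_measurable[OF g]) (rule h(1))
  have B0: "B \<ge> 0" using h(2)[of 0] norm_ge_zero order_trans by blast
  have i: "integrable lborel (\<lambda>y. B * norm (indicator {0<..} y *\<^sub>R g y))"
    by (intro Bochner_Integration.integrable_mult_right Bochner_Integration.integrable_norm decaying_integrable[OF g b])
  show ?thesis
    unfolding half_line_integrable set_integrable_def
  proof (rule Bochner_Integration.integrable_bound[OF i])
    show "AE y in lborel. norm (indicator {0<..} y *\<^sub>R (h y * cnj (g y))) \<le> norm (B * norm (indicator {0<..} y *\<^sub>R g y))"
      using h(2) B0 by (auto intro!: always_eventually mult_right_mono split: split_indicator simp: norm_mult abs_mult)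
  qed measurable
qed

lemma kernel_op_inner_integrable:
  assumes r: "bounded_kernel r" and f: "vdecaying b f" and g: "vdecaying b g" and b: "b > 0"
  shows "integrable half_line (\<lambda>x. kernel_op r f x $ j * cnj (g x $ j))"
proof -
  obtain B where "\<And>x. cmod (kernel_op r f x $ j) \<le> B" using kernel_op_bounded(2)[OF r f b] by blast
  thus ?thesis by (rule bounded_mult_decaying_integrable[OF kernel_op_bounded(1)[OF r f b] _ vdecayingD[OF g] b])
qed

text \<open>The left argument is merely bounded, so \<open>l2_inner_lin_left\<close> does not apply;
  the pairing converges because h decays.\<close>

lemma kernel_op_inner_lin_left:
  assumes r: "bounded_kernel r" and f: "vdecaying b f" and g: "vdecaying b g" and h: "vdecaying b h" and b: "b > 0"
  shows "l2_inner (kernel_op r (\<lambda>x. c *s f x + d *s g x)) h = c * l2_inner (kernel_op r f) h + d * l2_inner (kernel_op r g) h"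
proof -
  have i: "integrable half_line (\<lambda>x. \<Sum>j\<in>UNIV. kernel_op r w x $ j * cnj (h x $ j))" if "vdecaying b w" for w
    by (intro Bochner_Integration.integrable_sum kernel_op_inner_integrable[OF r that h b])
  have "l2_inner (kernel_op r (\<lambda>x. c *s f x + d *s g x)) h
    = (\<integral>x. c * (\<Sum>j\<in>UNIV. kernel_op r f x $ j * cnj (h x $ j)) + d * (\<Sum>j\<in>UNIV. kernel_op r g x $ j * cnj (h x $ j)) \<partial>half_line)"
    unfolding l2_inner_def kernel_op_lin[OF r f g b]
    by (intro Bochner_Integration.integral_cong refl) (simp add: sum_distrib_left sum.distrib algebra_simps)
  thus ?thesis unfolding l2_inner_def using i[OF f] i[OF g] by simp
qed

lemma kernel_op_inner_lin_right:
  assumes r: "bounded_kernel r" and f: "vdecaying b f" and g: "vdecaying b g" and h: "vdecaying b h" and b: "b > 0"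
  shows "l2_inner (kernel_op r h) (\<lambda>x. c *s f x + d *s g x) = cnj c * l2_inner (kernel_op r h) f + cnj d * l2_inner (kernel_op r h) g"
proof -
  have i: "integrable half_line (\<lambda>x. \<Sum>j\<in>UNIV. kernel_op r h x $ j * cnj (w x $ j))" if "vdecaying b w" for w
    by (intro Bochner_Integration.integrable_sum kernel_op_inner_integrable[OF r h that b])
  have "l2_inner (kernel_op r h) (\<lambda>x. c *s f x + d *s g x)
    = (\<integral>x. cnj c * (\<Sum>j\<in>UNIV. kernel_op r h x $ j * cnj (f x $ j)) + cnj d * (\<Sum>j\<in>UNIV. kernel_op r h x $ j * cnj (g x $ j)) \<partial>half_line)"
    unfolding l2_inner_def
    by (intro Bochner_Integration.integral_cong refl) (simp add: sum_distrib_left sum.distrib algebra_simps)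
  thus ?thesis unfolding l2_inner_def using i[OF f] i[OF g] by simp
qed

section \<open>Superposition of kernels over frequencies\<close>

text \<open>Boundedness of s and integrability of p, f and g dominate the triple integrand; the
  integral over w is moved outwards past y, then past x.\<close>

lemma Fubini_kernel:
  fixes s :: "real \<Rightarrow> real \<Rightarrow> real \<Rightarrow> real" and p :: "real \<Rightarrow> real" and f g :: "real \<Rightarrow> complex"
  assumes s: "(\<lambda>(w, x, y). s w x y) \<in> borel_measurable (borel \<Otimes>\<^sub>M borel \<Otimes>\<^sub>M borel)"
    and C: "\<And>w x y. \<bar>s w x y\<bar> \<le> C"
    and p: "integrable lborel p" and f: "integrable lborel f" and g: "integrable lborel g"
  shows "(LBINT x. (LBINT y. of_real (LBINT w. p w * s w x y) * f y) * g x)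
    = (LBINT w. of_real (p w) * (LBINT x. (LBINT y. of_real (s w x y) * f y) * g x))"
    and "integrable lborel (\<lambda>w. of_real (p w) * (LBINT x. (LBINT y. of_real (s w x y) * f y) * g x))"
proof -
  have C0: "C \<ge> 0" using C[of 0 0 0] by linarith
  have [measurable]: "p \<in> borel_measurable borel" "f \<in> borel_measurable borel" "g \<in> borel_measurable borel"
    using p f g by (auto dest: borel_measurable_integrable)
  note [measurable] = s
  have s2[measurable]: "(\<lambda>z. s (a z) (b z) (c z)) \<in> borel_measurable M"
    if [measurable]: "a \<in> borel_measurable M" "b \<in> borel_measurable M" "c \<in> borel_measurable M" for a b c and M :: "'m measure"
  proof -
    have "(\<lambda>z. (\<lambda>(w, x, y). s w x y) (a z, b z, c z)) \<in> borel_measurable M" by measurable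
    thus ?thesis by simp
  qed
  define h where "h w x = (LBINT y. of_real (s w x y) * f y)" for w x
  have hm[measurable]: "(\<lambda>(w, x). h w x) \<in> borel_measurable (borel \<Otimes>\<^sub>M borel)"
    unfolding h_def by (simp add: split_beta') measurable
  define F where "F = (LBINT y. C * norm (f y))"
  have hb: "cmod (h w x) \<le> F" for w x
    unfolding h_def F_def
  proof (rule Bochner_Integration.integral_norm_bound_integral)
    show g1: "integrable lborel (\<lambda>y. C * norm (f y))"
      by (intro Bochner_Integration.integrable_mult_right Bochner_Integration.integrable_norm f)
    show b1: "norm (of_real (s w x y) * f y) \<le> C * norm (f y)" for y
      using C[of w x y] by (auto simp: norm_mult intro: mult_right_mono)
    show "integrable lborel (\<lambda>y. of_real (s w x y) * f y)"
      by (rule Bochner_Integration.integrable_bound[OF g1]) (use b1 C0 in \<open>auto simp: abs_mult intro!: s2\<close>)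
  qed
  have F0: "F \<ge> 0" using hb[of 0 0] norm_ge_zero order_trans by blast
  have in1: "(LBINT y. of_real (LBINT w. p w * s w x y) * f y) = (LBINT w. of_real (p w) * h w x)" for x
  proof -
    have "integrable (lborel \<Otimes>\<^sub>M lborel) (\<lambda>(w, y). of_real (p w * s w x y) * f y)"
    proof (rule integrable_pair_bound)
      show "(\<lambda>(w, y). of_real (p w * s w x y) * f y) \<in> borel_measurable (lborel \<Otimes>\<^sub>M lborel)"
        by (simp add: split_beta') measurable
      show "integrable lborel (\<lambda>w. \<bar>p w\<bar>)" using p by simp
      show "integrable lborel (\<lambda>y. C * norm (f y))"
        by (intro Bochner_Integration.integrable_mult_right Bochner_Integration.integrable_norm f)
      fix w y
      have "\<bar>p w\<bar> * \<bar>s w x y\<bar> * norm (f y) \<le> \<bar>p w\<bar> * C * norm (f y)"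
        using C[of w x y] by (intro mult_right_mono mult_left_mono) auto
      thus "norm (case (w, y) of (w, y) \<Rightarrow> of_real (p w * s w x y) * f y) \<le> \<bar>p w\<bar> * (C * norm (f y))"
        by (simp add: norm_mult mult.assoc)
    qed
    from lborel_pair.Fubini_integral[OF this]
    have "(LBINT y. LBINT w. of_real (p w * s w x y) * f y) = (LBINT w. LBINT y. of_real (p w * s w x y) * f y)" .
    moreover have "(LBINT w. of_real (p w * s w x y) * f y) = of_real (LBINT w. p w * s w x y) * f y" for y
      unfolding Bochner_Integration.integral_mult_left_zero integral_complex_of_real ..
    moreover have "(LBINT y. of_real (p w * s w x y) * f y) = of_real (p w) * h w x" for w
      unfolding h_def by (simp only: of_real_mult mult.assoc Bochner_Integration.integral_mult_right_zero)
    ultimately show ?thesis by (simp only:)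
  qed
  have int: "integrable (lborel \<Otimes>\<^sub>M lborel) (\<lambda>(w, x). of_real (p w) * h w x * g x)"
  proof (rule integrable_pair_bound)
    show "(\<lambda>(w, x). of_real (p w) * h w x * g x) \<in> borel_measurable (lborel \<Otimes>\<^sub>M lborel)"
      by measurable
    show "integrable lborel (\<lambda>w. \<bar>p w\<bar>)" using p by simp
    show "integrable lborel (\<lambda>x. F * norm (g x))"
      by (intro Bochner_Integration.integrable_mult_right Bochner_Integration.integrable_norm g)
    fix w x
    have "\<bar>p w\<bar> * cmod (h w x) * norm (g x) \<le> \<bar>p w\<bar> * F * norm (g x)"
      using hb[of w x] by (intro mult_right_mono mult_left_mono) auto
    thus "norm (case (w, x) of (w, x) \<Rightarrow> of_real (p w) * h w x * g x) \<le> \<bar>p w\<bar> * (F * norm (g x))"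
      by (simp add: norm_mult mult.assoc)
  qed
  have o: "(LBINT x. of_real (p w) * h w x * g x) = of_real (p w) * (LBINT x. h w x * g x)" for w
    by (simp only: mult.assoc Bochner_Integration.integral_mult_right_zero)
  from lborel_pair.Fubini_integral[OF int]
  have "(LBINT x. LBINT w. of_real (p w) * h w x * g x) = (LBINT w. LBINT x. of_real (p w) * h w x * g x)" .
  thus "(LBINT x. (LBINT y. of_real (LBINT w. p w * s w x y) * f y) * g x)
    = (LBINT w. of_real (p w) * (LBINT x. (LBINT y. of_real (s w x y) * f y) * g x))"
    unfolding in1 o h_def[symmetric] Bochner_Integration.integral_mult_left_zero .
  from lborel_pair.integrable_fst'[OF int]
  show "integrable lborel (\<lambda>w. of_real (p w) * (LBINT x. (LBINT y. of_real (s w x y) * f y) * g x))"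
    unfolding h_def[symmetric] prod.case o .
qed

lemma kernel_op_inner_eq:
  assumes r: "bounded_kernel r" and f: "vdecaying b f" and g: "vdecaying b g" and b: "b > 0"
  shows "l2_inner (kernel_op r f) g = (\<Sum>j\<in>UNIV. \<Sum>l\<in>UNIV. LBINT x. (LBINT y. of_real (r j l x y) * (indicator {0<..} y *\<^sub>R f y $ l)) * (indicator {0<..} x *\<^sub>R cnj (g x $ j)))"
proof -
  obtain C where C: "\<And>j l x y. \<bar>r j l x y\<bar> \<le> C" using r by (auto simp: bounded_kernel_def)
  define h where "h j l x = (\<integral>y. of_real (r j l x y) * f y $ l \<partial>half_line)" for j l x
  have h: "h j l x = (LBINT y. of_real (r j l x y) * (indicator {0<..} y *\<^sub>R f y $ l))" for j l x
    unfolding h_def half_line_integral set_lebesgue_integral_def by simp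
  have i: "integrable half_line (\<lambda>x. h j l x * cnj (g x $ j))" for j l
  proof -
    \<comment> \<open>Keeping a single column isolates one summand, whose integrability then follows
      from that of a whole operator.\<close>
    let ?r = "\<lambda>j' l'. if l' = l then r j l else (\<lambda>_ _. 0)"
    have r': "bounded_kernel ?r"
      using r C unfolding bounded_kernel_def
      by (auto simp: split_beta' intro!: exI[of _ C] order_trans[OF abs_ge_zero C])
    have "kernel_op ?r f x $ j = h j l x" for x
      unfolding kernel_op_def h_def by (simp add: if_distrib[of "\<lambda>z. z _ _"] sum.delta cong: if_cong) (subst sum.remove[of _ l], simp_all)
    thus ?thesis using kernel_op_inner_integrable[OF r' f g b, of j] by simp
  qed
  have "l2_inner (kernel_op r f) g = (\<integral>x. (\<Sum>j\<in>UNIV. \<Sum>l\<in>UNIV. h j l x * cnj (g x $ j)) \<partial>half_line)"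
    unfolding l2_inner_def kernel_op_def h_def by (simp add: sum_distrib_right)
  also have "\<dots> = (\<Sum>j\<in>UNIV. \<Sum>l\<in>UNIV. (\<integral>x. h j l x * cnj (g x $ j) \<partial>half_line))"
    using i by (subst Bochner_Integration.integral_sum, simp, subst Bochner_Integration.integral_sum) simp_all
  also have "\<dots> = (\<Sum>j\<in>UNIV. \<Sum>l\<in>UNIV. LBINT x. h j l x * (indicator {0<..} x *\<^sub>R cnj (g x $ j)))"
    unfolding half_line_integral set_lebesgue_integral_def by simp
  finally show ?thesis unfolding h .
qed

lemma bounded_kernel_sigma: "bounded_kernel (\<lambda>j l. sigma_S \<alpha> j l w)"
  unfolding bounded_kernel_def by (intro conjI allI exI[of _ "6 / pi"] sigma_S_bound) (simp add: split_beta')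

lemma bounded_kernel_sigma_integral:
  assumes p: "integrable lborel p"
  shows "bounded_kernel (\<lambda>j l x y. LBINT w. p w * sigma_S \<alpha> j l w x y)"
  unfolding bounded_kernel_def
proof (intro conjI allI)
  have [measurable]: "p \<in> borel_measurable borel" using p by (auto dest: borel_measurable_integrable)
  show "(\<lambda>(x, y). LBINT w. p w * sigma_S \<alpha> j l w x y) \<in> borel_measurable (borel \<Otimes>\<^sub>M borel)" for j l
    by measurable
  show "\<exists>C. \<forall>j l x y. \<bar>LBINT w. p w * sigma_S \<alpha> j l w x y\<bar> \<le> C"
  proof (intro exI allI)
    fix j l x y
    have b: "\<bar>p w * sigma_S \<alpha> j l w x y\<bar> \<le> 6 / pi * \<bar>p w\<bar>" for w
      unfolding abs_mult using mult_left_mono[OF sigma_S_bound[of \<alpha> j l w x y], of "\<bar>p w\<bar>"] by (simp add: mult.commute)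
    have i: "integrable lborel (\<lambda>w. 6 / pi * \<bar>p w\<bar>)" using p by simp
    have "integrable lborel (\<lambda>w. p w * sigma_S \<alpha> j l w x y)"
      by (rule Bochner_Integration.integrable_bound[OF i]) (use b in auto)
    from Bochner_Integration.integral_norm_bound_integral[OF this i]
    show "\<bar>LBINT w. p w * sigma_S \<alpha> j l w x y\<bar> \<le> (LBINT w. 6 / pi * \<bar>p w\<bar>)" using b by simp
  qed
qed

text \<open>Serves twice: for the resolvent, with p = 1 / (c + w^2) on w \<ge> 0, and for the
  projection, with p the indicator of [0, sqrt lam].\<close>

lemma sigma_integral_inner:
  assumes p: "integrable lborel p" and f: "vdecaying b f" and g: "vdecaying b g" and b: "b > 0"
  shows "l2_inner (kernel_op (\<lambda>j l x y. LBINT w. p w * sigma_S \<alpha> j l w x y) f) g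
    = (LBINT w. of_real (p w) * l2_inner (kernel_op (\<lambda>j l. sigma_S \<alpha> j l w) f) g)"
proof -
  have if': "integrable lborel (\<lambda>y. indicator {0<..} y *\<^sub>R f y $ l)" for l
    by (rule decaying_integrable[OF vdecayingD[OF f] b])
  have ig: "integrable lborel (\<lambda>x. indicator {0<..} x *\<^sub>R cnj (g x $ j))" for j
  proof -
    have "integrable lborel (\<lambda>x. cnj (indicator {0<..} x *\<^sub>R g x $ j))"
      by (rule integrable_bounded_linear[OF bounded_linear_cnj decaying_integrable[OF vdecayingD[OF g] b]])
    thus ?thesis by simp
  qed
  note F = Fubini_kernel[OF _ sigma_S_bound p if' ig]
  show ?thesis
    unfolding kernel_op_inner_eq[OF bounded_kernel_sigma_integral[OF p] f g b] kernel_op_inner_eq[OF bounded_kernel_sigma f g b]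
      sum_distrib_left
    by (subst Bochner_Integration.integral_sum, intro Bochner_Integration.integrable_sum F(2), simp add: split_beta',
        subst Bochner_Integration.integral_sum, intro F(2), simp add: split_beta',
        intro sum.cong refl F(1), simp add: split_beta')
qed

text \<open>Provides the hypotheses on \<rho> in \<open>measure_from_moments\<close>.\<close>

lemma sigma_inner_bounded_measurable:
  assumes f: "vdecaying b f" and g: "vdecaying b g" and b: "b > 0"
  shows "(\<lambda>w. l2_inner (kernel_op (\<lambda>j l. sigma_S \<alpha> j l w) f) g) \<in> borel_measurable borel"
    and "\<exists>B. \<forall>w. cmod (l2_inner (kernel_op (\<lambda>j l. sigma_S \<alpha> j l w) f) g) \<le> B"
proof -
  have [measurable]: "(\<lambda>y. f y $ l) \<in> borel_measurable borel" "(\<lambda>y. g y $ l) \<in> borel_measurable borel" for l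
    by (rule decaying_measurable[OF vdecayingD[OF f]], rule decaying_measurable[OF vdecayingD[OF g]])
  show "(\<lambda>w. l2_inner (kernel_op (\<lambda>j l. sigma_S \<alpha> j l w) f) g) \<in> borel_measurable borel"
    unfolding kernel_op_inner_eq[OF bounded_kernel_sigma f g b] by measurable
  define F where "F l = (LBINT y. 6 / pi * norm (indicator {0<..} y *\<^sub>R f y $ l))" for l
  define G where "G l j = (LBINT x. F l * norm (indicator {0<..} x *\<^sub>R g x $ j))" for l j
  have if': "integrable lborel (\<lambda>y. 6 / pi * norm (indicator {0<..} y *\<^sub>R f y $ l))" for l
    by (intro Bochner_Integration.integrable_mult_right Bochner_Integration.integrable_norm decaying_integrable[OF vdecayingD[OF f] b])
  have ig: "integrable lborel (\<lambda>x. F l * norm (indicator {0<..} x *\<^sub>R g x $ j))" for l j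
    by (intro Bochner_Integration.integrable_mult_right Bochner_Integration.integrable_norm decaying_integrable[OF vdecayingD[OF g] b])
  have hb: "cmod (LBINT y. of_real (sigma_S \<alpha> j l w x y) * (indicator {0<..} y *\<^sub>R f y $ l)) \<le> F l" for j l w x
    unfolding F_def
  proof (rule Bochner_Integration.integral_norm_bound_integral[OF _ if'])
    show b1: "norm (of_real (sigma_S \<alpha> j l w x y) * (indicator {0<..} y *\<^sub>R f y $ l)) \<le> 6 / pi * norm (indicator {0<..} y *\<^sub>R f y $ l)" for y
      unfolding norm_mult norm_of_real by (intro mult_right_mono sigma_S_bound) simp
    show "integrable lborel (\<lambda>y. of_real (sigma_S \<alpha> j l w x y) * (indicator {0<..} y *\<^sub>R f y $ l))"
      by (rule Bochner_Integration.integrable_bound[OF if'[of l]])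
         (measurable, intro always_eventually allI order_trans[OF b1], simp)
  qed
  have "cmod (LBINT x. (LBINT y. of_real (sigma_S \<alpha> j l w x y) * (indicator {0<..} y *\<^sub>R f y $ l)) * (indicator {0<..} x *\<^sub>R cnj (g x $ j))) \<le> G l j" for j l w
    unfolding G_def
  proof (rule Bochner_Integration.integral_norm_bound_integral[OF _ ig])
    show b1: "norm ((LBINT y. of_real (sigma_S \<alpha> j l w x y) * (indicator {0<..} y *\<^sub>R f y $ l)) * (indicator {0<..} x *\<^sub>R cnj (g x $ j)))
        \<le> F l * norm (indicator {0<..} x *\<^sub>R g x $ j)" for x
      unfolding norm_mult norm_scaleR complex_mod_cnj by (intro mult_right_mono hb) simp
    show "integrable lborel (\<lambda>x. (LBINT y. of_real (sigma_S \<alpha> j l w x y) * (indicator {0<..} y *\<^sub>R f y $ l)) * (indicator {0<..} x *\<^sub>R cnj (g x $ j)))"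
      by (rule Bochner_Integration.integrable_bound[OF ig[of l j]])
         (measurable, intro always_eventually allI order_trans[OF b1], simp)
  qed
  hence "cmod (l2_inner (kernel_op (\<lambda>j l. sigma_S \<alpha> j l w) f) g) \<le> (\<Sum>j\<in>UNIV. \<Sum>l\<in>UNIV. G l j)" for w
    unfolding kernel_op_inner_eq[OF bounded_kernel_sigma f g b]
    by (intro order_trans[OF norm_sum] sum_mono)
  thus "\<exists>B. \<forall>w. cmod (l2_inner (kernel_op (\<lambda>j l. sigma_S \<alpha> j l w) f) g) \<le> B" by blast
qed

section \<open>Functions determined by their pairings\<close>

text \<open>Half-lines form a generator closed under intersection, so vanishing spreads to all Borel
  sets by a Dynkin argument; the total integral serves the complements.\<close>

lemma AE_zero_of_initial_integrals:
  fixes f :: "real \<Rightarrow> complex"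
  assumes f: "integrable lborel f" and tot: "(LBINT x. f x) = 0" and init: "\<And>a. (LBINT x:{..a}. f x) = 0"
  shows "AE x in lborel. f x = 0"
proof (rule sigma_finite_measure.density_zero[OF lborel.sigma_finite_measure_axioms f])
  fix A :: "real set" assume "A \<in> sets lborel"
  hence A: "A \<in> sigma_sets UNIV (range (\<lambda>a. {..a}))"
    by (simp add: borel_eq_atMost)
  have "Int_stable (range (\<lambda>a::real. {..a}))"
    by (auto simp: Int_stable_def)
  moreover have "range (\<lambda>a::real. {..a}) \<subseteq> Pow UNIV" by simp
  ultimately show "(LBINT x:A. f x) = 0"
    using A
  proof (induction rule: sigma_sets_induct_disjoint)
    case (basic B)
    thus ?case using init by auto
  next
    case empty
    show ?case by (simp add: set_lebesgue_integral_def)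
  next
    case (compl B)
    hence B: "B \<in> sets borel" by (simp add: borel_eq_atMost)
    have "(LBINT x. f x) = (LBINT x. indicator B x *\<^sub>R f x + indicator (UNIV - B) x *\<^sub>R f x)"
      by (intro Bochner_Integration.integral_cong) (auto split: split_indicator)
    also have "\<dots> = (LBINT x:B. f x) + (LBINT x:UNIV - B. f x)"
      unfolding set_lebesgue_integral_def
      using f B by (intro Bochner_Integration.integral_add integrable_mult_indicator) auto
    finally show ?case using tot compl by simp
  next
    case (union B)
    hence B: "B i \<in> sets lborel" for i by (auto simp: borel_eq_atMost)
    have U: "(\<Union>i. B i) \<in> sets lborel" using B by auto
    have "(LBINT x:(\<Union>i. B i). f x) = (\<Sum>i. (LBINT x:B i. f x))"
    proof (rule lebesgue_integral_countable_add)
      show "set_integrable lborel (\<Union>i. B i) f"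
        unfolding set_integrable_def using f U by (intro integrable_mult_indicator)
      show "B i \<inter> B j = {}" if "i \<noteq> j" for i j
        using union(1) that by (auto simp: disjoint_family_on_def)
    qed (use B in auto)
    thus ?case using union(3) by simp
  qed
qed

text \<open>Ramps that are 1 up to a and 0 from a + 1 / (n + 1) on converge on the half-line to the
  indicator of (0, a]. Dominated convergence on (0, a + 1] gives the vanishing of all initial
  integrals.\<close>

lemma AE_zero_of_test_integrals:
  fixes z :: "real \<Rightarrow> complex" and b :: real
  assumes z: "\<And>c. set_integrable lborel {0<..c} z"
    and test: "\<And>\<tau>. decaying b \<tau> \<Longrightarrow> (\<exists>c. \<forall>x>c. \<tau> x = 0) \<Longrightarrow> (\<And>x. cmod (\<tau> x) \<le> 1) \<Longrightarrow> (LBINT x:{0<..}. z x * cnj (\<tau> x)) = 0"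
    and b: "b > 0"
  shows "AE x in lborel. x > 0 \<longrightarrow> z x = 0"
proof -
  have init: "(LBINT x:{0<..a}. z x) = 0" if a: "a > 0" for a
  proof -
    define \<tau> where "\<tau> n x = complex_of_real (max 0 (min 1 (1 - (real n + 1) * (x - a))))" for n x
    have supp: "\<tau> n x = 0" if "x > a + 1" for n x
    proof -
      have "1 * 1 \<le> (real n + 1) * (x - a)" using that by (intro mult_mono) auto
      thus ?thesis unfolding \<tau>_def by simp
    qed
    have bd: "cmod (\<tau> n x) \<le> 1" for n x unfolding \<tau>_def norm_of_real by auto
    have "decaying b (\<tau> n)" for n unfolding decaying_def
    proof (intro conjI exI allI impI)
      show "continuous_on UNIV (\<tau> n)" unfolding \<tau>_def by (intro continuous_intros)
      fix x :: real assume "x \<ge> 0"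
      \<comment> \<open>The ramp is at most 1 and vanishes beyond a + 1, which is exactly where e^(b
        (a + 1)) e^(- b x) drops below 1.\<close>
      show "cmod (\<tau> n x) \<le> exp (b * (a + 1)) * exp (- (b * x))"
      proof (cases "x \<le> a + 1")
        case True
        hence "1 \<le> exp (b * (a + 1) + - (b * x))" using b by (simp add: mult_left_mono)
        thus ?thesis using bd[of n x] unfolding exp_add by linarith
      qed (simp add: supp)
    qed
    hence 0: "(LBINT x. indicator {0<..} x *\<^sub>R (z x * cnj (\<tau> n x))) = 0" for n
      using test[of "\<tau> n"] supp[of _ n] bd[of n] unfolding set_lebesgue_integral_def by blast
    have zm: "(\<lambda>x. indicator {0<..a+1} x *\<^sub>R z x) \<in> borel_measurable lborel"
      using z[of "a + 1"] unfolding set_integrable_def by (rule borel_measurable_integrable)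
    have eq: "indicator {0<..} x *\<^sub>R (z x * cnj (\<tau> n x)) = (indicator {0<..a+1} x *\<^sub>R z x) * cnj (\<tau> n x)" for x n
      using supp[of x n] by (auto split: split_indicator)
    have [measurable]: "\<tau> n \<in> borel_measurable borel" for n unfolding \<tau>_def by measurable
    have "(\<lambda>n. LBINT x. indicator {0<..} x *\<^sub>R (z x * cnj (\<tau> n x))) \<longlonglongrightarrow> (LBINT x. indicator {0<..a} x *\<^sub>R z x)"
      unfolding eq
    proof (rule integral_dominated_convergence)
      show "(\<lambda>x. indicator {0<..a} x *\<^sub>R z x) \<in> borel_measurable lborel"
        using z[of a] unfolding set_integrable_def by (rule borel_measurable_integrable)
      show "(\<lambda>x. indicator {0<..a + 1} x *\<^sub>R z x * cnj (\<tau> n x)) \<in> borel_measurable lborel" for n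
        using zm by measurable
      show "integrable lborel (\<lambda>x. norm (indicator {0<..a+1} x *\<^sub>R z x))"
        using z[of "a + 1"] unfolding set_integrable_def by (rule Bochner_Integration.integrable_norm)
      show "AE x in lborel. norm (indicator {0<..a+1} x *\<^sub>R z x * cnj (\<tau> n x)) \<le> norm (indicator {0<..a+1} x *\<^sub>R z x)" for n
        unfolding norm_mult complex_mod_cnj by (intro always_eventually allI mult_left_le bd norm_ge_zero)
      show "AE x in lborel. (\<lambda>n. indicator {0<..a+1} x *\<^sub>R z x * cnj (\<tau> n x)) \<longlonglongrightarrow> indicator {0<..a} x *\<^sub>R z x"
      proof (intro always_eventually allI)
        fix x
        show "(\<lambda>n. indicator {0<..a+1} x *\<^sub>R z x * cnj (\<tau> n x)) \<longlonglongrightarrow> indicator {0<..a} x *\<^sub>R z x"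
        proof (cases "x \<le> a")
          case True
          hence "(real n + 1) * (x - a) \<le> 0" for n by (intro mult_nonneg_nonpos) auto
          hence "\<tau> n x = 1" for n unfolding \<tau>_def by (simp add: min_def max_def)
          thus ?thesis using True by (auto split: split_indicator)
        next
          case False
          obtain N :: nat where N: "1 / (x - a) < real N" using reals_Archimedean2 by blast
          have "\<tau> n x = 0" if "n \<ge> N" for n
          proof -
            have "1 / (x - a) < real n + 1" using N that by linarith
            hence "1 < (real n + 1) * (x - a)" using False by (simp add: pos_divide_less_eq)
            thus ?thesis unfolding \<tau>_def by simp
          qed
          hence "\<forall>\<^sub>F n in sequentially. indicator {0<..a+1} x *\<^sub>R z x * cnj (\<tau> n x) = 0"
            by (auto simp: eventually_sequentially)
          thus ?thesis using False by (simp add: tendsto_eventually)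
        qed
      qed
    qed
    thus ?thesis using LIMSEQ_unique[OF _ tendsto_const] unfolding 0 set_lebesgue_integral_def by metis
  qed
  have "AE x in lborel. indicator {0<..real n} x *\<^sub>R z x = 0" for n :: nat
  proof (rule AE_zero_of_initial_integrals)
    show "integrable lborel (\<lambda>x. indicator {0<..real n} x *\<^sub>R z x)"
      using z[of "real n"] by (simp add: set_integrable_def)
    have i: "(LBINT x:{0<..c}. z x) = 0" for c
    proof (cases "c > 0")
      case True
      thus ?thesis by (rule init)
    qed (simp add: set_lebesgue_integral_def)
    show "(LBINT x. indicator {0<..real n} x *\<^sub>R z x) = 0" using i[of "real n"] by (simp add: set_lebesgue_integral_def)
    fix a :: real
    have "(LBINT x:{..a}. indicator {0<..real n} x *\<^sub>R z x) = (LBINT x:{0<..min a (real n)}. z x)"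
      unfolding set_lebesgue_integral_def
      by (intro Bochner_Integration.integral_cong) (auto split: split_indicator)
    thus "(LBINT x:{..a}. indicator {0<..real n} x *\<^sub>R z x) = 0" using i by simp
  qed
  hence "AE x in lborel. \<forall>n::nat. indicator {0<..real n} x *\<^sub>R z x = 0" by (subst AE_all_countable) blast
  thus ?thesis
  proof eventually_elim
    case (elim x)
    obtain n :: nat where "x \<le> real n" using real_arch_simple by blast
    thus ?case using elim[rule_format, of n] by auto
  qed
qed

text \<open>One function is square-integrable, the other bounded; the difference may be neither, but
  it is integrable on each (0, c], as \<open>AE_zero_of_test_integrals\<close> demands.\<close>

lemma AE_eq_of_inner:
  fixes p q :: "real \<Rightarrow> complex ^ 'n::finite"
  assumes p: "p \<in> L2" and q: "\<And>j. (\<lambda>x. q x $ j) \<in> borel_measurable borel" "\<And>j. \<exists>B. \<forall>x. cmod (q x $ j) \<le> B"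
    and b: "b > 0" and eq: "\<And>w. vdecaying b w \<Longrightarrow> l2_inner p w = l2_inner q w"
  shows "AE x in half_line. \<forall>j. p x $ j = q x $ j"
proof -
  have "AE x in lborel. x > 0 \<longrightarrow> p x $ j - q x $ j = 0" for j
  proof (rule AE_zero_of_test_integrals[OF _ _ b])
    have pj: "(\<lambda>x. p x $ j) \<in> L2" by (rule L2_comp[OF p])
    have pm: "(\<lambda>x. indicator {0<..} x *\<^sub>R p x $ j) \<in> borel_measurable lborel"
      using pj by (simp add: L2_def borel_measurable_restrict_space_iff)
    have p2: "integrable lborel (\<lambda>x. indicator {0<..} x *\<^sub>R (cmod (p x $ j))\<^sup>2)"
      using pj by (simp add: L2_def half_line_integrable set_integrable_def)
    obtain B where B: "\<And>x. cmod (q x $ j) \<le> B" using q(2) by blast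
    show "set_integrable lborel {0<..c} (\<lambda>x. p x $ j - q x $ j)" for c
    proof (rule set_integral_diff)
      have ic: "integrable lborel (indicator {0<..c} :: real \<Rightarrow> real)"
        by (rule integrable_real_indicator, simp, cases "0 \<le> c") simp_all
      show "set_integrable lborel {0<..c} (\<lambda>x. p x $ j)"
        unfolding set_integrable_def
      proof (rule Bochner_Integration.integrable_bound)
        show "integrable lborel (\<lambda>x. indicator {0<..c} x + indicator {0<..} x *\<^sub>R (cmod (p x $ j))\<^sup>2)"
          using ic p2 by (rule Bochner_Integration.integrable_add)
        have "(\<lambda>x. indicator {0<..c} x *\<^sub>R (indicator {0<..} x *\<^sub>R p x $ j)) \<in> borel_measurable lborel"
          using pm by measurable
        moreover have "(\<lambda>x. indicator {0<..c} x *\<^sub>R (indicator {0<..} x *\<^sub>R p x $ j)) = (\<lambda>x. indicator {0<..c} x *\<^sub>R p x $ j)"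
          by (auto split: split_indicator)
        ultimately show "(\<lambda>x. indicator {0<..c} x *\<^sub>R p x $ j) \<in> borel_measurable lborel" by simp
        have "t \<le> 1 + t\<^sup>2" if "t \<ge> 0" for t :: real
          using zero_le_power2[of "t - 1"] that by (simp add: power2_diff)
        thus "AE x in lborel. norm (indicator {0<..c} x *\<^sub>R p x $ j) \<le> norm (indicator {0<..c} x + indicator {0<..} x *\<^sub>R (cmod (p x $ j))\<^sup>2)"
          by (auto split: split_indicator)
      qed
      show "set_integrable lborel {0<..c} (\<lambda>x. q x $ j)"
        unfolding set_integrable_def
      proof (rule Bochner_Integration.integrable_bound)
        show "integrable lborel (\<lambda>x. indicator {0<..c} x * B)"
          using ic by (rule Bochner_Integration.integrable_mult_left)
        show "(\<lambda>x. indicator {0<..c} x *\<^sub>R q x $ j) \<in> borel_measurable lborel" using q(1)[of j] by measurable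
        show "AE x in lborel. norm (indicator {0<..c} x *\<^sub>R q x $ j) \<le> norm (indicator {0<..c} x * B)"
          using order_trans[OF B abs_ge_self] by (auto split: split_indicator)
      qed
    qed
    fix \<tau> :: "real \<Rightarrow> complex" assume \<tau>: "decaying b \<tau>"
    \<comment> \<open>The scalar test function is placed on edge j alone, which singles out one
      component of the pairing.\<close>
    define w where "w x = (\<chi> l. if l = j then \<tau> x else 0)" for x
    have "decaying b (\<lambda>_. 0)" by (auto simp: decaying_def intro!: exI[of _ 0])
    hence "decaying b (\<lambda>x. if l = j then \<tau> x else 0)" for l using \<tau> by (cases "l = j") simp_all
    hence w: "vdecaying b w" unfolding vdecaying_def w_def by simp
    have wj: "(\<Sum>l\<in>UNIV. h x $ l * cnj (w x $ l)) = h x $ j * cnj (\<tau> x)" for h :: "real \<Rightarrow> complex ^ 'n" and x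
      unfolding w_def by (simp add: if_distrib[of cnj] if_distrib[of "\<lambda>z. _ * z"] cong: if_cong)
    have ip: "set_integrable lborel {0<..} (\<lambda>x. p x $ j * cnj (\<tau> x))"
      using l2_inner_integrable[OF p vdecaying_L2[OF w b]] unfolding wj half_line_integrable .
    have iq: "set_integrable lborel {0<..} (\<lambda>x. q x $ j * cnj (\<tau> x))"
      using bounded_mult_decaying_integrable[OF q(1) B \<tau> b] unfolding half_line_integrable .
    have "(LBINT x:{0<..}. p x $ j * cnj (\<tau> x)) = (LBINT x:{0<..}. q x $ j * cnj (\<tau> x))"
      using eq[OF w] unfolding l2_inner_def wj half_line_integral .
    thus "(LBINT x:{0<..}. (p x $ j - q x $ j) * cnj (\<tau> x)) = 0"
      unfolding left_diff_distrib by (subst set_integral_diff(2)[OF ip iq]) simp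
  qed
  hence "AE x in lborel. \<forall>j. x > 0 \<longrightarrow> p x $ j - q x $ j = 0"
    by (rule eventually_all_finite)
  hence "AE x in lborel. x \<in> {0<..} \<longrightarrow> (\<forall>j. p x $ j = q x $ j)"
    by eventually_elim auto
  thus ?thesis by (subst AE_restrict_space_iff) auto
qed

section \<open>Identification of the spectral measure\<close>

text \<open>On the compact support f e^(b x) is bounded, whatever b is; so the rate can be fixed
  afterwards according to k.\<close>

lemma test_function_vdecaying:
  fixes f :: "real \<Rightarrow> complex ^ 'n::finite"
  assumes f: "test_function f"
  shows "vdecaying b f"
proof -
  obtain K where K: "compact K" "\<And>x. x \<notin> K \<Longrightarrow> f x = 0" and c: "continuous_on UNIV f"
    using test_function_derivative[OF f] by metis
  have "decaying b (\<lambda>x. f x $ j)" for j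
  proof -
    have cj: "continuous_on UNIV (\<lambda>x. f x $ j)" by (intro continuous_intros c)
    have "continuous_on UNIV (\<lambda>x. f x $ j * of_real (exp (b * x)))"
      by (intro continuous_intros c)
    hence "continuous_on K (\<lambda>x. f x $ j * of_real (exp (b * x)))"
      by (rule continuous_on_subset) simp
    from compact_imp_bounded[OF compact_continuous_image[OF this K(1)]]
    obtain C where C: "\<And>x. x \<in> K \<Longrightarrow> norm (f x $ j * of_real (exp (b * x))) \<le> C" by (auto simp: bounded_iff)
    have "cmod (f x $ j) \<le> max C 0 * exp (- (b * x))" for x
    proof (cases "x \<in> K")
      case True
      have "cmod (f x $ j) = norm (f x $ j * of_real (exp (b * x))) * exp (- (b * x))"
        by (simp add: norm_mult exp_minus)
      also have "\<dots> \<le> max C 0 * exp (- (b * x))" using C[OF True] by (intro mult_right_mono) auto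
      finally show ?thesis .
    qed (simp add: K(2))
    thus ?thesis using cj unfolding decaying_def by blast
  qed
  thus ?thesis by (simp add: vdecaying_def)
qed

lemma sigma_set_integral:
  "(LBINT w:{0..L}. sigma_S \<alpha> j l w x y) = (LBINT w. indicator {0..L} w * sigma_S \<alpha> j l w x y)"
  by (simp add: set_lebesgue_integral_def)

lemma star_spectral_quadratic:
  fixes f :: "real \<Rightarrow> complex ^ 'n::finite"
  assumes \<alpha>: "\<alpha> > 0" and lam: "lam > 0" and sp: "spectral_relation E (star_H \<alpha>)"
    and b: "b > 0" and k: "b < k" and kn: "real CARD('n) * k \<noteq> \<alpha>" and f: "vdecaying b f"
  shows "l2_inner (E {0..lam} f) f
    = l2_inner (kernel_op (\<lambda>j l x y. LBINT w:{0..sqrt lam}. sigma_S \<alpha> j l w x y) f) f"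
proof -
  interpret spectral_relation E "star_H \<alpha>" by (rule sp)
  have k0: "k > 0" using b k by simp
  define c where "c = k\<^sup>2"
  have c: "c > 0" using k0 by (simp add: c_def)
  have den: "c + w\<^sup>2 > 0" for w using c by (simp add: add_pos_nonneg)
  define \<sigma> where "\<sigma> w = (\<lambda>j l :: 'n. sigma_S \<alpha> j l w)" for w
  \<comment> \<open>One function u carries three descriptions of R g: by the relation, by the kernel
    and by its behaviour under \<sigma>. The first gives the spectral moments of the iterates, the
    other two their frequency integrals.\<close>
  define \<Psi> where "\<Psi> g u \<longleftrightarrow> vdecaying b u \<and> star_H \<alpha> u (\<lambda>x. 1 *s g x + (- of_real c) *s u x) \<and>
      (\<forall>x\<ge>0. u x = kernel_op (resolvent_kernel \<alpha> k) g x) \<and>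
      (\<forall>w x. of_real (c + w\<^sup>2) *s kernel_op (\<sigma> w) u x = kernel_op (\<sigma> w) g x)" for g u :: "real \<Rightarrow> complex ^ 'n"
  have ex: "\<exists>u. \<Psi> g u" if g: "vdecaying b g" for g
  proof (rule star_resolvent[OF \<alpha> b k g], goal_cases)
    case (1 u v d)
    have "star_H \<alpha> u (\<lambda>x. 1 *s g x + (- of_real c) *s u x)"
    proof (rule star_H_classical[OF 1(3) _ vdecayingD[OF 1(1)] vdecayingD[OF 1(2)] _ b 1(5,6)])
      show "decaying b (\<lambda>x. (1 *s g x + (- of_real c) *s u x) $ j)" for j
        by (rule vdecayingD[OF vdecaying_lin[OF g 1(1)]])
      show "((\<lambda>x. v x $ j) has_vector_derivative - ((1 *s g x + (- of_real c) *s u x) $ j)) (at x)" for j x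
        using 1(4)[of j x] by (simp add: c_def)
    qed
    thus ?case unfolding \<Psi>_def c_def \<sigma>_def
      using 1 kernel_op_sigma_resolvent[OF \<alpha> b 1(1,2) g 1(3,4,5,6)] by blast
  qed
  define R where "R g = (SOME u. \<Psi> g u)" for g
  have R: "\<Psi> g (R g)" if "vdecaying b g" for g unfolding R_def by (rule someI_ex[OF ex[OF that]])
  define g where "g n = (R ^^ n) f" for n
  have g0: "g 0 = f" and gS: "g (Suc n) = R (g n)" for n by (simp_all add: g_def)
  have dec: "vdecaying b (g n)" for n
  proof (induction n)
    case (Suc n)
    thus ?case using R[of "g n"] by (simp add: gS \<Psi>_def)
  qed (simp add: g0 f)
  have \<Psi>: "\<Psi> (g n) (g (Suc n))" for n unfolding gS by (rule R[OF dec])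
  have L: "g n \<in> L2" for n by (rule vdecaying_L2[OF dec b])
  have H: "star_H \<alpha> (g (Suc n)) (\<lambda>x. 1 *s g n x + (- of_real c) *s g (Suc n) x)" for n
    using \<Psi> by (simp add: \<Psi>_def)
  have sets': "sets (\<mu> (g n)) = sets borel" and fin': "finite_measure (\<mu> (g n))" for n
    by (simp_all add: finite_\<mu> L)
  have step: "\<mu> (g n) = density (\<mu> (g (Suc n))) (\<lambda>t. ennreal ((c + t)\<^sup>2))" for n
    by (rule \<mu>_shift[OF H L])
  \<comment> \<open>R is symmetric because the relation is: the terms with the real factor c agree
    on both sides and drop out.\<close>
  have shift: "l2_inner (g m) (g (Suc n)) = l2_inner (g (Suc m)) (g n)" for m n
  proof -
    have "l2_inner (\<lambda>x. 1 *s g m x + (- of_real c) *s g (Suc m) x) (g (Suc n))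
       = l2_inner (g (Suc m)) (\<lambda>x. 1 *s g n x + (- of_real c) *s g (Suc n) x)"
      by (rule A_symmetric[OF H H])
    thus ?thesis unfolding l2_inner_lin_left[OF L L L] l2_inner_lin_right[OF L L L] by simp
  qed
  have inner_add: "l2_inner (g m) (g n) = l2_inner (g (m + n)) f" for m n
    by (induction n arbitrary: m) (simp_all add: g0 shift)
  define \<rho> where "\<rho> w = l2_inner (kernel_op (\<sigma> w) f) f" for w
  have \<rho>m: "\<rho> \<in> borel_measurable borel"
    unfolding \<rho>_def \<sigma>_def by (rule sigma_inner_bounded_measurable(1)[OF f f b])
  obtain B where B: "\<And>w. cmod (\<rho> w) \<le> B"
    using sigma_inner_bounded_measurable(2)[OF f f b] unfolding \<rho>_def \<sigma>_def by blast
  have kg: "kernel_op (\<sigma> w) (g n) x = of_real ((1 / (c + w\<^sup>2)) ^ n) *s kernel_op (\<sigma> w) f x" for n w x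
  proof (induction n)
    case (Suc n)
    have "kernel_op (\<sigma> w) (g (Suc n)) x = of_real (1 / (c + w\<^sup>2)) *s (of_real (c + w\<^sup>2) *s kernel_op (\<sigma> w) (g (Suc n)) x)"
      using den[of w] by (simp add: vec_eq_iff mult.assoc[symmetric] flip: of_real_mult of_real_add of_real_power of_real_divide)
    also have "of_real (c + w\<^sup>2) *s kernel_op (\<sigma> w) (g (Suc n)) x = kernel_op (\<sigma> w) (g n) x"
      using \<Psi>[of n] unfolding \<Psi>_def by blast
    finally show ?case unfolding Suc.IH by (simp add: vector_smult_assoc)
  qed (simp add: g0)
  \<comment> \<open>Only the outermost resolvent is expanded through its kernel; it supplies the
    integrable weight 1 / (c + w^2), and this is why n \<ge> 1. The remaining m powers come out of
    \<sigma> by \<open>kg\<close>.\<close>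
  have mom: "l2_inner (g n) f = (LBINT w:{0..}. of_real ((1 / (c + w\<^sup>2)) ^ n) * \<rho> w)" if n: "n \<ge> 1" for n
  proof -
    obtain m where m: "n = Suc m" using n by (cases n) auto
    define p where "p w = indicator {0..} w * (1 / (c + w\<^sup>2))" for w :: real
    have p: "integrable lborel p"
      using set_integrable_inverse_add_square[OF c] unfolding p_def set_integrable_def by simp
    have "l2_inner (g n) f = l2_inner (kernel_op (\<lambda>j l x y. LBINT w. p w * sigma_S \<alpha> j l w x y) (g m)) f"
    proof -
      have r: "resolvent_kernel \<alpha> k j l x y = (LBINT w. p w * sigma_S \<alpha> j l w x y)" if "x > 0" "y > 0" for j l :: 'n and x y
        using has_integral_sigma_S[OF \<alpha> k0 kn, of x y j l] that
        unfolding p_def c_def by (simp add: has_bochner_integral_iff mult.assoc)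
      have "g n x = kernel_op (\<lambda>j l x y. LBINT w. p w * sigma_S \<alpha> j l w x y) (g m) x" if x: "x > 0" for x
      proof -
        have "g n x = kernel_op (resolvent_kernel \<alpha> k) (g m) x"
          using \<Psi>[of m] x unfolding \<Psi>_def m by simp
        also have "\<dots> = kernel_op (\<lambda>j l x y. LBINT w. p w * sigma_S \<alpha> j l w x y) (g m) x"
          unfolding kernel_op_def
          by (simp add: vec_eq_iff, intro allI sum.cong refl Bochner_Integration.integral_cong) (simp add: r x)
        finally show ?thesis .
      qed
      thus ?thesis unfolding l2_inner_def by (intro Bochner_Integration.integral_cong refl) simp
    qed
    also have "\<dots> = (LBINT w. of_real (p w) * l2_inner (kernel_op (\<sigma> w) (g m)) f)"
      unfolding \<sigma>_def by (rule sigma_integral_inner[OF p dec f b])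
    also have "\<dots> = (LBINT w. indicator {0..} w *\<^sub>R (of_real ((1 / (c + w\<^sup>2)) ^ n) * \<rho> w))"
    proof (intro Bochner_Integration.integral_cong refl)
      fix w
      have "l2_inner (kernel_op (\<sigma> w) (g m)) f = of_real ((1 / (c + w\<^sup>2)) ^ m) * \<rho> w"
        unfolding \<rho>_def l2_inner_def kg
        by (subst Bochner_Integration.integral_mult_right_zero[symmetric]) (simp add: sum_distrib_left mult.assoc)
      thus "of_real (p w) * l2_inner (kernel_op (\<sigma> w) (g m)) f = indicator {0..} w *\<^sub>R (of_real ((1 / (c + w\<^sup>2)) ^ n) * \<rho> w)"
        unfolding p_def m by (simp add: mult.assoc split: split_indicator)
    qed
    finally show ?thesis by (simp add: set_lebesgue_integral_def)
  qed
  have int: "integrable (\<mu> f) (\<lambda>t. (1 / (c + t)) ^ n) \<and> complex_of_real (\<integral>t. (1 / (c + t)) ^ n \<partial>\<mu> f) = l2_inner (g n) f"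
    if n: "n \<ge> 1" for n
  proof -
    note D = density_chain_moments[of "\<lambda>n. \<mu> (g n)" c, OF sets' fin' step, unfolded g0]
    \<comment> \<open>Even moments are squared norms of g m; odd ones are <(H + c) g m, g m> = <g (m
      - 1), g m>. Both reduce to <g n, f> by \<open>inner_add\<close>.\<close>
    consider m where "n = 2 * m" "m \<ge> 1" | m where "n = 2 * m - 1" "m \<ge> 1"
    proof (cases "even n")
      case True
      then obtain m where "n = 2 * m" by blast
      thus thesis using n that(1)[of m] by simp
    next
      case False
      then obtain m where "n = 2 * m + 1" by (elim oddE)
      thus thesis using that(2)[of "m + 1"] by simp
    qed
    thus ?thesis
    proof cases
      case (1 m)
      have "of_real (\<integral>t. (1 / (c + t)) ^ n \<partial>\<mu> f) = l2_inner (g m) (g m)"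
        unfolding 1 D(2) l2_inner_self by (simp add: measure_\<mu>_UNIV L)
      thus ?thesis using D(1)[of m] unfolding 1 inner_add by (simp add: mult_2)
    next
      case (2 m)
      then obtain i where i: "m = Suc i" by (cases m) auto
      have it: "integrable (\<mu> (g m)) (\<lambda>t. t)" unfolding i by (rule integrable_id[OF H])
      interpret M: finite_measure "\<mu> (g m)" by (rule fin')
      have "complex_of_real (\<integral>t. c + t \<partial>\<mu> (g m)) = of_real c * l2_inner (g m) (g m) + of_real (\<integral>t. t \<partial>\<mu> (g m))"
        using it by (simp add: l2_inner_self measure_\<mu>_UNIV L)
      also have "of_real (\<integral>t. t \<partial>\<mu> (g m)) = l2_inner (\<lambda>x. 1 *s g i x + (- of_real c) *s g m x) (g m)"
        using A_form[OF H[of i]] unfolding i by simp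
      also have "of_real c * l2_inner (g m) (g m) + \<dots> = l2_inner (g i) (g m)"
        unfolding l2_inner_lin_left[OF L L L] by simp
      also have "\<dots> = l2_inner (g n) f" unfolding inner_add 2(1) i by (simp add: mult_2)
      finally have e: "complex_of_real (\<integral>t. c + t \<partial>\<mu> (g m)) = l2_inner (g n) f" .
      show ?thesis using D(3)[OF 2(2) it] D(4)[OF 2(2) it] e unfolding 2(1) by simp
    qed
  qed
  have "complex_of_real (measure (\<mu> f) {0..lam}) = (LBINT w:{0..sqrt lam}. \<rho> w)"
    by (rule measure_from_moments[OF _ _ c _ \<rho>m B])
       (use int mom lam fin'[of 0] sets'[of 0] in \<open>simp_all add: g0\<close>)
  moreover have "of_real (measure (\<mu> f) {0..lam}) = l2_inner (E {0..lam} f) f"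
    using norm_square_eq[of "{0..lam}" f] L[of 0] by (simp add: measure_\<mu> g0)
  moreover have "(LBINT w:{0..sqrt lam}. \<rho> w) = l2_inner (kernel_op (\<lambda>j l x y. LBINT w:{0..sqrt lam}. sigma_S \<alpha> j l w x y) f) f"
  proof -
    have p: "integrable lborel (indicator {0..sqrt lam} :: real \<Rightarrow> real)"
      by (rule integrable_real_indicator) (auto simp: emeasure_lborel_Icc_eq)
    show ?thesis unfolding sigma_set_integral sigma_integral_inner[OF p f f b] \<rho>_def \<sigma>_def
      by (simp add: set_lebesgue_integral_def scaleR_conv_of_real)
  qed
  ultimately show ?thesis by simp
qed

theorem mainTheorem4:
  fixes \<alpha> lam :: real
    and E :: "real set \<Rightarrow> (real \<Rightarrow> complex ^ 'n::finite) \<Rightarrow> (real \<Rightarrow> complex ^ 'n)"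
  assumes "\<alpha> > 0" and "lam > 0"
    and "spectral_measure_of (star_H \<alpha>) E"
  shows "has_kernel (E {0..lam})
           (\<lambda>j l x y. LBINT \<omega>:{0..sqrt lam}. sigma_S \<alpha> j l \<omega> x y)"
proof -
  \<comment> \<open>Any k > 0 with N k \<noteq> \<alpha> would do; here N k = 2 \<alpha>. The decay
    rate b has to lie strictly between 0 and k.\<close>
  define k where "k = 2 * \<alpha> / real CARD('n)"
  define b where "b = k / 2"
  have k: "k > 0" "b > 0" "b < k" "real CARD('n) * k \<noteq> \<alpha>"
  proof -
    show 1: "k > 0" using assms(1) by (simp add: k_def)
    show "b > 0" "b < k" using 1 by (simp_all add: b_def)
    show "real CARD('n) * k \<noteq> \<alpha>" using assms(1) by (simp add: k_def)
  qed
  have sp: "spectral_relation E (star_H \<alpha>)"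
    using assms(3) star_H_L2 star_H_lin
    by unfold_locales (auto simp: spectral_measure_of_def)
  interpret spectral_relation E "star_H \<alpha>" by (rule sp)
  let ?P = "E {0..lam}"
  define r :: "'n \<Rightarrow> 'n \<Rightarrow> real \<Rightarrow> real \<Rightarrow> real" where
    "r = (\<lambda>j l x y. LBINT \<omega>:{0..sqrt lam}. sigma_S \<alpha> j l \<omega> x y)"
  have r: "bounded_kernel r"
    unfolding r_def sigma_set_integral
    by (rule bounded_kernel_sigma_integral, rule integrable_real_indicator) (auto simp: emeasure_lborel_Icc_eq)
  have P: "u \<in> L2 \<Longrightarrow> ?P u \<in> L2" for u by (rule L2) simp_all
  have quad: "l2_inner (?P f) f = l2_inner (kernel_op r f) f" if "vdecaying b f" for f
    unfolding r_def by (rule star_spectral_quadratic[OF assms(1,2) sp k(2,3,4) that])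
  \<comment> \<open>Both sides are sesquilinear, so agreement of the quadratic forms at f + c g for
    c = 1 and c = i separates the two mixed terms.\<close>
  have polar: "l2_inner (?P f) g = l2_inner (kernel_op r f) g" if f: "vdecaying b f" and g: "vdecaying b g" for f g
  proof -
    have Lf: "f \<in> L2" and Lg: "g \<in> L2" using vdecaying_L2[OF f k(2)] vdecaying_L2[OF g k(2)] by auto
    have *: "cnj c * l2_inner (?P f) g + c * l2_inner (?P g) f
        = cnj c * l2_inner (kernel_op r f) g + c * l2_inner (kernel_op r g) f" for c
    proof -
      let ?h = "\<lambda>x. 1 *s f x + c *s g x"
      have h: "vdecaying b ?h" by (rule vdecaying_lin[OF f g])
      have Lh: "?h \<in> L2" by (rule L2_lin[OF Lf Lg])
      have "l2_inner (?P ?h) ?h = l2_inner (\<lambda>x. 1 *s ?P f x + c *s ?P g x) ?h"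
        by (rule l2_inner_cong[OF lin[OF _ Lf Lg] l2_eq_refl P[OF Lh] L2_lin[OF P[OF Lf] P[OF Lg]] Lh Lh]) simp
      also have "\<dots> = l2_inner (?P f) f + cnj c * l2_inner (?P f) g + c * l2_inner (?P g) f + c * cnj c * l2_inner (?P g) g"
        unfolding l2_inner_lin_left[OF P[OF Lf] P[OF Lg] Lh] l2_inner_lin_right[OF Lf Lg P[OF Lf]] l2_inner_lin_right[OF Lf Lg P[OF Lg]]
        by (simp add: algebra_simps)
      finally have 1: "l2_inner (kernel_op r ?h) ?h = \<dots>" unfolding quad[OF h] .
      have "l2_inner (kernel_op r ?h) ?h = l2_inner (kernel_op r f) f + cnj c * l2_inner (kernel_op r f) g
          + c * l2_inner (kernel_op r g) f + c * cnj c * l2_inner (kernel_op r g) g"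
        unfolding kernel_op_inner_lin_left[OF r f g h k(2)] kernel_op_inner_lin_right[OF r f g f k(2)]
          kernel_op_inner_lin_right[OF r f g g k(2)]
        by (simp add: algebra_simps)
      with 1 show ?thesis unfolding quad[OF f] quad[OF g] by simp
    qed
    from *[of 1] *[of \<i>] show ?thesis by (simp add: complex_eq_iff)
  qed
  have "has_kernel ?P r"
    unfolding has_kernel_def
  proof (intro allI impI conjI)
    fix f :: "real \<Rightarrow> complex ^ 'n" assume "test_function f"
    hence f: "vdecaying b f" by (rule test_function_vdecaying)
    show "integrable half_line (\<lambda>y. of_real (r j l x y) * f y $ l)" for j l x
      using kernel_mult_integrable[OF r f k(2)] by (simp add: half_line_integrable)
    \<comment> \<open>\<open>polar\<close> tests against decaying functions only; these already
      determine both sides almost everywhere.\<close>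
    have "AE x in half_line. \<forall>j. ?P f x $ j = kernel_op r f x $ j"
      by (rule AE_eq_of_inner[OF P[OF vdecaying_L2[OF f k(2)]] kernel_op_bounded(1)[OF r f k(2)]
            kernel_op_bounded(2)[OF r f k(2)] k(2) polar[OF f]])
    thus "AE x in half_line. \<forall>j. ?P f x $ j = (\<Sum>l\<in>UNIV. \<integral>y. of_real (r j l x y) * f y $ l \<partial>half_line)"
      by (simp add: kernel_op_def)
  qed
  thus ?thesis unfolding r_def .
qed

end
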